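(* Let $\mathscr Q\xrightarrow{\psi}\mathscr R\xrightarrow{\phi}\mathscr S$ be additive functors between small preadditive categories. The extension of scalars $\phi^*:\mathcal M_{\mathscr R}\to\mathcal M_{\mathscr S}$ is heavily $\psi_*$-separable, where $\psi_*:\mathcal M_{\mathscr R}\to\mathcal M_{\mathscr Q}$ is the restriction of scalars, if and only if there is a morphism $\alpha:\mathscr S(\phi(\psi(-)),\phi(-))\to\mathscr R(\psi(-),-)$ of $(\mathscr R,\mathscr Q)$-bimodules such that (1) $\alpha\circ\phi_{\psi(-),-}=\mathrm{id}$, and (2) for every $a\in\mathscr Q$, $b,c\in\mathscr R$, and every $f\in\mathscr S(\phi(\psi(a)),\phi(b))$, $g\in\mathscr S(\phi(b),\phi(c))$, $$\alpha_{a,c}(g\circ f)=\alpha_{a,c}\big(g\circ\phi(\alpha_{a,b}(f))\big).$$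
   Context: For a small preadditive category $\mathscr R$, $\mathcal M_{\mathscr R}$ denotes the category of right $\mathscr R$-modules, i.e. additive functors $\mathscr R^{op}\to\mathbf{Ab}$; left modules are additive functors $\mathscr R\to\mathbf{Ab}$. For a right module $\mathscr M$ and a left module $\mathscr N$, $\mathscr M\otimes_{\mathscr R}\mathscr N$ is the quotient of $\bigoplus_{a\in Ob(\mathscr R)}\mathscr M(a)\otimes_{\mathbb Z}\mathscr N(a)$ by the subgroup generated by all $\mathscr M(r)(x)\otimes y-x\otimes\mathscr N(r)(y)$ with $r\in\mathscr R(a,b)$, $x\in\mathscr M(b)$, $y\in\mathscr N(a)$. For an additive functor $\phi:\mathscr R\to\mathscr S$, the restriction of scalars is $\phi_*:\mathcal M_{\mathscr S}\to\mathcal M_{\mathscr R}$, $\mathscr N\mapsto\mathscr N\circ\phi$, and its left adjoint, the extension of scalars, is $\phi^*:\mathcal M_{\mathscr R}\to\mathcal M_{\mathscr S}$, $\mathscr M\mapsto\mathscr M\otimes_{\mathscr R}\mathscr S(-,\phi(?))$ (tensor over the variable $?$). An $(\mathscr R,\mathscr Q)$-bimodule is a left $\mathscr Q^{op}\otimes\mathscr R$-module, i.e. an additive functor $\mathscr Q^{op}\otimes\mathscr R\to\mathbf{Ab}$, where $\mathscr Q^{op}\otimes\mathscr R$ has objects pairs $(a,b)$ and morphism groups given by tensor products over $\mathbb Z$. The bimodule $\mathscr S(\phi(\psi(-)),\phi(-))$ sends $(a,b)$ to $\mathscr S(\phi(\psi(a)),\phi(b))$ and $\mathscr R(\psi(-),-)$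 sends $(a,b)$ to $\mathscr R(\psi(a),b)$. A morphism $\alpha$ has components $\alpha_{a,b}$. The bimodule morphism $\phi_{\psi(-),-}:\mathscr R(\psi(-),-)\to\mathscr S(\phi(\psi(-)),\phi(-))$ is given by $r\mapsto\phi(r)$. Definition (heavy $I$-separability). Let $F:\mathcal C\to\mathcal D$ and $I:\mathcal C\to\mathcal X$ be functors. $F$ is heavily $I$-separable if there is a natural transformation $P:\mathcal D(F(-),F(-))\to\mathcal X(I(-),I(-))$ of functors $\mathcal C^{op}\times\mathcal C\to \mathrm{Set}$ such that (a) $P_{a,b}(F(f))=I(f)$ for all $f\in\mathcal C(a,b)$; and (b) $P_{a,c}(g\circ f)=P_{b,c}(g)\circ P_{a,b}(f)$ for all $f\in\mathcal D(Fa,Fb)$, $g\in\mathcal D(Fb,Fc)$. *)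

theory Defs
  imports "HOL-Algebra.Free_Abelian_Groups"
begin

text \<open>
  Hom-sets are indexed by source and target and need not be disjoint, so identities, composition
  and the action of a functor on arrows carry the objects as arguments:
  \<open>Comp C a b c g f\<close> is the composite of \<open>f : a \<rightarrow> b\<close> followed by \<open>g : b \<rightarrow> c\<close>.
  Abelian groups are \<open>comm_group\<close>s of HOL-Algebra, hence written multiplicatively.
\<close>

section \<open>Categories and functors\<close>

record ('o, 'a) category =
  Ob :: "'o set"
  Hom :: "'o \<Rightarrow> 'o \<Rightarrow> 'a set"
  Ident :: "'o \<Rightarrow> 'a"
  Comp :: "'o \<Rightarrow> 'o \<Rightarrow> 'o \<Rightarrow> 'a \<Rightarrow> 'a \<Rightarrow> 'a"

locale category =
  fixes C :: "('o, 'a, 'z) category_scheme" (structure)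
  assumes Ident_in_Hom: "a \<in> Ob C \<Longrightarrow> Ident C a \<in> Hom C a a"
    and Comp_in_Hom: "\<lbrakk>a \<in> Ob C; b \<in> Ob C; c \<in> Ob C; f \<in> Hom C a b; g \<in> Hom C b c\<rbrakk>
      \<Longrightarrow> Comp C a b c g f \<in> Hom C a c"
    and Comp_Ident_right: "\<lbrakk>a \<in> Ob C; b \<in> Ob C; f \<in> Hom C a b\<rbrakk>
      \<Longrightarrow> Comp C a a b f (Ident C a) = f"
    and Comp_Ident_left: "\<lbrakk>a \<in> Ob C; b \<in> Ob C; f \<in> Hom C a b\<rbrakk>
      \<Longrightarrow> Comp C a b b (Ident C b) f = f"
    and Comp_assoc: "\<lbrakk>a \<in> Ob C; b \<in> Ob C; c \<in> Ob C; d \<in> Ob C;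
        f \<in> Hom C a b; g \<in> Hom C b c; h \<in> Hom C c d\<rbrakk>
      \<Longrightarrow> Comp C a c d h (Comp C a b c g f) = Comp C a b d (Comp C b c d h g) f"

record ('o, 'a) preadditive = "('o, 'a) category" +
  HomGrp :: "'o \<Rightarrow> 'o \<Rightarrow> 'a monoid"

locale preadditive_category = category C
  for C :: "('o, 'a, 'z) preadditive_scheme" (structure) +
  assumes HomGrp_carrier: "\<lbrakk>a \<in> Ob C; b \<in> Ob C\<rbrakk> \<Longrightarrow> carrier (HomGrp C a b) = Hom C a b"
    and HomGrp_comm_group: "\<lbrakk>a \<in> Ob C; b \<in> Ob C\<rbrakk> \<Longrightarrow> comm_group (HomGrp C a b)"
    and Comp_add_left: "\<lbrakk>a \<in> Ob C; b \<in> Ob C; c \<in> Ob C; f \<in> Hom C a b; g \<in> Hom C b c; g' \<in> Hom C b c\<rbrakk>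
      \<Longrightarrow> Comp C a b c (g \<otimes>\<^bsub>HomGrp C b c\<^esub> g') f
        = Comp C a b c g f \<otimes>\<^bsub>HomGrp C a c\<^esub> Comp C a b c g' f"
    and Comp_add_right: "\<lbrakk>a \<in> Ob C; b \<in> Ob C; c \<in> Ob C; f \<in> Hom C a b; f' \<in> Hom C a b; g \<in> Hom C b c\<rbrakk>
      \<Longrightarrow> Comp C a b c g (f \<otimes>\<^bsub>HomGrp C a b\<^esub> f')
        = Comp C a b c g f \<otimes>\<^bsub>HomGrp C a c\<^esub> Comp C a b c g f'"

text \<open>
  An infinite type \<open>'u\<close> plays the role of the universe in which modules take their values (infinite,
  so that modules have finite direct sums).  Smallness is relative to it: the set of all arrows,
  tagged with source and target, embeds into \<open>'u\<close>.
\<close>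

definition small :: "'u itself \<Rightarrow> ('o, 'a, 'z) category_scheme \<Rightarrow> bool" where
  "small U C \<longleftrightarrow> (\<exists>j :: 'o \<times> 'o \<times> 'a \<Rightarrow> 'u.
     inj_on j {(a, b, f). a \<in> Ob C \<and> b \<in> Ob C \<and> f \<in> Hom C a b})"

definition opp :: "('o, 'a, 'z) preadditive_scheme \<Rightarrow> ('o, 'a) preadditive" where
  "opp C = \<lparr>Ob = Ob C, Hom = (\<lambda>a b. Hom C b a), Ident = Ident C,
            Comp = (\<lambda>a b c g f. Comp C c b a f g), HomGrp = (\<lambda>a b. HomGrp C b a)\<rparr>"

text \<open>The values of a functor off its source category are irrelevant and left unconstrained.\<close>

record ('o, 'a, 'p, 'b) cfun =
  on_ob :: "'o \<Rightarrow> 'p"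
  on_hom :: "'o \<Rightarrow> 'o \<Rightarrow> 'a \<Rightarrow> 'b"

definition is_functor ::
    "('o, 'a, 'y) category_scheme \<Rightarrow> ('p, 'b, 'z) category_scheme \<Rightarrow> ('o, 'a, 'p, 'b) cfun \<Rightarrow> bool" where
  "is_functor C D F \<longleftrightarrow>
     (\<forall>a\<in>Ob C. on_ob F a \<in> Ob D) \<and>
     (\<forall>a\<in>Ob C. \<forall>b\<in>Ob C. \<forall>f\<in>Hom C a b. on_hom F a b f \<in> Hom D (on_ob F a) (on_ob F b)) \<and>
     (\<forall>a\<in>Ob C. on_hom F a a (Ident C a) = Ident D (on_ob F a)) \<and>
     (\<forall>a\<in>Ob C. \<forall>b\<in>Ob C. \<forall>c\<in>Ob C. \<forall>f\<in>Hom C a b. \<forall>g\<in>Hom C b c.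
        on_hom F a c (Comp C a b c g f)
          = Comp D (on_ob F a) (on_ob F b) (on_ob F c) (on_hom F b c g) (on_hom F a b f))"

definition additive_functor ::
    "('o, 'a, 'y) preadditive_scheme \<Rightarrow> ('p, 'b, 'z) preadditive_scheme \<Rightarrow> ('o, 'a, 'p, 'b) cfun \<Rightarrow> bool" where
  "additive_functor C D F \<longleftrightarrow> is_functor C D F \<and>
     (\<forall>a\<in>Ob C. \<forall>b\<in>Ob C. on_hom F a b \<in> hom (HomGrp C a b) (HomGrp D (on_ob F a) (on_ob F b)))"

definition id_cfun :: "('o, 'a, 'o, 'a) cfun" where
  "id_cfun = \<lparr>on_ob = (\<lambda>a. a), on_hom = (\<lambda>a b f. f)\<rparr>"

definition comp_cfun :: "('p, 'b, 'q, 'c) cfun \<Rightarrow> ('o, 'a, 'p, 'b) cfun \<Rightarrow> ('o, 'a, 'q, 'c) cfun"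
    (infixl \<open>\<circ>\<^sub>F\<close> 55) where
  "G \<circ>\<^sub>F F = \<lparr>on_ob = (\<lambda>a. on_ob G (on_ob F a)),
             on_hom = (\<lambda>a b f. on_hom G (on_ob F a) (on_ob F b) (on_hom F a b f))\<rparr>"

section \<open>Heavy separability\<close>

definition heavily_separable ::
    "('o, 'a, 'x) category_scheme \<Rightarrow> ('p, 'b, 'y) category_scheme \<Rightarrow> ('q, 'c, 'z) category_scheme \<Rightarrow>
     ('o, 'a, 'p, 'b) cfun \<Rightarrow> ('o, 'a, 'q, 'c) cfun \<Rightarrow> bool" where
  "heavily_separable C D E F I \<longleftrightarrow> is_functor C D F \<and> is_functor C E I \<and>
     (\<exists>P.
       (\<forall>a\<in>Ob C. \<forall>b\<in>Ob C. P a b \<in> Hom D (on_ob F a) (on_ob F b) \<rightarrow> Hom E (on_ob I a) (on_ob I b)) \<and>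
       \<comment> \<open>naturality on \<open>C\<^sup>o\<^sup>p \<times> C\<close>\<close>
       (\<forall>a\<in>Ob C. \<forall>a'\<in>Ob C. \<forall>b\<in>Ob C. \<forall>b'\<in>Ob C. \<forall>u\<in>Hom C a' a. \<forall>v\<in>Hom C b b'.
          \<forall>h\<in>Hom D (on_ob F a) (on_ob F b).
          P a' b' (Comp D (on_ob F a') (on_ob F b) (on_ob F b') (on_hom F b b' v)
                    (Comp D (on_ob F a') (on_ob F a) (on_ob F b) h (on_hom F a' a u)))
          = Comp E (on_ob I a') (on_ob I b) (on_ob I b') (on_hom I b b' v)
              (Comp E (on_ob I a') (on_ob I a) (on_ob I b) (P a b h) (on_hom I a' a u))) \<and>
       (\<forall>a\<in>Ob C. \<forall>b\<in>Ob C. \<forall>f\<in>Hom C a b. P a b (on_hom F a b f) = on_hom I a b f) \<and>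
       (\<forall>a\<in>Ob C. \<forall>b\<in>Ob C. \<forall>c\<in>Ob C.
          \<forall>f\<in>Hom D (on_ob F a) (on_ob F b). \<forall>g\<in>Hom D (on_ob F b) (on_ob F c).
          P a c (Comp D (on_ob F a) (on_ob F b) (on_ob F c) g f)
          = Comp E (on_ob I a) (on_ob I b) (on_ob I c) (P b c g) (P a b f)))"

section \<open>Modules\<close>

definition ext_hom :: "('m, 'y) monoid_scheme \<Rightarrow> ('n, 'z) monoid_scheme \<Rightarrow> ('m \<Rightarrow> 'n) set" where
  "ext_hom G H = hom G H \<inter> extensional (carrier G)"

text \<open>The abelian groups with carrier in \<open>'m\<close>.\<close>

definition Ab :: "('m monoid, 'm \<Rightarrow> 'm) preadditive" where
  "Ab = \<lparr>Ob = {G. comm_group G}, Hom = ext_hom,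
         Ident = (\<lambda>G. \<lambda>x\<in>carrier G. x),
         Comp = (\<lambda>G H K g f. compose (carrier G) g f),
         HomGrp = (\<lambda>G H. \<lparr>carrier = ext_hom G H,
                            monoid.mult = (\<lambda>f g. \<lambda>x\<in>carrier G. f x \<otimes>\<^bsub>H\<^esub> g x),
                            one = (\<lambda>x\<in>carrier G. \<one>\<^bsub>H\<^esub>)\<rparr>)\<rparr>"

type_synonym ('o, 'a, 'm) modul = "('o, 'a, 'm monoid, 'm \<Rightarrow> 'm) cfun"

text \<open>
  Left \<open>C\<close>-modules are additive functors \<open>C \<rightarrow> Ab\<close>; right modules are left modules over \<open>opp C\<close>.
  Morphisms are the natural transformations; the two modules may take values in different types.
\<close>

definition mod_hom ::
    "('o, 'a, 'z) preadditive_scheme \<Rightarrow> ('o, 'a, 'm) modul \<Rightarrow> ('o, 'a, 'n) modul \<Rightarrow> ('o \<Rightarrow> 'm \<Rightarrow> 'n) set" where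
  "mod_hom C M N = {\<eta> \<in> \<Pi>\<^sub>E a\<in>Ob C. ext_hom (on_ob M a) (on_ob N a).
     \<forall>a\<in>Ob C. \<forall>b\<in>Ob C. \<forall>f\<in>Hom C a b.
       compose (carrier (on_ob M a)) (\<eta> b) (on_hom M a b f)
       = compose (carrier (on_ob M a)) (on_hom N a b f) (\<eta> a)}"

definition mod_id :: "('o, 'a, 'z) preadditive_scheme \<Rightarrow> ('o, 'a, 'm) modul \<Rightarrow> 'o \<Rightarrow> 'm \<Rightarrow> 'm" where
  "mod_id C M = (\<lambda>a\<in>Ob C. \<lambda>x\<in>carrier (on_ob M a). x)"

definition mod_comp ::
    "('o, 'a, 'z) preadditive_scheme \<Rightarrow> ('o, 'a, 'm) modul \<Rightarrow> ('o \<Rightarrow> 'n \<Rightarrow> 'k) \<Rightarrow> ('o \<Rightarrow> 'm \<Rightarrow> 'n) \<Rightarrow>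
     'o \<Rightarrow> 'm \<Rightarrow> 'k" where
  "mod_comp C M \<theta> \<eta> = (\<lambda>a\<in>Ob C. compose (carrier (on_ob M a)) (\<theta> a) (\<eta> a))"

definition left_modules ::
    "('o, 'a, 'z) preadditive_scheme \<Rightarrow> (('o, 'a, 'm) modul, 'o \<Rightarrow> 'm \<Rightarrow> 'm) category" where
  "left_modules C = \<lparr>Ob = {M. additive_functor C Ab M}, Hom = mod_hom C, Ident = mod_id C,
                     Comp = (\<lambda>L M N \<theta> \<eta>. mod_comp C L \<theta> \<eta>)\<rparr>"

definition right_modules ::
    "('o, 'a, 'z) preadditive_scheme \<Rightarrow> (('o, 'a, 'm) modul, 'o \<Rightarrow> 'm \<Rightarrow> 'm) category" where
  "right_modules C = left_modules (opp C)"

section \<open>Tensor products\<close>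

type_synonym ('m, 'n) tens = "('m \<times> 'n \<Rightarrow>\<^sub>0 int) set"

definition tensor_rels :: "'m monoid \<Rightarrow> 'n monoid \<Rightarrow> ('m \<times> 'n \<Rightarrow>\<^sub>0 int) set" where
  "tensor_rels G H =
     {frag_of (x \<otimes>\<^bsub>G\<^esub> x', y) - frag_of (x, y) - frag_of (x', y) | x x' y.
        x \<in> carrier G \<and> x' \<in> carrier G \<and> y \<in> carrier H} \<union>
     {frag_of (x, y \<otimes>\<^bsub>H\<^esub> y') - frag_of (x, y) - frag_of (x, y') | x y y'.
        x \<in> carrier G \<and> y \<in> carrier H \<and> y' \<in> carrier H}"

definition tensor_ker :: "'m monoid \<Rightarrow> 'n monoid \<Rightarrow> ('m \<times> 'n \<Rightarrow>\<^sub>0 int) set" where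
  "tensor_ker G H = generate (free_Abelian_group (carrier G \<times> carrier H)) (tensor_rels G H)"

definition tensor :: "'m monoid \<Rightarrow> 'n monoid \<Rightarrow> ('m, 'n) tens monoid" where
  "tensor G H = free_Abelian_group (carrier G \<times> carrier H) Mod tensor_ker G H"

definition pure_tensor :: "'m monoid \<Rightarrow> 'n monoid \<Rightarrow> 'm \<Rightarrow> 'n \<Rightarrow> ('m, 'n) tens" where
  "pure_tensor G H x y = tensor_ker G H #>\<^bsub>free_Abelian_group (carrier G \<times> carrier H)\<^esub> frag_of (x, y)"

text \<open>The homomorphism out of \<open>tensor G H\<close> induced by a \<open>\<int>\<close>-bilinear map \<open>\<beta>\<close>.\<close>

definition tensor_lift ::
    "'m monoid \<Rightarrow> 'n monoid \<Rightarrow> 'k monoid \<Rightarrow> ('m \<Rightarrow> 'n \<Rightarrow> 'k) \<Rightarrow> ('m, 'n) tens \<Rightarrow> 'k" where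
  "tensor_lift G H K \<beta> = (THE h. h \<in> ext_hom (tensor G H) K \<and>
     (\<forall>x\<in>carrier G. \<forall>y\<in>carrier H. h (pure_tensor G H x y) = \<beta> x y))"

text \<open>
  Composition in the tensor product of two preadditive categories is the biadditive extension of
  \<open>(g \<otimes> k) \<circ> (f \<otimes> h) = (g \<circ> f) \<otimes> (k \<circ> h)\<close>.
\<close>

definition tensor_category ::
    "('o, 'a, 'y) preadditive_scheme \<Rightarrow> ('p, 'b, 'z) preadditive_scheme \<Rightarrow>
     ('o \<times> 'p, ('a, 'b) tens) preadditive" where
  "tensor_category C D =
    (let T = (\<lambda>(a, b) (a', b'). tensor (HomGrp C a a') (HomGrp D b b')) in
     \<lparr>Ob = Ob C \<times> Ob D,
      Hom = (\<lambda>s t. carrier (T s t)),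
      Ident = (\<lambda>(a, b). pure_tensor (HomGrp C a a) (HomGrp D b b) (Ident C a) (Ident D b)),
      Comp = (\<lambda>(a, b) (a', b') (a'', b'') v u.
        tensor_lift (HomGrp C a' a'') (HomGrp D b' b'') (T (a, b) (a'', b''))
          (\<lambda>g k. tensor_lift (HomGrp C a a') (HomGrp D b b') (T (a, b) (a'', b''))
             (\<lambda>f h. pure_tensor (HomGrp C a a'') (HomGrp D b b'')
                (Comp C a a' a'' g f) (Comp D b b' b'' k h)) u) v),
      HomGrp = T\<rparr>)"

text \<open>For a right module \<open>M\<close> and a left module \<open>N\<close> over \<open>R\<close>.\<close>

type_synonym ('o, 'm, 'n) mtens = "('o \<Rightarrow> ('m, 'n) tens) set"

definition tensor_sum ::
    "('o, 'a, 'z) preadditive_scheme \<Rightarrow> ('o, 'a, 'm) modul \<Rightarrow> ('o, 'a, 'n) modul \<Rightarrow>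
     ('o \<Rightarrow> ('m, 'n) tens) monoid" where
  "tensor_sum R M N = sum_group (Ob R) (\<lambda>a. tensor (on_ob M a) (on_ob N a))"

definition tensor_summand ::
    "('o, 'a, 'z) preadditive_scheme \<Rightarrow> ('o, 'a, 'm) modul \<Rightarrow> ('o, 'a, 'n) modul \<Rightarrow>
     'o \<Rightarrow> 'm \<Rightarrow> 'n \<Rightarrow> 'o \<Rightarrow> ('m, 'n) tens" where
  "tensor_summand R M N a x y =
     (\<lambda>b\<in>Ob R. if b = a then pure_tensor (on_ob M b) (on_ob N b) x y
               else \<one>\<^bsub>tensor (on_ob M b) (on_ob N b)\<^esub>)"

definition mod_tensor_ker ::
    "('o, 'a, 'z) preadditive_scheme \<Rightarrow> ('o, 'a, 'm) modul \<Rightarrow> ('o, 'a, 'n) modul \<Rightarrow>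
     ('o \<Rightarrow> ('m, 'n) tens) set" where
  "mod_tensor_ker R M N = generate (tensor_sum R M N)
     {tensor_summand R M N a (on_hom M b a r x) y
        \<otimes>\<^bsub>tensor_sum R M N\<^esub> inv\<^bsub>tensor_sum R M N\<^esub> tensor_summand R M N b x (on_hom N a b r y) | a b r x y.
        a \<in> Ob R \<and> b \<in> Ob R \<and> r \<in> Hom R a b \<and> x \<in> carrier (on_ob M b) \<and> y \<in> carrier (on_ob N a)}"

definition mod_tensor ::
    "('o, 'a, 'z) preadditive_scheme \<Rightarrow> ('o, 'a, 'm) modul \<Rightarrow> ('o, 'a, 'n) modul \<Rightarrow>
     ('o, 'm, 'n) mtens monoid" where
  "mod_tensor R M N = tensor_sum R M N Mod mod_tensor_ker R M N"

definition mod_pure_tensor ::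
    "('o, 'a, 'z) preadditive_scheme \<Rightarrow> ('o, 'a, 'm) modul \<Rightarrow> ('o, 'a, 'n) modul \<Rightarrow>
     'o \<Rightarrow> 'm \<Rightarrow> 'n \<Rightarrow> ('o, 'm, 'n) mtens" where
  "mod_pure_tensor R M N a x y = mod_tensor_ker R M N #>\<^bsub>tensor_sum R M N\<^esub> tensor_summand R M N a x y"

text \<open>The homomorphism \<open>\<eta> \<otimes> \<theta> : M \<otimes> N \<rightarrow> M' \<otimes> N'\<close>.\<close>

definition mod_tensor_map ::
    "('o, 'a, 'z) preadditive_scheme \<Rightarrow> ('o, 'a, 'm) modul \<Rightarrow> ('o, 'a, 'n) modul \<Rightarrow>
     ('o, 'a, 'k) modul \<Rightarrow> ('o, 'a, 'l) modul \<Rightarrow>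
     ('o \<Rightarrow> 'm \<Rightarrow> 'k) \<Rightarrow> ('o \<Rightarrow> 'n \<Rightarrow> 'l) \<Rightarrow> ('o, 'm, 'n) mtens \<Rightarrow> ('o, 'k, 'l) mtens" where
  "mod_tensor_map R M N M' N' \<eta> \<theta> = (THE h. h \<in> ext_hom (mod_tensor R M N) (mod_tensor R M' N') \<and>
     (\<forall>a\<in>Ob R. \<forall>x\<in>carrier (on_ob M a). \<forall>y\<in>carrier (on_ob N a).
        h (mod_pure_tensor R M N a x y) = mod_pure_tensor R M' N' a (\<eta> a x) (\<theta> a y)))"

section \<open>Restriction and extension of scalars\<close>

definition restriction ::
    "('q, 'b, 'z) preadditive_scheme \<Rightarrow> ('q, 'b, 'r, 'a) cfun \<Rightarrow>
     (('r, 'a, 'm) modul, 'r \<Rightarrow> 'm \<Rightarrow> 'm, ('q, 'b, 'm) modul, 'q \<Rightarrow> 'm \<Rightarrow> 'm) cfun" where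
  "restriction Q \<psi> = \<lparr>on_ob = (\<lambda>M. \<lparr>on_ob = (\<lambda>a. on_ob M (on_ob \<psi> a)),
                                    on_hom = (\<lambda>a b f. on_hom M (on_ob \<psi> a) (on_ob \<psi> b) (on_hom \<psi> b a f))\<rparr>),
                       on_hom = (\<lambda>M N \<eta>. \<lambda>a\<in>Ob Q. \<eta> (on_ob \<psi> a))\<rparr>"

text \<open>The left \<open>R\<close>-module \<open>S(s, \<phi>(?))\<close>, and the morphism \<open>S(s, \<phi>(?)) \<rightarrow> S(s', \<phi>(?))\<close> given by
  precomposition with \<open>t : s' \<rightarrow> s\<close>.\<close>

definition hom_module ::
    "('s, 'c, 'z) preadditive_scheme \<Rightarrow> ('r, 'a, 's, 'c) cfun \<Rightarrow> 's \<Rightarrow> ('r, 'a, 'c) modul" where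
  "hom_module S \<phi> s = \<lparr>on_ob = (\<lambda>b. HomGrp S s (on_ob \<phi> b)),
     on_hom = (\<lambda>b b' r. \<lambda>f\<in>Hom S s (on_ob \<phi> b). Comp S s (on_ob \<phi> b) (on_ob \<phi> b') (on_hom \<phi> b b' r) f)\<rparr>"

definition hom_module_map ::
    "('r, 'a, 'y) preadditive_scheme \<Rightarrow> ('s, 'c, 'z) preadditive_scheme \<Rightarrow> ('r, 'a, 's, 'c) cfun \<Rightarrow>
     's \<Rightarrow> 's \<Rightarrow> 'c \<Rightarrow> 'r \<Rightarrow> 'c \<Rightarrow> 'c" where
  "hom_module_map R S \<phi> s s' t =
     (\<lambda>b\<in>Ob R. \<lambda>f\<in>Hom S s (on_ob \<phi> b). Comp S s' s (on_ob \<phi> b) f t)"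

text \<open>
  The group \<open>M \<otimes> S(s, \<phi>(?))\<close> is the literal quotient construction and so has a type of its own;
  the target of \<open>extension R S \<phi>\<close> is \<open>right_modules S\<close> with values in that type.  This does not affect
  the groups of module morphisms between extended modules.
\<close>

definition extension ::
    "('r, 'a, 'y) preadditive_scheme \<Rightarrow> ('s, 'c, 'z) preadditive_scheme \<Rightarrow> ('r, 'a, 's, 'c) cfun \<Rightarrow>
     (('r, 'a, 'm) modul, 'r \<Rightarrow> 'm \<Rightarrow> 'm,
      ('s, 'c, ('r, 'm, 'c) mtens) modul, 's \<Rightarrow> ('r, 'm, 'c) mtens \<Rightarrow> ('r, 'm, 'c) mtens) cfun" where
  "extension R S \<phi> =
    \<lparr>on_ob = (\<lambda>M.
       \<lparr>on_ob = (\<lambda>s. mod_tensor R M (hom_module S \<phi> s)),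
        on_hom = (\<lambda>s s' t. mod_tensor_map R M (hom_module S \<phi> s) M (hom_module S \<phi> s')
                    (mod_id (opp R) M) (hom_module_map R S \<phi> s s' t))\<rparr>),
     on_hom = (\<lambda>M N \<eta>. \<lambda>s\<in>Ob S. mod_tensor_map R M (hom_module S \<phi> s) N (hom_module S \<phi> s)
                    \<eta> (mod_id R (hom_module S \<phi> s)))\<rparr>"

section \<open>Bimodules\<close>

text \<open>An \<open>(R, Q)\<close>-bimodule is a left module over this category.\<close>

definition bimod_category ::
    "('r, 'a, 'y) preadditive_scheme \<Rightarrow> ('q, 'b, 'z) preadditive_scheme \<Rightarrow>
     ('q \<times> 'r, ('b, 'a) tens) preadditive" where
  "bimod_category R Q = tensor_category (opp Q) R"

text \<open>The \<open>(R, Q)\<close>-bimodule \<open>(a, b) \<mapsto> S(F(a), G(b))\<close> for \<open>F : Q \<rightarrow> S\<close> and \<open>G : R \<rightarrow> S\<close>, on which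
  \<open>q \<otimes> r\<close> acts by \<open>f \<mapsto> G(r) \<circ> f \<circ> F(q)\<close>.\<close>

definition hom_bimodule ::
    "('r, 'a, 'x) preadditive_scheme \<Rightarrow> ('q, 'b, 'y) preadditive_scheme \<Rightarrow> ('s, 'c, 'z) preadditive_scheme \<Rightarrow>
     ('q, 'b, 's, 'c) cfun \<Rightarrow> ('r, 'a, 's, 'c) cfun \<Rightarrow> ('q \<times> 'r, ('b, 'a) tens, 'c) modul" where
  "hom_bimodule R Q S F G =
    \<lparr>on_ob = (\<lambda>(a, b). HomGrp S (on_ob F a) (on_ob G b)),
     on_hom = (\<lambda>(a, b) (a', b').
       tensor_lift (HomGrp (opp Q) a a') (HomGrp R b b')
         (HomGrp Ab (HomGrp S (on_ob F a) (on_ob G b)) (HomGrp S (on_ob F a') (on_ob G b')))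
         (\<lambda>q r. \<lambda>f\<in>Hom S (on_ob F a) (on_ob G b).
            Comp S (on_ob F a') (on_ob G b) (on_ob G b') (on_hom G b b' r)
              (Comp S (on_ob F a') (on_ob F a) (on_ob G b) f (on_hom F a' a q))))\<rparr>"

text \<open>The morphism \<open>R(\<psi>(-), -) \<rightarrow> S(\<phi>(\<psi>(-)), \<phi>(-))\<close>, \<open>r \<mapsto> \<phi>(r)\<close>.\<close>

definition functor_bimod_hom ::
    "('r, 'a, 'y) preadditive_scheme \<Rightarrow> ('q, 'b, 'z) preadditive_scheme \<Rightarrow>
     ('r, 'a, 's, 'c) cfun \<Rightarrow> ('q, 'b, 'r, 'a) cfun \<Rightarrow> 'q \<times> 'r \<Rightarrow> 'a \<Rightarrow> 'c" where
  "functor_bimod_hom R Q \<phi> \<psi> =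
     (\<lambda>(a, b)\<in>Ob (bimod_category R Q). \<lambda>r\<in>Hom R (on_ob \<psi> a) b. on_hom \<phi> (on_ob \<psi> a) b r)"

end

theory Submission
  imports Defs "HOL-Algebra.Weak_Morphisms"
begin

text \<open>
  Write \<open>E\<close> for the extension of scalars. Given \<open>\<alpha>\<close>, the maps \<open>n \<otimes> f \<mapsto> n \<cdot> \<alpha>(f)\<close> assemble to a
  family \<open>\<epsilon> : N \<otimes> S(\<phi>\<psi>a, \<phi>(?)) \<rightarrow> N(\<psi>a)\<close>, natural in \<open>N\<close> and \<open>a\<close>, and one puts \<open>P(h)(x) = \<epsilon>(h(x \<otimes>
  1))\<close> for \<open>h : E(M) \<rightarrow> E(N)\<close>. Condition (1) gives \<open>P(E(u)) = \<psi>\<^sub>*(u)\<close>. Condition (2) says that \<open>\<epsilon>\<close>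
  does not distinguish \<open>v \<cdot> f\<close> from \<open>v \<cdot> \<phi>(\<alpha>(f))\<close>, hence not \<open>g(w)\<close> from \<open>g(\<epsilon>(w) \<otimes> 1)\<close>, which is
  the multiplicativity of \<open>P\<close>.

  Conversely, \<open>f : \<phi>b \<rightarrow> \<phi>c\<close> induces a morphism \<open>f\<^sub>* : E(R(-, b)) \<rightarrow> E(R(-, c))\<close>, \<open>r \<otimes> t \<mapsto> 1 \<otimes> (f \<circ>
  \<phi>(r) \<circ> t)\<close>. For \<open>b = \<psi>a\<close>, let \<open>\<alpha>(f)\<close> be \<open>P(f\<^sub>*)\<close> evaluated at the identity of \<open>\<psi>a\<close>. Additivity
  of \<open>\<alpha>\<close> is not part of the hypothesis on \<open>P\<close>; it follows from naturality, as modules have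
  biproducts.
\<close>

section \<open>Tensor products of abelian groups\<close>

text \<open>The maps that make up \<open>extension\<close> and the bimodule actions are introduced
  by definite description, so nothing about them can be computed before existence and uniqueness are
  known. Hence every quotient below comes with a universal property and with the principle that
  homomorphisms agreeing on pure tensors agree; later identities are mostly checked on pure tensors.
  A second obstacle: \<open>P\<close> exists only for modules with values in the universe, whereas
  R(-, b) has values in the arrows of R, and a sum of two copies of a module has values in pairs.
  Smallness of R embeds the former, infinity of the universe the latter; this is why modules are
  transported along injections. By the Yoneda identification of E(R(-, b)) with S(-, \<phi> b), the
  map induced by f is postcomposition with f. It follows that \<alpha>(g \<circ> f) is the value of
  \<open>P\<close> at the map induced by g, applied to \<alpha>(f). So it depends on f only through
  \<alpha>(f), and by (1) the arrows f and \<phi>(\<alpha>(f)) have the same image under \<alpha>.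
  That is condition (2).\<close>

lemma (in comm_group) quotient_universal:
  assumes "A \<subseteq> carrier G" and "comm_group K" and "h \<in> hom G K"
    and "\<And>x. x \<in> A \<Longrightarrow> h x = \<one>\<^bsub>K\<^esub>"
  shows "\<exists>g\<in>hom (G Mod generate G A) K. \<forall>x\<in>carrier G. g (generate G A #> x) = h x"
proof -
  interpret K: comm_group K by fact
  interpret h: group_hom G K h
    by unfold_locales (rule assms)
  have sub: "subgroup (generate G A) G"
    by (rule generate_is_subgroup) (rule assms)
  have "generate G A \<subseteq> kernel G K h"
    by (rule generate_subgroup_incl) (use assms h.subgroup_kernel in \<open>auto simp: kernel_def\<close>)
  from h.FactGroup_universal_kernel [OF subgroup_imp_normal [OF sub] this] show ?thesis
    by metis
qed

lemma (in comm_group) quotient_generate: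
  assumes "A \<subseteq> carrier G"
  shows "comm_group (G Mod generate G A)"
    and "(\<lambda>x. generate G A #> x) \<in> hom G (G Mod generate G A)"
    and "\<lbrakk>x \<in> carrier G; y \<in> carrier G; x \<otimes> inv y \<in> A\<rbrakk> \<Longrightarrow> generate G A #> x = generate G A #> y"
proof -
  have sub: "subgroup (generate G A) G"
    by (rule generate_is_subgroup) (rule assms)
  then show "comm_group (G Mod generate G A)"
    by (rule abelian_FactGroup)
  show "(\<lambda>x. generate G A #> x) \<in> hom G (G Mod generate G A)"
    using normal.r_coset_hom_Mod [OF subgroup_imp_normal [OF sub]] .
  assume "x \<in> carrier G" "y \<in> carrier G" "x \<otimes> inv y \<in> A"
  then have "x \<in> generate G A #> y"
    using sub by (simp add: subgroup.rcos_module_rev generate.incl)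
  then show "generate G A #> x = generate G A #> y"
    using repr_independence \<open>y \<in> carrier G\<close> sub by auto
qed

lemma hom_FactGroup_eqI:
  assumes "x \<in> carrier (G Mod N)" and "\<And>y. y \<in> carrier G \<Longrightarrow> g (N #>\<^bsub>G\<^esub> y) = h (N #>\<^bsub>G\<^esub> y)"
  shows "g x = h x"
  using assms by (auto simp: carrier_FactGroup)

lemma tensor_rels_subset: 
  assumes "monoid G" "monoid H"
  shows "tensor_rels G H \<subseteq> carrier (free_Abelian_group (carrier G \<times> carrier H))"
proof -
  have *: "frag_of u - frag_of v - frag_of w \<in> carrier (free_Abelian_group X)"
    if "u \<in> X" "v \<in> X" "w \<in> X" for u v w :: 'c and X
    using keys_diff [of "frag_of u - frag_of v" "frag_of w"] keys_diff [of "frag_of u" "frag_of v"]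
      that
    by auto
  show ?thesis
    unfolding tensor_rels_def
    by (auto simp del: carrier_free_Abelian_group_iff intro!: * monoid.m_closed
      [OF assms(1)] monoid.m_closed [OF assms(2)])
qed

locale tensor_product = G: comm_group G + H: comm_group H
  for G :: "'m monoid" and H :: "'n monoid"
begin

abbreviation "F \<equiv> free_Abelian_group (carrier G \<times> carrier H)"
abbreviation "T \<equiv> tensor G H"

lemma rels_subset: "tensor_rels G H \<subseteq> carrier F"
  by (rule tensor_rels_subset) (rule G.is_monoid H.is_monoid)+

lemma comm_group_tensor: "comm_group T"
  unfolding tensor_def tensor_ker_def
  by (rule comm_group.quotient_generate(1) [OF abelian_free_Abelian_group rels_subset])

lemma quotient_hom: "(\<lambda>x. tensor_ker G H #>\<^bsub>F\<^esub> x) \<in> hom F T"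
  unfolding tensor_def tensor_ker_def
  by (rule comm_group.quotient_generate(2) [OF abelian_free_Abelian_group rels_subset])

lemma pure_tensor_closed:
  "\<lbrakk>x \<in> carrier G; y \<in> carrier H\<rbrakk> \<Longrightarrow> pure_tensor G H x y \<in> carrier T"
  unfolding pure_tensor_def by (rule hom_in_carrier [OF quotient_hom]) auto

text \<open>The generators of the kernel for either variable have the shape u - v - w, so one
  argument serves both additivity laws of \<open>pure_tensor\<close>.\<close>

lemma pure_tensor_relI:
  assumes "u \<in> carrier G \<times> carrier H" "v \<in> carrier G \<times> carrier H" "w \<in> carrier G \<times> carrier H"
    and "frag_of u - frag_of v - frag_of w \<in> tensor_rels G H"
  shows "tensor_ker G H #>\<^bsub>F\<^esub> frag_of u
    = (tensor_ker G H #>\<^bsub>F\<^esub> frag_of v) \<otimes>\<^bsub>T\<^esub> (tensor_ker G H #>\<^bsub>F\<^esub> frag_of w)"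
proof -
  have *: "frag_of v + frag_of w \<in> carrier F"
    using assms monoid.m_closed [OF group.is_monoid
      [OF group_free_Abelian_group [of "carrier G \<times> carrier H"]], of "frag_of v" "frag_of w"]
    by (auto simp del: carrier_free_Abelian_group_iff)
  have "tensor_ker G H #>\<^bsub>F\<^esub> frag_of u = tensor_ker G H #>\<^bsub>F\<^esub> (frag_of v + frag_of w)"
    unfolding tensor_ker_def
    by (rule comm_group.quotient_generate(3) [OF abelian_free_Abelian_group rels_subset])
      (use assms * in \<open>auto simp: algebra_simps\<close>)
  also have "\<dots> = (tensor_ker G H #>\<^bsub>F\<^esub> frag_of v) \<otimes>\<^bsub>T\<^esub> (tensor_ker G H #>\<^bsub>F\<^esub> frag_of w)"
    using hom_mult [OF quotient_hom, of "frag_of v" "frag_of w"] assms by auto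
  finally show ?thesis .
qed

lemma pure_tensor_mult_left:
  assumes "x \<in> carrier G" "x' \<in> carrier G" "y \<in> carrier H"
  shows "pure_tensor G H (x \<otimes>\<^bsub>G\<^esub> x') y = pure_tensor G H x y \<otimes>\<^bsub>T\<^esub> pure_tensor G H x' y"
  unfolding pure_tensor_def
  by (rule pure_tensor_relI) (use assms in \<open>auto simp: tensor_rels_def\<close>)

lemma pure_tensor_mult_right:
  assumes "x \<in> carrier G" "y \<in> carrier H" "y' \<in> carrier H"
  shows "pure_tensor G H x (y \<otimes>\<^bsub>H\<^esub> y') = pure_tensor G H x y \<otimes>\<^bsub>T\<^esub> pure_tensor G H x y'"
  unfolding pure_tensor_def
  by (rule pure_tensor_relI) (use assms in \<open>auto simp: tensor_rels_def\<close>)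

text \<open>The uniqueness half of the universal property. Pulled back along the quotient map, the
  two homomorphisms live on a free abelian group, where induction over differences of generators
  reduces the claim to pure tensors.\<close>

lemma hom_eqI:
  assumes K: "group K" and g: "g \<in> hom T K" and h: "h \<in> hom T K"
    and eq: "\<And>x y. \<lbrakk>x \<in> carrier G; y \<in> carrier H\<rbrakk>
      \<Longrightarrow> g (pure_tensor G H x y) = h (pure_tensor G H x y)"
    and t: "t \<in> carrier T"
  shows "g t = h t"
proof -
  let ?q = "\<lambda>x. tensor_ker G H #>\<^bsub>F\<^esub> x"
  have q: "group_hom F K (\<lambda>x. f (?q x))" if "f \<in> hom T K" for f
    using hom_compose [OF quotient_hom that] K
    by (auto simp: group_hom_def group_hom_axioms_def comp_def)
  interpret g: group_hom F K "\<lambda>x. g (?q x)" by (rule q) (rule g)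
  interpret h: group_hom F K "\<lambda>x. h (?q x)" by (rule q) (rule h)
  have "g (?q c) = h (?q c)" if "c \<in> carrier F" for c
  proof (rule free_Abelian_group_induct [where S = "carrier G \<times> carrier H"
    and P = "\<lambda>c. g (?q c) = h (?q c)"])
    show "Poly_Mapping.keys c \<subseteq> carrier G \<times> carrier H" using that by simp
    show "g (?q 0) = h (?q 0)"
      using g.hom_one h.hom_one by simp
  next
    fix x y assume x: "Poly_Mapping.keys x \<subseteq> carrier G \<times> carrier H"
      and y: "Poly_Mapping.keys y \<subseteq> carrier G \<times> carrier H"
      and "g (?q x) = h (?q x)" "g (?q y) = h (?q y)"
    moreover have "g (?q (x - y)) = g (?q x) \<otimes>\<^bsub>K\<^esub> inv\<^bsub>K\<^esub> g (?q y)"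
      using g.hom_mult [of x "- y"] g.hom_inv [of y] x y by simp
    moreover have "h (?q (x - y)) = h (?q x) \<otimes>\<^bsub>K\<^esub> inv\<^bsub>K\<^esub> h (?q y)"
      using h.hom_mult [of x "- y"] h.hom_inv [of y] x y by simp
    ultimately show "g (?q (x - y)) = h (?q (x - y))" by simp
  next
    fix a assume "a \<in> carrier G \<times> carrier H"
    then show "g (?q (frag_of a)) = h (?q (frag_of a))"
      using eq unfolding pure_tensor_def by auto
  qed
  then show ?thesis
    using t hom_FactGroup_eqI [of t F "tensor_ker G H" g h] unfolding tensor_def by blast
qed

text \<open>The existence half: a map on pairs extends to the free abelian group, and bilinearity
  says precisely that the extension kills the relations.\<close>

lemma universal:
  assumes K: "comm_group K"
    and cl: "\<And>x y. \<lbrakk>x \<in> carrier G; y \<in> carrier H\<rbrakk> \<Longrightarrow> \<beta> x y \<in> carrier K"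
    and l: "\<And>x x' y. \<lbrakk>x \<in> carrier G; x' \<in> carrier G; y \<in> carrier H\<rbrakk>
      \<Longrightarrow> \<beta> (x \<otimes>\<^bsub>G\<^esub> x') y = \<beta> x y \<otimes>\<^bsub>K\<^esub> \<beta> x' y"
    and r: "\<And>x y y'. \<lbrakk>x \<in> carrier G; y \<in> carrier H; y' \<in> carrier H\<rbrakk>
      \<Longrightarrow> \<beta> x (y \<otimes>\<^bsub>H\<^esub> y') = \<beta> x y \<otimes>\<^bsub>K\<^esub> \<beta> x y'"
  shows "\<exists>h\<in>hom T K. \<forall>x\<in>carrier G. \<forall>y\<in>carrier H. h (pure_tensor G H x y) = \<beta> x y"
proof -
  interpret K: comm_group K by fact
  have im: "case_prod \<beta> ` (carrier G \<times> carrier H) \<subseteq> carrier K"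
    using cl by auto
  obtain k where k: "k \<in> hom F K" "\<And>p. p \<in> carrier G \<times> carrier H \<Longrightarrow> k (frag_of p) = case_prod \<beta> p"
    by (rule K.free_Abelian_group_universal [OF im]) auto
  interpret k: group_hom F K k
    using k K by (auto simp: group_hom_def group_hom_axioms_def)
  \<comment> \<open>The free group is written additively and \<open>K\<close> multiplicatively.
    Instead of translating the differences, v + w is added back and the common factor is cancelled
    in \<open>K\<close>.\<close>
  have kd: "k (frag_of u - frag_of v - frag_of w) = \<one>\<^bsub>K\<^esub>"
    if "u \<in> carrier G \<times> carrier H" "v \<in> carrier G \<times> carrier H" "w \<in> carrier G \<times> carrier H"
      and "case_prod \<beta> u = case_prod \<beta> v \<otimes>\<^bsub>K\<^esub> case_prod \<beta> w" for u v w
  proof -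
    have *: "frag_of u - frag_of v - frag_of w \<in> carrier F"
      using keys_diff [of "frag_of u - frag_of v" "frag_of w"] keys_diff
        [of "frag_of u" "frag_of v"] that
      by auto
    have "frag_of v + frag_of w \<in> carrier F"
      using keys_add [of "frag_of v" "frag_of w"] that by auto
    then have "k ((frag_of u - frag_of v - frag_of w) + (frag_of v + frag_of w))
        = k (frag_of u - frag_of v - frag_of w) \<otimes>\<^bsub>K\<^esub> k (frag_of v + frag_of w)"
      using k.hom_mult [OF *, of "frag_of v + frag_of w"] by (simp only: mult_free_Abelian_group)
    moreover have "(frag_of u - frag_of v - frag_of w) + (frag_of v + frag_of w) = frag_of u"
      by simp
    moreover have "k (frag_of v + frag_of w) = k (frag_of v) \<otimes>\<^bsub>K\<^esub> k (frag_of w)"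
      using k.hom_mult [of "frag_of v" "frag_of w"] that
      by (simp only: mult_free_Abelian_group frag_of_in_free_Abelian_group)
    ultimately have "k (frag_of u)
        = k (frag_of u - frag_of v - frag_of w) \<otimes>\<^bsub>K\<^esub> (k (frag_of v) \<otimes>\<^bsub>K\<^esub> k (frag_of w))"
      by metis
    moreover have "k (frag_of u) = k (frag_of v) \<otimes>\<^bsub>K\<^esub> k (frag_of w)"
      using that k(2) by simp
    moreover have "k (frag_of u) \<in> carrier K"
      by (rule k.hom_closed) (use that in simp)
    ultimately show ?thesis
      using k.hom_closed [OF *] by (metis K.r_cancel_one')
  qed
  have kr: "k p = \<one>\<^bsub>K\<^esub>" if "p \<in> tensor_rels G H" for p
    using that unfolding tensor_rels_def by safe (rule kd; simp add: l r)+
  obtain h where "h \<in> hom T K" "\<And>x. x \<in> carrier F \<Longrightarrow> h (tensor_ker G H #>\<^bsub>F\<^esub> x) = k x"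
    using comm_group.quotient_universal [OF abelian_free_Abelian_group rels_subset K k(1) kr]
    unfolding tensor_def tensor_ker_def by blast
  then show ?thesis
    using k(2) by (intro bexI [of _ h]) (auto simp: pure_tensor_def)
qed

text \<open>Turns the description in \<open>tensor_lift\<close> into a usable rule. Homomorphisms
  are determined only on the carrier, so uniqueness as a function comes from the extensionality
  built into \<open>ext_hom\<close>.\<close>

lemma tensor_lift:
  assumes K: "comm_group K"
    and cl: "\<And>x y. \<lbrakk>x \<in> carrier G; y \<in> carrier H\<rbrakk> \<Longrightarrow> \<beta> x y \<in> carrier K"
    and l: "\<And>x x' y. \<lbrakk>x \<in> carrier G; x' \<in> carrier G; y \<in> carrier H\<rbrakk>
      \<Longrightarrow> \<beta> (x \<otimes>\<^bsub>G\<^esub> x') y = \<beta> x y \<otimes>\<^bsub>K\<^esub> \<beta> x' y"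
    and r: "\<And>x y y'. \<lbrakk>x \<in> carrier G; y \<in> carrier H; y' \<in> carrier H\<rbrakk>
      \<Longrightarrow> \<beta> x (y \<otimes>\<^bsub>H\<^esub> y') = \<beta> x y \<otimes>\<^bsub>K\<^esub> \<beta> x y'"
  shows "tensor_lift G H K \<beta> \<in> ext_hom T K"
    and "\<And>x y. \<lbrakk>x \<in> carrier G; y \<in> carrier H\<rbrakk> \<Longrightarrow> tensor_lift G H K \<beta> (pure_tensor G H x y) = \<beta> x y"
proof -
  let ?Q = "\<lambda>h. h \<in> ext_hom T K \<and> (\<forall>x\<in>carrier G. \<forall>y\<in>carrier H. h (pure_tensor G H x y) = \<beta> x y)"
  obtain h where h: "h \<in> hom T K" "\<And>x y. \<lbrakk>x \<in> carrier G; y \<in> carrier H\<rbrakk>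
    \<Longrightarrow> h (pure_tensor G H x y) = \<beta> x y"
    using universal [OF assms] by blast
  interpret T: comm_group T by (rule comm_group_tensor)
  have "\<exists>!h. ?Q h"
  proof (rule ex1I)
    show "?Q (restrict h (carrier T))"
      using h pure_tensor_closed by (auto simp: ext_hom_def hom_def)
    fix g assume "?Q g"
    then show "g = restrict h (carrier T)"
      using h hom_eqI [of K g h] comm_group.axioms(2) [OF K] unfolding ext_hom_def
      by (intro extensionalityI [of _ "carrier T"]) auto
  qed
  from theI' [OF this] show "tensor_lift G H K \<beta> \<in> ext_hom T K"
    and "\<And>x y. \<lbrakk>x \<in> carrier G; y \<in> carrier H\<rbrakk> \<Longrightarrow> tensor_lift G H K \<beta> (pure_tensor G H x y) = \<beta> x y"
    unfolding tensor_lift_def by auto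
qed

end

section \<open>Direct sums of groups\<close>

definition sum_inj :: "'i set \<Rightarrow> ('i \<Rightarrow> 'm monoid) \<Rightarrow> 'i \<Rightarrow> 'm \<Rightarrow> 'i \<Rightarrow> 'm" where
  "sum_inj I G i x = (\<lambda>j\<in>I. if j = i then x else \<one>\<^bsub>G j\<^esub>)"

lemma sum_inj_hom:
  assumes "\<And>i. i \<in> I \<Longrightarrow> group (G i)" and "i \<in> I"
  shows "sum_inj I G i \<in> hom (G i) (sum_group I G)"
proof (rule homI)
  note group.is_monoid [OF assms(1), simp]
  fix x assume x: "x \<in> carrier (G i)"
  have "finite {j \<in> I. sum_inj I G i x j \<noteq> \<one>\<^bsub>G j\<^esub>}"
    by (rule finite_subset [of _ "{i}"]) (auto simp: sum_inj_def)
  then show "sum_inj I G i x \<in> carrier (sum_group I G)"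
    using assms x by (auto simp: carrier_sum_group sum_inj_def split: if_splits)
  fix y assume y: "y \<in> carrier (G i)"
  show "sum_inj I G i (x \<otimes>\<^bsub>G i\<^esub> y) = sum_inj I G i x \<otimes>\<^bsub>sum_group I G\<^esub> sum_inj I G i y"
    by (auto simp: sum_inj_def fun_eq_iff)
qed

text \<open>Elements of the direct sum have finite support, so each is a finite product of elements
  of the summands; the proof is by induction on the support.\<close>

lemma sum_group_hom_eqI:
  assumes G: "\<And>i. i \<in> I \<Longrightarrow> group (G i)" and K: "group K"
    and g: "g \<in> hom (sum_group I G) K" and h: "h \<in> hom (sum_group I G) K"
    and eq: "\<And>i x. \<lbrakk>i \<in> I; x \<in> carrier (G i)\<rbrakk> \<Longrightarrow> g (sum_inj I G i x) = h (sum_inj I G i x)"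
    and t: "t \<in> carrier (sum_group I G)"
  shows "g t = h t"
proof -
  note group.is_monoid [OF G, simp]
  have "g t = h t" if "t \<in> carrier (sum_group I G)" "{i \<in> I. t i \<noteq> \<one>\<^bsub>G i\<^esub>} = F" "finite F" for F t
    using that(3,1,2)
  proof (induction F arbitrary: t rule: finite_induct)
    case empty
    then have t: "t = \<one>\<^bsub>sum_group I G\<^esub>"
      by (auto simp: carrier_sum_group G PiE_iff extensional_def fun_eq_iff)
    then show ?case
      unfolding t using hom_one [OF g _ K] hom_one [OF h _ K] G sum_group by metis
  next
    case (insert i F)
    \<comment> \<open>Resetting one coordinate to the neutral element shrinks the support by one and
      leaves \<open>t\<close> as the product of \<open>s\<close> with an element of the summand at
      \<open>i\<close>.\<close>
    define s where "s = t(i := \<one>\<^bsub>G i\<^esub>)"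
    have i: "i \<in> I" using insert.prems by auto
    have tp: "t \<in> (\<Pi>\<^sub>E i\<in>I. carrier (G i))" using insert.prems G by (auto simp: carrier_sum_group)
    have sF: "{i \<in> I. s i \<noteq> \<one>\<^bsub>G i\<^esub>} = F"
      using insert unfolding s_def by auto
    have s: "s \<in> carrier (sum_group I G)"
      using tp i sF insert.hyps G by (auto simp: carrier_sum_group s_def PiE_iff extensional_def)
    have ti: "t i \<in> carrier (G i)" using tp i by auto
    have ts: "t = sum_inj I G i (t i) \<otimes>\<^bsub>sum_group I G\<^esub> s"
    proof
      fix j show "t j = (sum_inj I G i (t i) \<otimes>\<^bsub>sum_group I G\<^esub> s) j"
        using tp i by (cases "j \<in> I") (auto simp: sum_inj_def s_def PiE_iff extensional_def)
    qed
    have si: "sum_inj I G i (t i) \<in> carrier (sum_group I G)"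
      by (rule hom_in_carrier [OF sum_inj_hom [where G = G] ti]) (use G i in auto)
    have "g t = g (sum_inj I G i (t i)) \<otimes>\<^bsub>K\<^esub> g s"
      by (subst ts) (rule hom_mult [OF g si s])
    moreover have "h t = h (sum_inj I G i (t i)) \<otimes>\<^bsub>K\<^esub> h s"
      by (subst ts) (rule hom_mult [OF h si s])
    ultimately show ?case
      using eq [OF i ti] insert.IH [OF s sF] by simp
  qed
  moreover have "finite {i \<in> I. t i \<noteq> \<one>\<^bsub>G i\<^esub>}"
    using t by (simp add: carrier_sum_group G)
  ultimately show ?thesis using t by blast
qed

text \<open>The homomorphism multiplies the values of the \<open>f i\<close>. The index set may be
  infinite, but \<open>gfinprod\<close> takes into account only the finitely many nontrivial
  factors.\<close>

lemma sum_group_universal: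
  assumes G: "\<And>i. i \<in> I \<Longrightarrow> group (G i)" and K: "comm_group K"
    and f: "\<And>i. i \<in> I \<Longrightarrow> f i \<in> hom (G i) K"
  shows "\<exists>h\<in>hom (sum_group I G) K. \<forall>i\<in>I. \<forall>x\<in>carrier (G i). h (sum_inj I G i x) = f i x"
proof -
  interpret K: comm_group K by fact
  let ?h = "\<lambda>x. gfinprod K (\<lambda>i. f i (x i)) I"
  have "?h (sum_inj I G i x) = f i x" if i: "i \<in> I" and x: "x \<in> carrier (G i)" for i x
  proof -
    have fx: "f i x \<in> carrier K" using f [OF i] x by (auto simp: hom_def)
    have "?h (sum_inj I G i x) = gfinprod K (\<lambda>j. f j (sum_inj I G i x j)) {i}"
      using i x fx hom_one [OF f G] K.group_axioms
      by (intro K.gfinprod_mono_neutral_cong_right) (auto simp: sum_inj_def)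
    also have "\<dots> = f i x"
      using i fx by (simp add: sum_inj_def K.finprod_singleton Pi_def)
    finally show ?thesis .
  qed
  moreover have "?h \<in> hom (sum_group I G) K"
    by (rule K.hom_group_sum) (rule f G; assumption)+
  ultimately show ?thesis
    by (intro bexI [of _ ?h]) auto
qed

lemma comm_group_sum_group:
  assumes "\<And>i. i \<in> I \<Longrightarrow> comm_group (G i)"
  shows "comm_group (sum_group I G)"
proof (rule group.group_comm_groupI)
  have G: "\<And>i. i \<in> I \<Longrightarrow> group (G i)" using assms comm_group.axioms(2) by blast
  then show "group (sum_group I G)" by simp
  fix x y assume "x \<in> carrier (sum_group I G)" "y \<in> carrier (sum_group I G)"
  then show "x \<otimes>\<^bsub>sum_group I G\<^esub> y = y \<otimes>\<^bsub>sum_group I G\<^esub> x"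
    using comm_monoid.m_comm [OF comm_group.axioms(1) [OF assms]]
    by (auto simp: carrier_sum_group G PiE_iff intro!: restrict_ext)
qed

section \<open>Modules\<close>

lemma opp_sel [simp]:
  "Ob (opp C) = Ob C" "Hom (opp C) a b = Hom C b a" "Ident (opp C) = Ident C"
  "Comp (opp C) a b c g f = Comp C c b a f g" "HomGrp (opp C) a b = HomGrp C b a"
  by (simp_all add: opp_def)

lemma Ab_sel [simp]:
  "Ob Ab = {G. comm_group G}" "Hom Ab G H = ext_hom G H" "Ident Ab G = (\<lambda>x\<in>carrier G. x)"
  "Comp Ab G H K g f = compose (carrier G) g f" "carrier (HomGrp Ab G H) = ext_hom G H"
  "f \<otimes>\<^bsub>HomGrp Ab G H\<^esub> g = (\<lambda>x\<in>carrier G. f x \<otimes>\<^bsub>H\<^esub> g x)"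
  "\<one>\<^bsub>HomGrp Ab G H\<^esub> = (\<lambda>x\<in>carrier G. \<one>\<^bsub>H\<^esub>)"
  by (simp_all add: Ab_def)

lemma cfun_sel [simp]:
  "on_ob id_cfun a = a" "on_hom id_cfun a b f = f"
  "on_ob (\<Psi> \<circ>\<^sub>F \<Phi>) a = on_ob \<Psi> (on_ob \<Phi> a)"
  "on_hom (\<Psi> \<circ>\<^sub>F \<Phi>) a b f = on_hom \<Psi> (on_ob \<Phi> a) (on_ob \<Phi> b) (on_hom \<Phi> a b f)"
  by (simp_all add: id_cfun_def comp_cfun_def)

lemma (in preadditive_category) preadditive_opp: "preadditive_category (opp C)"
proof -
  have "category (opp C)"
    by unfold_locales
      (auto simp: Ident_in_Hom Comp_in_Hom Comp_Ident_left Comp_Ident_right Comp_assoc)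
  then show ?thesis
    unfolding preadditive_category_def preadditive_category_axioms_def
    by (auto simp: HomGrp_carrier HomGrp_comm_group Comp_add_left Comp_add_right)
qed

lemma ext_hom_hom: "h \<in> ext_hom G H \<Longrightarrow> h \<in> hom G H"
  by (simp add: ext_hom_def)

lemma ext_hom_eqI:
  assumes "g \<in> ext_hom G H" "h \<in> ext_hom G K" "\<And>x. x \<in> carrier G \<Longrightarrow> g x = h x"
  shows "g = h"
  using assms by (intro extensionalityI [of _ "carrier G"]) (auto simp: ext_hom_def)

lemma restrict_ext_hom: "h \<in> hom G H \<Longrightarrow> group G \<Longrightarrow> restrict h (carrier G) \<in> ext_hom G H"
  using group.is_monoid monoid.m_closed by (fastforce simp: ext_hom_def hom_def)

lemma ext_hom_restrictI:
  assumes "group G" "\<And>x. x \<in> carrier G \<Longrightarrow> h x \<in> carrier H"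
    "\<And>x y. \<lbrakk>x \<in> carrier G; y \<in> carrier G\<rbrakk> \<Longrightarrow> h (x \<otimes>\<^bsub>G\<^esub> y) = h x \<otimes>\<^bsub>H\<^esub> h y"
  shows "(\<lambda>x\<in>carrier G. h x) \<in> ext_hom G H"
  using assms by (intro restrict_ext_hom homI)

section \<open>Modules in elementwise form\<close>

locale ab_module = preadditive_category C for C :: "('o, 'a, 'z) preadditive_scheme" +
  fixes M :: "('o, 'a, 'm) modul"
  assumes additive: "additive_functor C Ab M"
begin

lemma grp: "a \<in> Ob C \<Longrightarrow> comm_group (on_ob M a)"
  using additive by (auto simp: additive_functor_def is_functor_def)

lemma act_ext_hom: "\<lbrakk>a \<in> Ob C; b \<in> Ob C; f \<in> Hom C a b\<rbrakk>
  \<Longrightarrow> on_hom M a b f \<in> ext_hom (on_ob M a) (on_ob M b)"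
  using additive by (auto simp: additive_functor_def is_functor_def)

lemma act_closed:
  "\<lbrakk>a \<in> Ob C; b \<in> Ob C; f \<in> Hom C a b; x \<in> carrier (on_ob M a)\<rbrakk>
    \<Longrightarrow> on_hom M a b f x \<in> carrier (on_ob M b)"
  using act_ext_hom by (meson ext_hom_hom hom_in_carrier)

lemma act_mult:
  "\<lbrakk>a \<in> Ob C; b \<in> Ob C; f \<in> Hom C a b; x \<in> carrier (on_ob M a); y \<in> carrier (on_ob M a)\<rbrakk>
   \<Longrightarrow> on_hom M a b f (x \<otimes>\<^bsub>on_ob M a\<^esub> y) = on_hom M a b f x \<otimes>\<^bsub>on_ob M b\<^esub> on_hom M a b f y"
  using act_ext_hom by (meson ext_hom_hom hom_mult)

lemma act_id: "\<lbrakk>a \<in> Ob C; x \<in> carrier (on_ob M a)\<rbrakk> \<Longrightarrow> on_hom M a a (Ident C a) x = x"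
  using additive by (auto simp: additive_functor_def is_functor_def)

lemma act_comp:
  "\<lbrakk>a \<in> Ob C; b \<in> Ob C; c \<in> Ob C; f \<in> Hom C a b; g \<in> Hom C b c; x \<in> carrier (on_ob M a)\<rbrakk>
   \<Longrightarrow> on_hom M a c (Comp C a b c g f) x = on_hom M b c g (on_hom M a b f x)"
  using additive by (auto simp: additive_functor_def is_functor_def compose_def)

lemma act_add:
  "\<lbrakk>a \<in> Ob C; b \<in> Ob C; f \<in> Hom C a b; g \<in> Hom C a b; x \<in> carrier (on_ob M a)\<rbrakk>
   \<Longrightarrow> on_hom M a b (f \<otimes>\<^bsub>HomGrp C a b\<^esub> g) x = on_hom M a b f x \<otimes>\<^bsub>on_ob M b\<^esub> on_hom M a b g x"
  using additive by (auto simp: additive_functor_def hom_def HomGrp_carrier)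

end

text \<open>Arrows of \<open>Ab\<close> are extensional functions, hence the functor equations and
  additivity may be verified on elements of the carriers.\<close>

lemma ab_moduleI:
  assumes C: "preadditive_category C"
    and grp: "\<And>a. a \<in> Ob C \<Longrightarrow> comm_group (on_ob M a)"
    and hom: "\<And>a b f. \<lbrakk>a \<in> Ob C; b \<in> Ob C; f \<in> Hom C a b\<rbrakk>
      \<Longrightarrow> on_hom M a b f \<in> ext_hom (on_ob M a) (on_ob M b)"
    and id: "\<And>a x. \<lbrakk>a \<in> Ob C; x \<in> carrier (on_ob M a)\<rbrakk> \<Longrightarrow> on_hom M a a (Ident C a) x = x"
    and comp: "\<And>a b c f g x. \<lbrakk>a \<in> Ob C; b \<in> Ob C; c \<in> Ob C; f \<in> Hom C a b; g \<in> Hom C b c;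
      x \<in> carrier (on_ob M a)\<rbrakk>
      \<Longrightarrow> on_hom M a c (Comp C a b c g f) x = on_hom M b c g (on_hom M a b f x)"
    and add: "\<And>a b f g x. \<lbrakk>a \<in> Ob C; b \<in> Ob C; f \<in> Hom C a b; g \<in> Hom C a b;
      x \<in> carrier (on_ob M a)\<rbrakk>
      \<Longrightarrow> on_hom M a b (f \<otimes>\<^bsub>HomGrp C a b\<^esub> g) x = on_hom M a b f x \<otimes>\<^bsub>on_ob M b\<^esub> on_hom M a b g x"
  shows "ab_module C M"
proof -
  interpret preadditive_category C by fact
  have e: "on_hom M a b f \<in> extensional (carrier (on_ob M a))"
    if "a \<in> Ob C" "b \<in> Ob C" "f \<in> Hom C a b" for a b f
    using hom [OF that] by (simp add: ext_hom_def)
  have "is_functor C Ab M"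
    unfolding is_functor_def
  proof (intro conjI ballI)
    fix a assume a: "a \<in> Ob C"
    show "on_ob M a \<in> Ob Ab" using grp [OF a] by simp
    show "on_hom M a a (Ident C a) = Ident Ab (on_ob M a)"
      by (rule extensionalityI [OF e]) (use a id Ident_in_Hom in auto)
    fix b f assume b: "b \<in> Ob C" and f: "f \<in> Hom C a b"
    show "on_hom M a b f \<in> Hom Ab (on_ob M a) (on_ob M b)"
      using hom [OF a b f] by simp
    fix c g assume c: "c \<in> Ob C" and g: "g \<in> Hom C b c"
    show "on_hom M a c (Comp C a b c g f)
      = Comp Ab (on_ob M a) (on_ob M b) (on_ob M c) (on_hom M b c g) (on_hom M a b f)"
      by (rule extensionalityI [OF e]) (use a b c f g comp Comp_in_Hom in \<open>auto simp: compose_def\<close>)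
  qed
  moreover have "on_hom M a b \<in> hom (HomGrp C a b) (HomGrp Ab (on_ob M a) (on_ob M b))"
    if ab: "a \<in> Ob C" "b \<in> Ob C" for a b
  proof (rule homI)
    interpret G: comm_group "HomGrp C a b" by (rule HomGrp_comm_group) fact+
    fix f assume f: "f \<in> carrier (HomGrp C a b)"
    then show "on_hom M a b f \<in> carrier (HomGrp Ab (on_ob M a) (on_ob M b))"
      using hom ab by (simp add: HomGrp_carrier)
    fix g assume g: "g \<in> carrier (HomGrp C a b)"
    have "f \<otimes>\<^bsub>HomGrp C a b\<^esub> g \<in> Hom C a b"
      using G.m_closed [OF f g] ab by (simp add: HomGrp_carrier)
    then show "on_hom M a b (f \<otimes>\<^bsub>HomGrp C a b\<^esub> g) = on_hom M a b f
      \<otimes>\<^bsub>HomGrp Ab (on_ob M a) (on_ob M b)\<^esub> on_hom M a b g"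
      by (intro extensionalityI [OF e]) (use ab f g add in \<open>auto simp: HomGrp_carrier\<close>)
  qed
  ultimately show ?thesis
    by unfold_locales (auto simp: additive_functor_def)
qed

section \<open>Morphisms of modules in elementwise form\<close>

lemma mod_homD:
  assumes "\<eta> \<in> mod_hom C M N" "a \<in> Ob C"
  shows "\<eta> a \<in> ext_hom (on_ob M a) (on_ob N a)"
    and "x \<in> carrier (on_ob M a) \<Longrightarrow> \<eta> a x \<in> carrier (on_ob N a)"
    and "\<lbrakk>x \<in> carrier (on_ob M a); y \<in> carrier (on_ob M a)\<rbrakk> \<Longrightarrow> \<eta> a (x \<otimes>\<^bsub>on_ob M a\<^esub> y) = \<eta> a x
      \<otimes>\<^bsub>on_ob N a\<^esub> \<eta> a y"
    and "\<lbrakk>b \<in> Ob C; f \<in> Hom C a b; x \<in> carrier (on_ob M a)\<rbrakk>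
      \<Longrightarrow> \<eta> b (on_hom M a b f x) = on_hom N a b f (\<eta> a x)"
proof -
  show "\<eta> a \<in> ext_hom (on_ob M a) (on_ob N a)"
    using assms by (auto simp: mod_hom_def)
  then show "x \<in> carrier (on_ob M a) \<Longrightarrow> \<eta> a x \<in> carrier (on_ob N a)"
    and "\<lbrakk>x \<in> carrier (on_ob M a); y \<in> carrier (on_ob M a)\<rbrakk> \<Longrightarrow> \<eta> a (x \<otimes>\<^bsub>on_ob M a\<^esub> y) = \<eta> a x
      \<otimes>\<^bsub>on_ob N a\<^esub> \<eta> a y"
    by (auto simp: ext_hom_def hom_def)
  assume "b \<in> Ob C" "f \<in> Hom C a b" and x: "x \<in> carrier (on_ob M a)"
  then have "compose (carrier (on_ob M a)) (\<eta> b) (on_hom M a b f)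
       = compose (carrier (on_ob M a)) (on_hom N a b f) (\<eta> a)"
    using assms by (auto simp: mod_hom_def)
  from fun_cong [OF this, of x] x show "\<eta> b (on_hom M a b f x) = on_hom N a b f (\<eta> a x)"
    by (simp add: compose_def)
qed

lemma mod_homI:
  assumes "\<eta> \<in> extensional (Ob C)"
    and "\<And>a. a \<in> Ob C \<Longrightarrow> \<eta> a \<in> ext_hom (on_ob M a) (on_ob N a)"
    and "\<And>a b f x. \<lbrakk>a \<in> Ob C; b \<in> Ob C; f \<in> Hom C a b; x \<in> carrier (on_ob M a)\<rbrakk>
      \<Longrightarrow> \<eta> b (on_hom M a b f x) = on_hom N a b f (\<eta> a x)"
  shows "\<eta> \<in> mod_hom C M N"
  using assms by (auto simp: mod_hom_def PiE_def compose_def restrict_def fun_eq_iff)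

lemma mod_hom_eqI:
  assumes "\<eta> \<in> mod_hom C M N" "\<theta> \<in> mod_hom C M N'"
    and "\<And>a x. \<lbrakk>a \<in> Ob C; x \<in> carrier (on_ob M a)\<rbrakk> \<Longrightarrow> \<eta> a x = \<theta> a x"
  shows "\<eta> = \<theta>"
proof (rule extensionalityI [of _ "Ob C"])
  show "\<eta> \<in> extensional (Ob C)" "\<theta> \<in> extensional (Ob C)"
    using assms by (auto simp: mod_hom_def PiE_def)
  fix a assume "a \<in> Ob C"
  then show "\<eta> a = \<theta> a"
    using ext_hom_eqI [OF mod_homD(1) [OF assms(1)] mod_homD(1) [OF assms(2)]] assms(3) by blast
qed

lemma mod_id_hom:
  assumes "ab_module C M"
  shows "mod_id C M \<in> mod_hom C M M"
proof -
  interpret ab_module C M by fact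
  show ?thesis
    by (rule mod_homI)
      (auto simp: mod_id_def act_closed intro!: ext_hom_restrictI comm_group.axioms(2) grp)
qed

lemma mod_comp_hom:
  assumes \<eta>: "\<eta> \<in> mod_hom C L M" and \<theta>: "\<theta> \<in> mod_hom C M N" and L: "ab_module C L"
  shows "mod_comp C L \<theta> \<eta> \<in> mod_hom C L N"
proof -
  interpret ab_module C L by fact
  show ?thesis
    by (rule mod_homI)
      (auto simp: mod_comp_def act_closed compose_def mod_homD(2-4) [OF \<eta>] mod_homD(2-4) [OF \<theta>]
        intro!: ext_hom_restrictI comm_group.axioms(2) grp)
qed

section \<open>Tensor products of modules\<close>

locale mod_product = M: ab_module "opp R" M + N: ab_module R N
  for R :: "('o, 'a, 'z) preadditive_scheme" and M :: "('o, 'a, 'm) modul"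
    and N :: "('o, 'a, 'n) modul"
begin

abbreviation "T \<equiv> mod_tensor R M N"
abbreviation "pure \<equiv> mod_pure_tensor R M N"
abbreviation "grp_tensor a \<equiv> tensor (on_ob M a) (on_ob N a)"

lemma tensor_product: "a \<in> Ob R \<Longrightarrow> tensor_product (on_ob M a) (on_ob N a)"
  by (intro tensor_product.intro M.grp N.grp) auto

lemma grp_tensor_comm_group: "a \<in> Ob R \<Longrightarrow> comm_group (grp_tensor a)"
  by (rule tensor_product.comm_group_tensor [OF tensor_product])

lemma grp_tensor_group: "a \<in> Ob R \<Longrightarrow> group (grp_tensor a)"
  by (rule comm_group.axioms(2) [OF grp_tensor_comm_group])

lemma tensor_sum_comm_group: "comm_group (tensor_sum R M N)"
  unfolding tensor_sum_def by (rule comm_group_sum_group) (rule grp_tensor_comm_group)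

lemma tensor_sum_inj:
  "a \<in> Ob R \<Longrightarrow> sum_inj (Ob R) grp_tensor a \<in> hom (grp_tensor a) (tensor_sum R M N)"
  unfolding tensor_sum_def by (rule sum_inj_hom [where G = grp_tensor]) (rule grp_tensor_group)

text \<open>Separates the inclusion of a summand from the formation of a pure tensor, so that the
  facts on direct sums and on tensor products of groups can be applied one after the other.\<close>

lemma tensor_summand_eq:
  "tensor_summand R M N a x y = sum_inj (Ob R) grp_tensor a (pure_tensor (on_ob M a) (on_ob N a) x
    y)"
  unfolding tensor_summand_def sum_inj_def by (rule restrict_ext) simp

lemma tensor_summand_closed:
  "\<lbrakk>a \<in> Ob R; x \<in> carrier (on_ob M a); y \<in> carrier (on_ob N a)\<rbrakk>
   \<Longrightarrow> tensor_summand R M N a x y \<in> carrier (tensor_sum R M N)"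
  unfolding tensor_summand_eq
  by (intro hom_in_carrier [OF tensor_sum_inj] tensor_product.pure_tensor_closed
    [OF tensor_product])

definition "rels = {tensor_summand R M N a (on_hom M b a r x) y
        \<otimes>\<^bsub>tensor_sum R M N\<^esub> inv\<^bsub>tensor_sum R M N\<^esub> tensor_summand R M N b x (on_hom N a b r y) | a b
          r x y.
        a \<in> Ob R \<and> b \<in> Ob R \<and> r \<in> Hom R a b \<and> x \<in> carrier (on_ob M b) \<and> y \<in> carrier (on_ob N a)}"

lemma M_act_closed:
  "\<lbrakk>a \<in> Ob R; b \<in> Ob R; r \<in> Hom R a b; x \<in> carrier (on_ob M b)\<rbrakk>
    \<Longrightarrow> on_hom M b a r x \<in> carrier (on_ob M a)"
  by (rule M.act_closed) auto

lemma rels_subset: "rels \<subseteq> carrier (tensor_sum R M N)"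
proof -
  interpret S: comm_group "tensor_sum R M N" by (rule tensor_sum_comm_group)
  show ?thesis
    unfolding rels_def
    by (auto intro!: S.m_closed S.inv_closed tensor_summand_closed M_act_closed N.act_closed)
qed

lemma mod_tensor_ker_eq: "mod_tensor_ker R M N = generate (tensor_sum R M N) rels"
  by (simp add: mod_tensor_ker_def rels_def)

lemma comm_group_mod_tensor: "comm_group T"
  unfolding mod_tensor_def mod_tensor_ker_eq
  by (rule comm_group.quotient_generate(1) [OF tensor_sum_comm_group rels_subset])

lemma group_mod_tensor: "group T"
  by (rule comm_group.axioms(2) [OF comm_group_mod_tensor])

lemma quotient_hom: "(\<lambda>x. mod_tensor_ker R M N #>\<^bsub>tensor_sum R M N\<^esub> x) \<in> hom (tensor_sum R M N) T"
  unfolding mod_tensor_def mod_tensor_ker_eq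
  by (rule comm_group.quotient_generate(2) [OF tensor_sum_comm_group rels_subset])

lemma pure_closed:
  "\<lbrakk>a \<in> Ob R; x \<in> carrier (on_ob M a); y \<in> carrier (on_ob N a)\<rbrakk> \<Longrightarrow> pure a x y \<in> carrier T"
  unfolding mod_pure_tensor_def by (intro hom_in_carrier [OF quotient_hom] tensor_summand_closed)

lemma pure_hom:
  "a \<in> Ob R \<Longrightarrow> (\<lambda>t. mod_tensor_ker R M N #>\<^bsub>tensor_sum R M N\<^esub> sum_inj (Ob R) grp_tensor a t)
    \<in> hom (grp_tensor a) T"
  using hom_compose [OF tensor_sum_inj quotient_hom] by (simp add: comp_def)

lemma pure_mult_left:
  assumes "a \<in> Ob R" "x \<in> carrier (on_ob M a)" "x' \<in> carrier (on_ob M a)" "y \<in> carrier (on_ob N a)"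
  shows "pure a (x \<otimes>\<^bsub>on_ob M a\<^esub> x') y = pure a x y \<otimes>\<^bsub>T\<^esub> pure a x' y"
proof -
  interpret t: tensor_product "on_ob M a" "on_ob N a" by (rule tensor_product) fact
  show ?thesis
    unfolding mod_pure_tensor_def tensor_summand_eq using assms
    by (simp add: t.pure_tensor_mult_left hom_mult [OF pure_hom] t.pure_tensor_closed)
qed

lemma pure_mult_right:
  assumes "a \<in> Ob R" "x \<in> carrier (on_ob M a)" "y \<in> carrier (on_ob N a)" "y' \<in> carrier (on_ob N a)"
  shows "pure a x (y \<otimes>\<^bsub>on_ob N a\<^esub> y') = pure a x y \<otimes>\<^bsub>T\<^esub> pure a x y'"
proof -
  interpret t: tensor_product "on_ob M a" "on_ob N a" by (rule tensor_product) fact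
  show ?thesis
    unfolding mod_pure_tensor_def tensor_summand_eq using assms
    by (simp add: t.pure_tensor_mult_right hom_mult [OF pure_hom] t.pure_tensor_closed)
qed

text \<open>By additivity in the first variable the element is its own square, hence neutral. This
  is what makes a zero morphism extend to a zero morphism.\<close>

lemma pure_one_left:
  assumes "a \<in> Ob R" "y \<in> carrier (on_ob N a)"
  shows "pure a \<one>\<^bsub>on_ob M a\<^esub> y = \<one>\<^bsub>T\<^esub>"
proof -
  interpret T: comm_group T by (rule comm_group_mod_tensor)
  interpret A: comm_group "on_ob M a" by (rule M.grp) (use assms in simp)
  show ?thesis
    using pure_mult_left [of a "\<one>\<^bsub>on_ob M a\<^esub>" "\<one>\<^bsub>on_ob M a\<^esub>" y] pure_closed [of a "\<one>\<^bsub>on_ob M a\<^esub>" y]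
      assms
    by simp
qed

lemma pure_balanced:
  assumes "a \<in> Ob R" "b \<in> Ob R" "r \<in> Hom R a b" "x \<in> carrier (on_ob M b)" "y \<in> carrier (on_ob N a)"
  shows "pure a (on_hom M b a r x) y = pure b x (on_hom N a b r y)"
  unfolding mod_pure_tensor_def mod_tensor_ker_eq
proof (rule comm_group.quotient_generate(3) [OF tensor_sum_comm_group rels_subset])
  show "tensor_summand R M N a (on_hom M b a r x) y \<otimes>\<^bsub>tensor_sum R M N\<^esub>
      inv\<^bsub>tensor_sum R M N\<^esub> tensor_summand R M N b x (on_hom N a b r y) \<in> rels"
    unfolding rels_def using assms by blast
qed (use assms in \<open>auto intro!: tensor_summand_closed M_act_closed N.act_closed\<close>)

text \<open>The two layers of the construction are peeled off in turn: the quotient map reduces the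
  claim to the direct sum, the inclusions reduce it to the single summands, and there pure tensors
  suffice.\<close>

lemma hom_eqI:
  assumes K: "group K" and g: "g \<in> hom T K" and h: "h \<in> hom T K"
    and eq: "\<And>a x y. \<lbrakk>a \<in> Ob R; x \<in> carrier (on_ob M a); y \<in> carrier (on_ob N a)\<rbrakk>
      \<Longrightarrow> g (pure a x y) = h (pure a x y)"
    and t: "t \<in> carrier T"
  shows "g t = h t"
proof -
  let ?S = "tensor_sum R M N"
  let ?q = "\<lambda>x. mod_tensor_ker R M N #>\<^bsub>?S\<^esub> x"
  have q: "(\<lambda>x. f (?q x)) \<in> hom ?S K" if "f \<in> hom T K" for f
    using hom_compose [OF quotient_hom that] by (simp add: comp_def)
  have "g (?q s) = h (?q s)" if s: "s \<in> carrier ?S" for s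
  proof (rule sum_group_hom_eqI [where I = "Ob R" and G = grp_tensor, OF grp_tensor_group K])
    show "(\<lambda>x. g (?q x)) \<in> hom (sum_group (Ob R) grp_tensor) K" "(\<lambda>x. h (?q x))
      \<in> hom (sum_group (Ob R) grp_tensor) K"
      using q g h unfolding tensor_sum_def by auto
    show "s \<in> carrier (sum_group (Ob R) grp_tensor)"
      using s by (simp add: tensor_sum_def)
    fix a u assume a: "a \<in> Ob R" and u: "u \<in> carrier (grp_tensor a)"
    interpret t: tensor_product "on_ob M a" "on_ob N a" by (rule tensor_product) fact
    have qa: "(\<lambda>u. f (?q (sum_inj (Ob R) grp_tensor a u))) \<in> hom (grp_tensor a) K"
      if "f \<in> hom T K" for f
      using hom_compose [OF pure_hom [OF a] that] by (simp add: comp_def)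
    show "g (?q (sum_inj (Ob R) grp_tensor a u)) = h (?q (sum_inj (Ob R) grp_tensor a u))"
    proof (rule t.hom_eqI [OF K qa [OF g] qa [OF h] _ u])
      fix x y assume "x \<in> carrier (on_ob M a)" "y \<in> carrier (on_ob N a)"
      from eq [OF a this] show "g (?q (sum_inj (Ob R) grp_tensor a (pure_tensor (on_ob M a)
        (on_ob N a) x y)))
          = h (?q (sum_inj (Ob R) grp_tensor a (pure_tensor (on_ob M a) (on_ob N a) x y)))"
        by (simp add: mod_pure_tensor_def tensor_summand_eq)
    qed
  qed
  then show ?thesis
    using t hom_FactGroup_eqI [of t ?S "mod_tensor_ker R M N" g h] unfolding mod_tensor_def by blast
qed

text \<open>The first clause lets \<open>\<beta>\<close> factor through the tensor product over the
  integers at every object; the second makes the resulting map on the direct sum kill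
  \<open>rels\<close>.\<close>

definition balanced :: "('k, 'w) monoid_scheme \<Rightarrow> ('o \<Rightarrow> 'm \<Rightarrow> 'n \<Rightarrow> 'k) \<Rightarrow> bool" where
  "balanced K \<beta> \<longleftrightarrow>
    (\<forall>a\<in>Ob R. \<forall>x\<in>carrier (on_ob M a). \<forall>y\<in>carrier (on_ob N a). \<beta> a x y \<in> carrier K \<and>
      (\<forall>x'\<in>carrier (on_ob M a). \<beta> a (x \<otimes>\<^bsub>on_ob M a\<^esub> x') y = \<beta> a x y \<otimes>\<^bsub>K\<^esub> \<beta> a x' y) \<and>
      (\<forall>y'\<in>carrier (on_ob N a). \<beta> a x (y \<otimes>\<^bsub>on_ob N a\<^esub> y') = \<beta> a x y \<otimes>\<^bsub>K\<^esub> \<beta> a x y')) \<and>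
    (\<forall>a\<in>Ob R. \<forall>b\<in>Ob R. \<forall>r\<in>Hom R a b. \<forall>x\<in>carrier (on_ob M b). \<forall>y\<in>carrier (on_ob N a).
      \<beta> a (on_hom M b a r x) y = \<beta> b x (on_hom N a b r y))"

lemma universal:
  assumes K: "comm_group K" and \<beta>: "balanced K \<beta>"
  shows "\<exists>h\<in>ext_hom T K. \<forall>a\<in>Ob R. \<forall>x\<in>carrier (on_ob M a). \<forall>y\<in>carrier (on_ob N a). h (pure a x y)
    = \<beta> a x y"
proof -
  interpret K: comm_group K by fact
  let ?S = "tensor_sum R M N"
  interpret S: comm_group ?S by (rule tensor_sum_comm_group)
  have "\<exists>h\<in>hom (grp_tensor a) K. \<forall>x\<in>carrier (on_ob M a). \<forall>y\<in>carrier (on_ob N a).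
      h (pure_tensor (on_ob M a) (on_ob N a) x y) = \<beta> a x y" if a: "a \<in> Ob R" for a
  proof -
    interpret t: tensor_product "on_ob M a" "on_ob N a" by (rule tensor_product) fact
    show ?thesis
      by (rule t.universal [OF K]) (use \<beta> a in \<open>auto simp: balanced_def\<close>)
  qed
  then obtain f where f: "\<And>a. a \<in> Ob R \<Longrightarrow> f a \<in> hom (grp_tensor a) K"
    and f_pure: "\<And>a x y. \<lbrakk>a \<in> Ob R; x \<in> carrier (on_ob M a); y \<in> carrier (on_ob N a)\<rbrakk>
      \<Longrightarrow> f a (pure_tensor (on_ob M a) (on_ob N a) x y) = \<beta> a x y"
    by metis
  obtain k where k: "k \<in> hom ?S K"
    and kf: "\<And>a u. \<lbrakk>a \<in> Ob R; u \<in> carrier (grp_tensor a)\<rbrakk> \<Longrightarrow> k (sum_inj (Ob R) grp_tensor a u)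
      = f a u"
    using sum_group_universal [where I = "Ob R" and G = grp_tensor, OF grp_tensor_group K f]
    unfolding tensor_sum_def by blast
  have k_summand: "k (tensor_summand R M N a x y) = \<beta> a x y"
    if "a \<in> Ob R" "x \<in> carrier (on_ob M a)" "y \<in> carrier (on_ob N a)"
    for a x y unfolding tensor_summand_eq
    using that by (simp add: kf f_pure tensor_product.pure_tensor_closed [OF tensor_product])
  interpret k: group_hom ?S K k
    by unfold_locales (rule k)
  \<comment> \<open>A relation is a quotient of two summands on which \<open>k\<close> takes the
    same value, because \<open>\<beta>\<close> is balanced.\<close>
  have k_rels: "k u = \<one>\<^bsub>K\<^esub>" if u: "u \<in> rels" for u
  proof -
    from u obtain a b r x y where
      u: "u = tensor_summand R M N a (on_hom M b a r x) y \<otimes>\<^bsub>?S\<^esub> inv\<^bsub>?S\<^esub> tensor_summand R M N b x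
        (on_hom N a b r y)"
      and ab: "a \<in> Ob R" "b \<in> Ob R" "r \<in> Hom R a b" "x \<in> carrier (on_ob M b)"
        "y \<in> carrier (on_ob N a)"
      unfolding rels_def by blast
    have "\<beta> a (on_hom M b a r x) y = \<beta> b x (on_hom N a b r y)" "\<beta> b x (on_hom N a b r y)
      \<in> carrier K"
      using \<beta> ab N.act_closed by (auto simp: balanced_def)
    then show ?thesis
      unfolding u using ab
      by (simp add: tensor_summand_closed M_act_closed N.act_closed k_summand)
  qed
  obtain h where h: "h \<in> hom T K" and hk: "\<And>s. s \<in> carrier ?S \<Longrightarrow> h (mod_tensor_ker R M N #>\<^bsub>?S\<^esub> s)
    = k s"
    using S.quotient_universal [OF rels_subset K k k_rels] unfolding mod_tensor_def
      mod_tensor_ker_eq by blast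
  show ?thesis
  proof (intro bexI ballI)
    show "restrict h (carrier T) \<in> ext_hom T K"
      by (rule restrict_ext_hom [OF h group_mod_tensor])
    fix a x y assume "a \<in> Ob R" "x \<in> carrier (on_ob M a)" "y \<in> carrier (on_ob N a)"
    then show "restrict h (carrier T) (pure a x y) = \<beta> a x y"
      using hk tensor_summand_closed k_summand
        by (simp add: pure_closed) (simp add: mod_pure_tensor_def)
  qed
qed

end

text \<open>Justifies the description behind \<open>mod_tensor_map\<close>: naturality of \<eta> and
  \<theta> makes the assignment on pairs balanced, and uniqueness is agreement on pure
  tensors.\<close>

lemma mod_tensor_map:
  assumes MN: "mod_product R M N" and MN': "mod_product R M' N'"
    and \<eta>: "\<eta> \<in> mod_hom (opp R) M M'" and \<theta>: "\<theta> \<in> mod_hom R N N'"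
  shows "mod_tensor_map R M N M' N' \<eta> \<theta> \<in> ext_hom (mod_tensor R M N) (mod_tensor R M' N')"
    and "\<And>a x y. \<lbrakk>a \<in> Ob R; x \<in> carrier (on_ob M a); y \<in> carrier (on_ob N a)\<rbrakk>
      \<Longrightarrow> mod_tensor_map R M N M' N' \<eta> \<theta> (mod_pure_tensor R M N a x y) = mod_pure_tensor R M' N' a
        (\<eta> a x) (\<theta> a y)"
proof -
  interpret A: mod_product R M N by fact
  interpret B: mod_product R M' N' by fact
  note \<eta>s = mod_homD(2-4) [OF \<eta>, simplified] and \<theta>s = mod_homD(2-4) [OF \<theta>]
  let ?Q = "\<lambda>h. h \<in> ext_hom A.T B.T \<and> (\<forall>a\<in>Ob R. \<forall>x\<in>carrier (on_ob M a). \<forall>y\<in>carrier (on_ob N a).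
        h (A.pure a x y) = B.pure a (\<eta> a x) (\<theta> a y))"
  have "A.balanced B.T (\<lambda>a x y. B.pure a (\<eta> a x) (\<theta> a y))"
    unfolding A.balanced_def
    by (simp add: \<eta>s \<theta>s B.pure_closed B.pure_mult_left B.pure_mult_right B.pure_balanced)
  from A.universal [OF B.comm_group_mod_tensor this] obtain h where h: "?Q h"
    by blast
  have "\<exists>!h. ?Q h"
  proof (rule ex1I [of ?Q, OF h])
    fix g assume g: "?Q g"
    show "g = h"
    proof (rule ext_hom_eqI)
      fix t assume t: "t \<in> carrier A.T"
      show "g t = h t"
        by (rule A.hom_eqI [OF B.group_mod_tensor _ _ _ t]) (use g h in \<open>auto intro: ext_hom_hom\<close>)
    qed (use g h in auto)
  qed
  from theI' [OF this] show "mod_tensor_map R M N M' N' \<eta> \<theta> \<in> ext_hom A.T B.T"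
    and "\<And>a x y. \<lbrakk>a \<in> Ob R; x \<in> carrier (on_ob M a); y \<in> carrier (on_ob N a)\<rbrakk>
      \<Longrightarrow> mod_tensor_map R M N M' N' \<eta> \<theta> (A.pure a x y) = B.pure a (\<eta> a x) (\<theta> a y)"
    unfolding mod_tensor_map_def by auto
qed

lemma right_modules_sel [simp]:
  "Hom (right_modules C) = mod_hom (opp C)" "Ident (right_modules C) = mod_id (opp C)"
  "Comp (right_modules C) L M N \<theta> \<eta> = mod_comp (opp C) L \<theta> \<eta>"
  by (simp_all add: right_modules_def left_modules_def)

lemma (in preadditive_category) Ob_right_modules: "M \<in> Ob (right_modules C) \<longleftrightarrow> ab_module (opp C) M"
  by (simp add: right_modules_def left_modules_def ab_module_def ab_module_axioms_def
    preadditive_opp)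

lemma (in preadditive_category) add_closed:
  assumes "a \<in> Ob C" "b \<in> Ob C" "f \<in> Hom C a b" "g \<in> Hom C a b"
  shows "f \<otimes>\<^bsub>HomGrp C a b\<^esub> g \<in> Hom C a b"
proof -
  interpret comm_group "HomGrp C a b" by (rule HomGrp_comm_group) fact+
  show ?thesis
    using m_closed [of f g, unfolded HomGrp_carrier [OF assms(1,2)]] assms by blast
qed

lemma hom_ident: "(\<lambda>x. x) \<in> hom G G"
  by (simp add: hom_def)

section \<open>Restriction and extension of scalars\<close>

locale add_functor = C: preadditive_category C + D: preadditive_category D
  for C :: "('o, 'a, 'y) preadditive_scheme" and D :: "('p, 'b, 'z) preadditive_scheme"
    and F :: "('o, 'a, 'p, 'b) cfun" +
  assumes additive: "additive_functor C D F"
begin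

lemma ob: "a \<in> Ob C \<Longrightarrow> on_ob F a \<in> Ob D"
  using additive by (auto simp: additive_functor_def is_functor_def)

lemma arr: "\<lbrakk>a \<in> Ob C; b \<in> Ob C; f \<in> Hom C a b\<rbrakk> \<Longrightarrow> on_hom F a b f \<in> Hom D (on_ob F a) (on_ob F b)"
  using additive by (auto simp: additive_functor_def is_functor_def)

lemma id: "a \<in> Ob C \<Longrightarrow> on_hom F a a (Ident C a) = Ident D (on_ob F a)"
  using additive by (auto simp: additive_functor_def is_functor_def)

lemma comp:
  "\<lbrakk>a \<in> Ob C; b \<in> Ob C; c \<in> Ob C; f \<in> Hom C a b; g \<in> Hom C b c\<rbrakk>
   \<Longrightarrow> on_hom F a c (Comp C a b c g f)
    = Comp D (on_ob F a) (on_ob F b) (on_ob F c) (on_hom F b c g) (on_hom F a b f)"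
  using additive by (auto simp: additive_functor_def is_functor_def)

lemma add:
  "\<lbrakk>a \<in> Ob C; b \<in> Ob C; f \<in> Hom C a b; g \<in> Hom C a b\<rbrakk>
   \<Longrightarrow> on_hom F a b (f \<otimes>\<^bsub>HomGrp C a b\<^esub> g)
    = on_hom F a b f \<otimes>\<^bsub>HomGrp D (on_ob F a) (on_ob F b)\<^esub> on_hom F a b g"
  using additive by (auto simp: additive_functor_def hom_def C.HomGrp_carrier)

section \<open>Restriction of scalars as a functor\<close>

lemma restriction_module:
  assumes "ab_module (opp D) M"
  shows "ab_module (opp C) (on_ob (restriction C F) M)"
proof -
  interpret M: ab_module "opp D" M by fact
  show ?thesis
    by (rule ab_moduleI [OF C.preadditive_opp])
      (simp_all add: restriction_def ob arr comp id add M.grp M.act_ext_hom M.act_id [simplified]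
        M.act_comp [simplified] M.act_add [simplified])
qed

lemma restriction_map:
  assumes "ab_module (opp D) M" and \<eta>: "\<eta> \<in> mod_hom (opp D) M N"
  shows "on_hom (restriction C F) M N \<eta> \<in> mod_hom (opp C) (on_ob (restriction C F) M)
    (on_ob (restriction C F) N)"
  by (rule mod_homI) (auto simp: restriction_def ob arr mod_homD(1,4) [OF \<eta>, simplified])

lemma is_functor_restriction:
  "is_functor (right_modules D :: (('p, 'b, 'm) modul, 'p \<Rightarrow> 'm \<Rightarrow> 'm) category) (right_modules C)
    (restriction C F)"
  unfolding is_functor_def right_modules_sel C.Ob_right_modules D.Ob_right_modules
proof (intro conjI ballI; unfold D.Ob_right_modules)
  fix M :: "('p, 'b, 'm) modul" assume M: "ab_module (opp D) M"
  then show "ab_module (opp C) (on_ob (restriction C F) M)" by (rule restriction_module)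
  show "on_hom (restriction C F) M M (mod_id (opp D) M) = mod_id (opp C) (on_ob (restriction C F)
    M)"
    by (auto simp: restriction_def mod_id_def ob)
  fix N :: "('p, 'b, 'm) modul" and \<eta> assume \<eta>: "\<eta> \<in> mod_hom (opp D) M N"
  from M this show "on_hom (restriction C F) M N \<eta>
      \<in> mod_hom (opp C) (on_ob (restriction C F) M) (on_ob (restriction C F) N)"
    by (rule restriction_map)
  fix L and \<theta>
  show "on_hom (restriction C F) M L (mod_comp (opp D) M \<theta> \<eta>)
      = mod_comp (opp C) (on_ob (restriction C F) M) (on_hom (restriction C F) N L \<theta>)
        (on_hom (restriction C F) M N \<eta>)"
    by (auto simp: restriction_def mod_comp_def ob)
qed

section \<open>The modules D(s, F(?)) and the tensor products with them\<close>

abbreviation "hmod \<equiv> hom_module D F"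
abbreviation "E \<equiv> on_ob (extension C D F)"
abbreviation "E\<^sub>m \<equiv> on_hom (extension C D F)"
abbreviation "ten M s \<equiv> mod_pure_tensor C M (hmod s)"
abbreviation "Ten M s \<equiv> mod_tensor C M (hmod s)"

lemma hmod_sel [simp]:
  "on_ob (hmod s) b = HomGrp D s (on_ob F b)"
  "f \<in> Hom D s (on_ob F b) \<Longrightarrow> on_hom (hmod s) b b' r f = Comp D s (on_ob F b) (on_ob F b')
    (on_hom F b b' r) f"
  by (simp_all add: hom_module_def)

lemma hmod_module:
  assumes s: "s \<in> Ob D"
  shows "ab_module C (hmod s)"
proof (rule ab_moduleI)
  show "preadditive_category C" by unfold_locales
  fix a b f assume ab: "a \<in> Ob C" "b \<in> Ob C" "f \<in> Hom C a b"
  interpret G: comm_group "HomGrp D s (on_ob F a)"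
    by (rule D.HomGrp_comm_group) (use s ab ob in auto)
  have "(\<lambda>g\<in>carrier (HomGrp D s (on_ob F a)). Comp D s (on_ob F a) (on_ob F b) (on_hom F a b f) g)
      \<in> ext_hom (HomGrp D s (on_ob F a)) (HomGrp D s (on_ob F b))"
    by (rule ext_hom_restrictI)
      (use ab s in \<open>auto simp: D.HomGrp_carrier ob arr D.Comp_in_Hom D.Comp_add_right G.is_group\<close>)
  then show "on_hom (hmod s) a b f \<in> ext_hom (on_ob (hmod s) a) (on_ob (hmod s) b)"
    using ab s by (simp add: hom_module_def D.HomGrp_carrier ob)
qed (use s in \<open>simp_all add: D.HomGrp_carrier D.HomGrp_comm_group ob arr id comp add
  D.Comp_Ident_left
      D.Comp_assoc D.Comp_in_Hom D.Comp_add_left\<close>)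

lemma hmod_map:
  assumes s: "s \<in> Ob D" "s' \<in> Ob D" and t: "t \<in> Hom D s' s"
  shows "hom_module_map C D F s s' t \<in> mod_hom C (hmod s) (hmod s')"
proof (rule mod_homI)
  fix a assume a: "a \<in> Ob C"
  interpret G: comm_group "HomGrp D s (on_ob F a)"
    by (rule D.HomGrp_comm_group) (use s a ob in auto)
  have "(\<lambda>g\<in>carrier (HomGrp D s (on_ob F a)). Comp D s' s (on_ob F a) g t)
      \<in> ext_hom (HomGrp D s (on_ob F a)) (HomGrp D s' (on_ob F a))"
    by (rule ext_hom_restrictI)
      (use a s t in \<open>auto simp: D.HomGrp_carrier ob arr D.Comp_in_Hom D.Comp_add_left G.is_group\<close>)
  then show "hom_module_map C D F s s' t a \<in> ext_hom (on_ob (hmod s) a) (on_ob (hmod s') a)"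
    using a s by (simp add: hom_module_map_def D.HomGrp_carrier ob)
qed (use s t in \<open>auto simp: hom_module_map_def D.HomGrp_carrier ob arr D.Comp_in_Hom D.Comp_assoc\<close>)

context
  fixes M :: "('o, 'a, 'm) modul"
  assumes M: "ab_module (opp C) M"
begin

interpretation M: ab_module "opp C" M by (rule M)

lemma ten_product: "s \<in> Ob D \<Longrightarrow> mod_product C M (hmod s)"
  by (intro mod_product.intro M hmod_module)

lemmas Ten_comm_group = mod_product.comm_group_mod_tensor [OF ten_product]
lemmas Ten_group = mod_product.group_mod_tensor [OF ten_product]

lemma ten_closed:
  "\<lbrakk>s \<in> Ob D; a \<in> Ob C; x \<in> carrier (on_ob M a); f \<in> Hom D s (on_ob F a)\<rbrakk>
    \<Longrightarrow> ten M s a x f \<in> carrier (Ten M s)"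
  by (rule mod_product.pure_closed [OF ten_product]) (simp_all add: D.HomGrp_carrier ob)

lemma ten_mult_left:
  "\<lbrakk>s \<in> Ob D; a \<in> Ob C; x \<in> carrier (on_ob M a); x' \<in> carrier (on_ob M a); f \<in> Hom D s (on_ob F a)\<rbrakk>
   \<Longrightarrow> ten M s a (x \<otimes>\<^bsub>on_ob M a\<^esub> x') f = ten M s a x f \<otimes>\<^bsub>Ten M s\<^esub> ten M s a x' f"
  by (rule mod_product.pure_mult_left [OF ten_product]) (simp_all add: D.HomGrp_carrier ob)

lemma ten_mult_right:
  "\<lbrakk>s \<in> Ob D; a \<in> Ob C; x \<in> carrier (on_ob M a); f \<in> Hom D s (on_ob F a); g \<in> Hom D s (on_ob F a)\<rbrakk>
   \<Longrightarrow> ten M s a x (f \<otimes>\<^bsub>HomGrp D s (on_ob F a)\<^esub> g) = ten M s a x f \<otimes>\<^bsub>Ten M s\<^esub> ten M s a x g"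
  using mod_product.pure_mult_right [OF ten_product, of s a x f g]
    by (simp add: D.HomGrp_carrier ob)

lemma ten_one_left:
  "\<lbrakk>s \<in> Ob D; a \<in> Ob C; f \<in> Hom D s (on_ob F a)\<rbrakk> \<Longrightarrow> ten M s a \<one>\<^bsub>on_ob M a\<^esub> f = \<one>\<^bsub>Ten M s\<^esub>"
  by (rule mod_product.pure_one_left [OF ten_product]) (simp_all add: D.HomGrp_carrier ob)

lemma ten_balanced:
  "\<lbrakk>s \<in> Ob D; a \<in> Ob C; b \<in> Ob C; r \<in> Hom C a b; x \<in> carrier (on_ob M b); f \<in> Hom D s (on_ob F a)\<rbrakk>
   \<Longrightarrow> ten M s a (on_hom M b a r x) f = ten M s b x (Comp D s (on_ob F a) (on_ob F b) (on_hom F a b r)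
     f)"
  using mod_product.pure_balanced [OF ten_product, of s a b r x f]
    by (simp add: D.HomGrp_carrier ob)

lemma ten_hom_eqI:
  assumes "s \<in> Ob D" "group K" "g \<in> hom (Ten M s) K" "h \<in> hom (Ten M s) K"
    and "\<And>a x f. \<lbrakk>a \<in> Ob C; x \<in> carrier (on_ob M a); f \<in> Hom D s (on_ob F a)\<rbrakk>
      \<Longrightarrow> g (ten M s a x f) = h (ten M s a x f)"
    and "t \<in> carrier (Ten M s)"
  shows "g t = h t"
  by (rule mod_product.hom_eqI [OF ten_product [OF assms(1)] assms(2-4) _ assms(6)])
    (use assms(1,5) in \<open>simp add: D.HomGrp_carrier ob\<close>)

text \<open>The universal property of \<open>mod_tensor\<close> for the second factor D(s, F(?)),
  with hom-sets in place of carriers of hom-groups and the left action written as composition with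
  F(r).\<close>

lemma ten_universal:
  assumes s: "s \<in> Ob D" and K: "comm_group K"
    and "\<And>a x f. \<lbrakk>a \<in> Ob C; x \<in> carrier (on_ob M a); f \<in> Hom D s (on_ob F a)\<rbrakk> \<Longrightarrow> \<beta> a x f \<in> carrier K"
    and "\<And>a x y f. \<lbrakk>a \<in> Ob C; x \<in> carrier (on_ob M a); y \<in> carrier (on_ob M a);
      f \<in> Hom D s (on_ob F a)\<rbrakk>
      \<Longrightarrow> \<beta> a (x \<otimes>\<^bsub>on_ob M a\<^esub> y) f = \<beta> a x f \<otimes>\<^bsub>K\<^esub> \<beta> a y f"
    and "\<And>a x f g. \<lbrakk>a \<in> Ob C; x \<in> carrier (on_ob M a); f \<in> Hom D s (on_ob F a);
      g \<in> Hom D s (on_ob F a)\<rbrakk>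
      \<Longrightarrow> \<beta> a x (f \<otimes>\<^bsub>HomGrp D s (on_ob F a)\<^esub> g) = \<beta> a x f \<otimes>\<^bsub>K\<^esub> \<beta> a x g"
    and "\<And>a b r x f. \<lbrakk>a \<in> Ob C; b \<in> Ob C; r \<in> Hom C a b; x \<in> carrier (on_ob M b);
      f \<in> Hom D s (on_ob F a)\<rbrakk>
      \<Longrightarrow> \<beta> a (on_hom M b a r x) f = \<beta> b x (Comp D s (on_ob F a) (on_ob F b) (on_hom F a b r) f)"
  shows "\<exists>h\<in>ext_hom (Ten M s) K. \<forall>a\<in>Ob C. \<forall>x\<in>carrier (on_ob M a). \<forall>f\<in>Hom D s (on_ob F a).
    h (ten M s a x f) = \<beta> a x f"
proof -
  have c: "carrier (HomGrp D s (on_ob F a)) = Hom D s (on_ob F a)" if "a \<in> Ob C" for a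
    using s that by (simp add: D.HomGrp_carrier ob)
  have "mod_product.balanced C M (hmod s) K \<beta>"
    unfolding mod_product.balanced_def [OF ten_product [OF s]]
    by (auto simp: c assms(3-6))
  from mod_product.universal [OF ten_product [OF s] K this] show ?thesis
    by (simp add: c)
qed

section \<open>The extended module\<close>

lemma E_ob [simp]: "on_ob (E M) s = Ten M s"
  by (simp add: extension_def)

text \<open>An arrow t acts by precomposition on the second tensor factor only. Together with
  agreement on pure tensors, the two clauses determine the action completely.\<close>

lemma E_act:
  assumes s: "s \<in> Ob D" "s' \<in> Ob D" and t: "t \<in> Hom D s' s"
  shows "on_hom (E M) s s' t \<in> ext_hom (Ten M s) (Ten M s')"
    and "\<And>a x f. \<lbrakk>a \<in> Ob C; x \<in> carrier (on_ob M a); f \<in> Hom D s (on_ob F a)\<rbrakk>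
      \<Longrightarrow> on_hom (E M) s s' t (ten M s a x f) = ten M s' a x (Comp D s' s (on_ob F a) f t)"
  using mod_tensor_map [OF ten_product [OF s(1)] ten_product [OF s(2)] mod_id_hom [OF M] hmod_map
    [OF s t]] s
  by (simp_all add: extension_def mod_id_def hom_module_map_def D.HomGrp_carrier ob)

lemma E_act_hom:
  "\<lbrakk>s \<in> Ob D; s' \<in> Ob D; t \<in> Hom D s' s\<rbrakk> \<Longrightarrow> on_hom (E M) s s' t \<in> hom (Ten M s) (Ten M s')"
  using E_act(1) by (rule ext_hom_hom)

lemma E_module: "ab_module (opp D) (E M)"
proof (rule ab_moduleI [OF D.preadditive_opp])
  fix a assume a: "a \<in> Ob (opp D)"
  then show "comm_group (on_ob (E M) a)"
    using Ten_comm_group by simp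
  fix x assume x: "x \<in> carrier (on_ob (E M) a)"
  show "on_hom (E M) a a (Ident (opp D) a) x = x"
    by (rule ten_hom_eqI [where s = a and K = "Ten M a" and h = "\<lambda>x. x"])
      (use a x in \<open>auto simp: Ten_group E_act E_act_hom D.Ident_in_Hom D.Comp_Ident_right ob
        hom_ident\<close>)
next
  fix a b c f g x
  assume *: "a \<in> Ob (opp D)" "b \<in> Ob (opp D)" "c \<in> Ob (opp D)" "f \<in> Hom (opp D) a b"
    "g \<in> Hom (opp D) b c"
    and x: "x \<in> carrier (on_ob (E M) a)"
  have "(\<lambda>x. on_hom (E M) b c g (on_hom (E M) a b f x)) \<in> hom (Ten M a) (Ten M c)"
    using hom_compose [OF E_act_hom [of a b f] E_act_hom [of b c g]] * by (simp add: comp_def)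
  then show "on_hom (E M) a c (Comp (opp D) a b c g f) x = on_hom (E M) b c g (on_hom (E M) a b f
    x)"
    by (rule ten_hom_eqI [where s = a and K = "Ten M c", rotated 3])
      (use * x in \<open>auto simp: Ten_group E_act E_act_hom D.Comp_in_Hom D.Comp_assoc ob\<close>)
next
  fix a b f g x
  assume *: "a \<in> Ob (opp D)" "b \<in> Ob (opp D)" "f \<in> Hom (opp D) a b" "g \<in> Hom (opp D) a b"
    and x: "x \<in> carrier (on_ob (E M) a)"
  interpret K: comm_group "Ten M b" by (rule Ten_comm_group) (use * in simp)
  have fg: "f \<otimes>\<^bsub>HomGrp D b a\<^esub> g \<in> Hom D b a"
    using * by (auto simp: D.add_closed)
  have "(\<lambda>x. on_hom (E M) a b f x \<otimes>\<^bsub>Ten M b\<^esub> on_hom (E M) a b g x) \<in> hom (Ten M a) (Ten M b)"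
    by (intro K.hom_group_mult E_act_hom) (use * in auto)
  then show "on_hom (E M) a b (f \<otimes>\<^bsub>HomGrp (opp D) a b\<^esub> g) x
      = on_hom (E M) a b f x \<otimes>\<^bsub>on_ob (E M) b\<^esub> on_hom (E M) a b g x"
    unfolding E_ob
    by (rule ten_hom_eqI [where s = a and K = "Ten M b", rotated 3])
      (use * x fg in \<open>auto simp: Ten_group E_act E_act_hom D.Comp_in_Hom D.Comp_add_right
        ten_mult_right ob\<close>)
qed (simp add: E_act)

end

section \<open>Extension of scalars as a functor\<close>

lemma E_map:
  assumes M: "ab_module (opp C) M" and N: "ab_module (opp C) N" and \<eta>: "\<eta> \<in> mod_hom (opp C) M N"
  shows "E\<^sub>m M N \<eta> \<in> mod_hom (opp D) (E M) (E N)"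
    and "\<And>s a x f. \<lbrakk>s \<in> Ob D; a \<in> Ob C; x \<in> carrier (on_ob M a); f \<in> Hom D s (on_ob F a)\<rbrakk>
      \<Longrightarrow> E\<^sub>m M N \<eta> s (ten M s a x f) = ten N s a (\<eta> a x) f"
proof -
  note map = mod_tensor_map [OF ten_product [OF M] ten_product [OF N] \<eta> mod_id_hom [OF hmod_module]]
  note \<eta>s = mod_homD(2-4) [OF \<eta>, simplified]
  have 1: "E\<^sub>m M N \<eta> s \<in> ext_hom (Ten M s) (Ten N s)" if "s \<in> Ob D" for s
    using map(1) that by (simp add: extension_def)
  show 2: "E\<^sub>m M N \<eta> s (ten M s a x f) = ten N s a (\<eta> a x) f"
    if "s \<in> Ob D" "a \<in> Ob C" "x \<in> carrier (on_ob M a)" "f \<in> Hom D s (on_ob F a)" for s a x f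
    using map(2) [OF that(1) that(1) that(1), of a x f] that
      by (simp add: extension_def mod_id_def D.HomGrp_carrier ob)
  show "E\<^sub>m M N \<eta> \<in> mod_hom (opp D) (E M) (E N)"
  proof (rule mod_homI)
    show "E\<^sub>m M N \<eta> \<in> extensional (Ob (opp D))" by (simp add: extension_def)
    fix s assume s: "s \<in> Ob (opp D)"
    then show "E\<^sub>m M N \<eta> s \<in> ext_hom (on_ob (E M) s) (on_ob (E N) s)" using 1 by (simp add: M N)
    fix s' t w assume s': "s' \<in> Ob (opp D)" and t: "t \<in> Hom (opp D) s s'"
      and w: "w \<in> carrier (on_ob (E M) s)"
    have "(\<lambda>w. E\<^sub>m M N \<eta> s' (on_hom (E M) s s' t w)) \<in> hom (Ten M s) (Ten N s')"
      "(\<lambda>w. on_hom (E N) s s' t (E\<^sub>m M N \<eta> s w)) \<in> hom (Ten M s) (Ten N s')"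
      using hom_compose [OF E_act_hom [OF M, of s s' t] ext_hom_hom [OF 1 [of s']]]
        hom_compose [OF ext_hom_hom [OF 1 [of s]] E_act_hom [OF N, of s s' t]] s s' t
      by (simp_all add: comp_def)
    then show "E\<^sub>m M N \<eta> s' (on_hom (E M) s s' t w) = on_hom (E N) s s' t (E\<^sub>m M N \<eta> s w)"
      by (rule ten_hom_eqI [OF M, where s = s and K = "Ten N s'", rotated 2])
        (use s s' t w in \<open>auto simp: M Ten_group [OF N] E_act(2) [OF M] E_act(2)
          [OF N] 2 \<eta>s D.Comp_in_Hom ob\<close>)
  qed
qed

lemma is_functor_extension:
  "is_functor (right_modules C :: (('o, 'a, 'm) modul, 'o \<Rightarrow> 'm \<Rightarrow> 'm) category) (right_modules D)
    (extension C D F)"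
proof -
  show ?thesis
    unfolding is_functor_def right_modules_sel C.Ob_right_modules D.Ob_right_modules
  proof (intro conjI ballI; unfold C.Ob_right_modules)
    fix M :: "('o, 'a, 'm) modul" assume M: "ab_module (opp C) M"
    then show "ab_module (opp D) (E M)" by (rule E_module)
    note idM = mod_id_hom [OF M]
    show "E\<^sub>m M M (mod_id (opp C) M) = mod_id (opp D) (E M)"
    proof (rule mod_hom_eqI [OF E_map(1) [OF M M idM] mod_id_hom [OF E_module [OF M]]])
      fix s w assume s: "s \<in> Ob (opp D)" and w: "w \<in> carrier (on_ob (E M) s)"
      have id: "mod_id (opp C) M a x = x" if "a \<in> Ob C" "x \<in> carrier (on_ob M a)" for a x
        using that by (simp add: mod_id_def)
      have "E\<^sub>m M M (mod_id (opp C) M) s w = w"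
        by (rule ten_hom_eqI [OF M, where s = s and K = "Ten M s" and h = "\<lambda>x. x"])
          (use s w mod_homD(1) [OF E_map(1) [OF M M idM] s, THEN ext_hom_hom] in
            \<open>auto simp: M Ten_group E_map(2) [OF M M idM] id hom_ident\<close>)
      then show "E\<^sub>m M M (mod_id (opp C) M) s w = mod_id (opp D) (E M) s w"
        using s w by (simp add: mod_id_def)
    qed
    fix N :: "('o, 'a, 'm) modul" assume N: "ab_module (opp C) N"
    fix \<eta> assume \<eta>: "\<eta> \<in> mod_hom (opp C) M N"
    show "E\<^sub>m M N \<eta> \<in> mod_hom (opp D) (E M) (E N)"
      by (rule E_map(1) [OF M N \<eta>])
    fix L :: "('o, 'a, 'm) modul" assume L: "ab_module (opp C) L"
    fix \<theta> assume \<theta>: "\<theta> \<in> mod_hom (opp C) N L"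
    have \<theta>\<eta>: "mod_comp (opp C) M \<theta> \<eta> \<in> mod_hom (opp C) M L"
      by (rule mod_comp_hom [OF \<eta> \<theta> M])
    show "E\<^sub>m M L (mod_comp (opp C) M \<theta> \<eta>) = mod_comp (opp D) (E M) (E\<^sub>m N L \<theta>) (E\<^sub>m M N \<eta>)"
    proof (rule mod_hom_eqI [OF E_map(1) [OF M L \<theta>\<eta>] mod_comp_hom [OF E_map(1) [OF M N \<eta>] E_map(1)
      [OF N L \<theta>] E_module [OF M]]])
      fix s w assume s: "s \<in> Ob (opp D)" and w: "w \<in> carrier (on_ob (E M) s)"
      note h\<eta> = mod_homD(1) [OF E_map(1) [OF M N \<eta>] s, THEN ext_hom_hom]
      note h\<theta> = mod_homD(1) [OF E_map(1) [OF N L \<theta>] s, THEN ext_hom_hom]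
      have cmp: "mod_comp (opp C) M \<theta> \<eta> a x = \<theta> a (\<eta> a x)"
        if "a \<in> Ob C" "x \<in> carrier (on_ob M a)" for a x
        using that by (simp add: mod_comp_def compose_def)
      have "E\<^sub>m M L (mod_comp (opp C) M \<theta> \<eta>) s w = E\<^sub>m N L \<theta> s (E\<^sub>m M N \<eta> s w)"
        by (rule ten_hom_eqI [OF M, where s = s and K = "Ten L s" and t = w
              and h = "\<lambda>w. E\<^sub>m N L \<theta> s (E\<^sub>m M N \<eta> s w)"])
          (use s w mod_homD(1) [OF E_map(1) [OF M L \<theta>\<eta>] s, THEN ext_hom_hom] hom_compose
            [OF h\<eta> h\<theta>, unfolded comp_def] in
            \<open>auto simp: M N L Ten_group E_map(2) [OF M N \<eta>] E_map(2) [OF N L \<theta>] E_map(2) [OF M L \<theta>\<eta>]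
               cmp mod_homD(2) [OF \<eta>]\<close>)
      then show "E\<^sub>m M L (mod_comp (opp C) M \<theta> \<eta>) s w
          = mod_comp (opp D) (E M) (E\<^sub>m N L \<theta>) (E\<^sub>m M N \<eta>) s w"
        using s w by (simp add: mod_comp_def compose_def)
    qed
  qed
qed

section \<open>Morphisms out of an extended module\<close>

lemma E_hom_eqI:
  assumes M: "ab_module (opp C) M" and N: "ab_module (opp D) N"
    and \<eta>: "\<eta> \<in> mod_hom (opp D) (E M) N" and \<theta>: "\<theta> \<in> mod_hom (opp D) (E M) N"
    and eq: "\<And>s a x f. \<lbrakk>s \<in> Ob D; a \<in> Ob C; x \<in> carrier (on_ob M a); f \<in> Hom D s (on_ob F a)\<rbrakk>
      \<Longrightarrow> \<eta> s (ten M s a x f) = \<theta> s (ten M s a x f)"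
  shows "\<eta> = \<theta>"
proof (rule mod_hom_eqI [OF \<eta> \<theta>])
  interpret N: ab_module "opp D" N by fact
  fix s w assume s: "s \<in> Ob (opp D)" and w: "w \<in> carrier (on_ob (E M) s)"
  show "\<eta> s w = \<theta> s w"
    by (rule ten_hom_eqI [OF M, where s = s and K = "on_ob N s"])
      (use s w eq mod_homD(1) [OF \<eta> s, THEN ext_hom_hom] mod_homD(1) [OF \<theta> s, THEN ext_hom_hom]
        comm_group.axioms(2) [OF N.grp] in \<open>simp_all add: M\<close>)
qed

text \<open>\<open>cl\<close>, \<open>l\<close>, \<open>r\<close> and \<open>bal\<close> give a
  homomorphism at each object by the universal property. \<open>nat\<close> states compatibility
  with the action on pure tensors only, and this spreads to all elements because both composites are
  homomorphisms.\<close>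

lemma E_hom_exists:
  assumes M: "ab_module (opp C) M" and N: "ab_module (opp D) N"
    and cl: "\<And>s a x f. \<lbrakk>s \<in> Ob D; a \<in> Ob C; x \<in> carrier (on_ob M a); f \<in> Hom D s (on_ob F a)\<rbrakk>
      \<Longrightarrow> \<beta> s a x f \<in> carrier (on_ob N s)"
    and l: "\<And>s a x y f. \<lbrakk>s \<in> Ob D; a \<in> Ob C; x \<in> carrier (on_ob M a); y \<in> carrier (on_ob M a);
      f \<in> Hom D s (on_ob F a)\<rbrakk>
      \<Longrightarrow> \<beta> s a (x \<otimes>\<^bsub>on_ob M a\<^esub> y) f = \<beta> s a x f \<otimes>\<^bsub>on_ob N s\<^esub> \<beta> s a y f"
    and r: "\<And>s a x f g. \<lbrakk>s \<in> Ob D; a \<in> Ob C; x \<in> carrier (on_ob M a); f \<in> Hom D s (on_ob F a);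
      g \<in> Hom D s (on_ob F a)\<rbrakk>
      \<Longrightarrow> \<beta> s a x (f \<otimes>\<^bsub>HomGrp D s (on_ob F a)\<^esub> g) = \<beta> s a x f \<otimes>\<^bsub>on_ob N s\<^esub> \<beta> s a x g"
    and bal: "\<And>s a b r x f. \<lbrakk>s \<in> Ob D; a \<in> Ob C; b \<in> Ob C; r \<in> Hom C a b; x \<in> carrier (on_ob M b);
      f \<in> Hom D s (on_ob F a)\<rbrakk>
      \<Longrightarrow> \<beta> s a (on_hom M b a r x) f = \<beta> s b x (Comp D s (on_ob F a) (on_ob F b) (on_hom F a b r) f)"
    and nat: "\<And>s s' t a x f. \<lbrakk>s \<in> Ob D; s' \<in> Ob D; t \<in> Hom D s' s; a \<in> Ob C;
      x \<in> carrier (on_ob M a); f \<in> Hom D s (on_ob F a)\<rbrakk>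
      \<Longrightarrow> \<beta> s' a x (Comp D s' s (on_ob F a) f t) = on_hom N s s' t (\<beta> s a x f)"
  shows "\<exists>\<eta>\<in>mod_hom (opp D) (E M) N. \<forall>s\<in>Ob D. \<forall>a\<in>Ob C. \<forall>x\<in>carrier (on_ob M a). \<forall>f\<in>Hom D s
    (on_ob F a).
    \<eta> s (ten M s a x f) = \<beta> s a x f"
proof -
  interpret N: ab_module "opp D" N by fact
  have "\<exists>h\<in>ext_hom (Ten M s) (on_ob N s). \<forall>a\<in>Ob C. \<forall>x\<in>carrier (on_ob M a). \<forall>f\<in>Hom D s (on_ob F a).
      h (ten M s a x f) = \<beta> s a x f" if s: "s \<in> Ob D" for s
    by (rule ten_universal [OF M s N.grp]) (use s cl l r bal in auto)
  then obtain h where h: "\<And>s. s \<in> Ob D \<Longrightarrow> h s \<in> ext_hom (Ten M s) (on_ob N s)"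
    and h_ten: "\<And>s a x f. \<lbrakk>s \<in> Ob D; a \<in> Ob C; x \<in> carrier (on_ob M a); f \<in> Hom D s (on_ob F a)\<rbrakk>
      \<Longrightarrow> h s (ten M s a x f) = \<beta> s a x f"
    by metis
  have "restrict h (Ob D) \<in> mod_hom (opp D) (E M) N"
  proof (rule mod_homI)
    fix s assume s: "s \<in> Ob (opp D)"
    then show "restrict h (Ob D) s \<in> ext_hom (on_ob (E M) s) (on_ob N s)"
      using h by (simp add: M)
    fix s' t w assume s': "s' \<in> Ob (opp D)" and t: "t \<in> Hom (opp D) s s'"
      and w: "w \<in> carrier (on_ob (E M) s)"
    have "(\<lambda>w. h s' (on_hom (E M) s s' t w)) \<in> hom (Ten M s) (on_ob N s')"
      "(\<lambda>w. on_hom N s s' t (h s w)) \<in> hom (Ten M s) (on_ob N s')"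
      using hom_compose [OF E_act_hom [OF M, of s s' t] ext_hom_hom [OF h [of s']]]
        hom_compose [OF ext_hom_hom [OF h [of s]] ext_hom_hom [OF N.act_ext_hom [of s s' t]]] s s' t
      by (simp_all add: comp_def)
    then have "h s' (on_hom (E M) s s' t w) = on_hom N s s' t (h s w)"
      by (rule ten_hom_eqI [OF M, where s = s and K = "on_ob N s'", rotated 2])
        (use s s' t w comm_group.axioms(2) [OF N.grp] in
          \<open>auto simp: M E_act(2) [OF M] h_ten nat D.Comp_in_Hom ob\<close>)
    then show "restrict h (Ob D) s' (on_hom (E M) s s' t w)
      = on_hom N s s' t (restrict h (Ob D) s w)"
      using s s' by simp
  qed simp
  then show ?thesis
    using h_ten by (intro bexI [of _ "restrict h (Ob D)"]) auto
qed

end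

section \<open>Bimodules\<close>

text \<open>The action in a hom bimodule is a \<open>tensor_lift\<close> with values in such a group
  of homomorphisms, so the universal property needs this fact about its target.\<close>

lemma comm_group_HomGrp_Ab:
  assumes G: "comm_group G" and H: "comm_group H"
  shows "comm_group (HomGrp Ab G H)"
proof -
  interpret G: comm_group G by fact
  interpret H: comm_group H by fact
  note ext_homD = ext_hom_hom [THEN hom_in_carrier] ext_hom_hom [THEN hom_mult]
  have ext: "f = g" if "f \<in> ext_hom G H" "g \<in> ext_hom G H" "\<And>x. x \<in> carrier G \<Longrightarrow> f x = g x" for f g
    using that by (rule ext_hom_eqI)
  have mult: "(\<lambda>x\<in>carrier G. f x \<otimes>\<^bsub>H\<^esub> g x) \<in> ext_hom G H"
    if "f \<in> ext_hom G H" "g \<in> ext_hom G H" for f g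
    by (intro restrict_ext_hom H.hom_group_mult ext_hom_hom that G.is_group)
  have one: "(\<lambda>x\<in>carrier G. \<one>\<^bsub>H\<^esub>) \<in> ext_hom G H"
    by (rule ext_hom_restrictI) simp_all
  show ?thesis
  proof (rule comm_groupI; simp only: Ab_sel)
    fix f g assume f: "f \<in> ext_hom G H" and g: "g \<in> ext_hom G H"
    show "(\<lambda>x\<in>carrier G. f x \<otimes>\<^bsub>H\<^esub> g x) \<in> ext_hom G H" using f g by (rule mult)
    show "(\<lambda>x\<in>carrier G. f x \<otimes>\<^bsub>H\<^esub> g x) = (\<lambda>x\<in>carrier G. g x \<otimes>\<^bsub>H\<^esub> f x)"
      by (rule restrict_ext) (simp add: H.m_comm ext_homD(1) [OF f] ext_homD(1) [OF g])
    fix h assume h: "h \<in> ext_hom G H"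
    show "(\<lambda>x\<in>carrier G. (\<lambda>x\<in>carrier G. f x \<otimes>\<^bsub>H\<^esub> g x) x \<otimes>\<^bsub>H\<^esub> h x)
        = (\<lambda>x\<in>carrier G. f x \<otimes>\<^bsub>H\<^esub> (\<lambda>x\<in>carrier G. g x \<otimes>\<^bsub>H\<^esub> h x) x)"
      by (rule restrict_ext) (simp add: H.m_assoc ext_homD(1) [OF f] ext_homD(1) [OF g] ext_homD(1)
        [OF h])
  next
    show "(\<lambda>x\<in>carrier G. \<one>\<^bsub>H\<^esub>) \<in> ext_hom G H" by (rule one)
  next
    fix f assume f: "f \<in> ext_hom G H"
    show "(\<lambda>x\<in>carrier G. (\<lambda>x\<in>carrier G. \<one>\<^bsub>H\<^esub>) x \<otimes>\<^bsub>H\<^esub> f x) = f"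
      by (rule ext [OF mult [OF one f] f]) (simp add: ext_homD(1) [OF f])
    have inv: "(\<lambda>x\<in>carrier G. inv\<^bsub>H\<^esub> f x) \<in> ext_hom G H"
      by (rule ext_hom_restrictI)
        (simp_all add: ext_homD(1) [OF f] ext_homD(2) [OF f] H.inv_mult)
    show "\<exists>g\<in>ext_hom G H. (\<lambda>x\<in>carrier G. g x \<otimes>\<^bsub>H\<^esub> f x) = (\<lambda>x\<in>carrier G. \<one>\<^bsub>H\<^esub>)"
      by (rule bexI [OF _ inv], rule restrict_ext) (simp add: ext_homD(1) [OF f])
  qed
qed

text \<open>Evaluation at a fixed element is additive since the group operation on homomorphisms is
  pointwise. This lets a bimodule action be studied one element at a time.\<close>

lemma HomGrp_Ab_eval_hom:
  "\<lbrakk>A \<in> hom K (HomGrp Ab G H); x \<in> carrier G\<rbrakk> \<Longrightarrow> (\<lambda>u. A u x) \<in> hom K H"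
  by (auto simp: hom_def ext_hom_def)

lemma bimod_category_sel:
  "Ob (bimod_category R Q) = Ob Q \<times> Ob R"
  "Hom (bimod_category R Q) (a, b) (a', b') = carrier (tensor (HomGrp Q a' a) (HomGrp R b b'))"
  by (simp_all add: bimod_category_def tensor_category_def Let_def)

locale bimod_functors = F: add_functor Q S F + G: add_functor R S G
  for Q :: "('q, 'b, 'x) preadditive_scheme" and R :: "('r, 'a, 'y) preadditive_scheme"
    and S :: "('s, 'c, 'z) preadditive_scheme"
    and F :: "('q, 'b, 's, 'c) cfun" and G :: "('r, 'a, 's, 'c) cfun"
begin

lemma on_ob_hom_bimodule [simp]:
  "on_ob (hom_bimodule R Q S F G) (a, b) = HomGrp S (on_ob F a) (on_ob G b)"
  by (simp add: hom_bimodule_def)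

text \<open>The map sending q and r to f \<mapsto> G(r) \<circ> f \<circ> F(q) is biadditive because
  composition is biadditive and both functors are additive; the universal property then evaluates
  the lift.\<close>

lemma act:
  assumes ab: "a \<in> Ob Q" "a' \<in> Ob Q" "b \<in> Ob R" "b' \<in> Ob R"
  shows "on_hom (hom_bimodule R Q S F G) (a, b) (a', b')
      \<in> hom (tensor (HomGrp Q a' a) (HomGrp R b b'))
          (HomGrp Ab (HomGrp S (on_ob F a) (on_ob G b)) (HomGrp S (on_ob F a') (on_ob G b')))"
            (is "?act \<in> hom ?T ?K")
    and "\<And>q r f. \<lbrakk>q \<in> Hom Q a' a; r \<in> Hom R b b'; f \<in> Hom S (on_ob F a) (on_ob G b)\<rbrakk> \<Longrightarrow>
      on_hom (hom_bimodule R Q S F G) (a, b) (a', b') (pure_tensor (HomGrp Q a' a) (HomGrp R b b') q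
        r) f
      = Comp S (on_ob F a') (on_ob G b) (on_ob G b') (on_hom G b b' r)
              (Comp S (on_ob F a') (on_ob F a) (on_ob G b) f (on_hom F a' a q))"
proof -
  interpret tensor_product "HomGrp Q a' a" "HomGrp R b b'"
    by (intro tensor_product.intro F.C.HomGrp_comm_group G.C.HomGrp_comm_group ab)
  let ?X = "HomGrp S (on_ob F a) (on_ob G b)" and ?Y = "HomGrp S (on_ob F a') (on_ob G b')"
  let ?\<beta> = "\<lambda>q r. \<lambda>f\<in>Hom S (on_ob F a) (on_ob G b). Comp S (on_ob F a') (on_ob G b) (on_ob G b')
    (on_hom G b b' r)
              (Comp S (on_ob F a') (on_ob F a) (on_ob G b) f (on_hom F a' a q))"
  note obs = ab F.ob G.ob
  have X: "comm_group ?X" and Y: "comm_group ?Y"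
    by (simp_all add: F.D.HomGrp_comm_group obs)
  have c: "carrier (HomGrp Q a' a) = Hom Q a' a" "carrier (HomGrp R b b') = Hom R b b'"
    "carrier ?X = Hom S (on_ob F a) (on_ob G b)" "carrier ?Y = Hom S (on_ob F a') (on_ob G b')"
    by (simp_all add: F.C.HomGrp_carrier G.C.HomGrp_carrier F.D.HomGrp_carrier obs)
  have \<beta>: "?\<beta> q r \<in> ext_hom ?X ?Y" if "q \<in> Hom Q a' a" "r \<in> Hom R b b'" for q r
    unfolding c(3) [symmetric]
    by (rule ext_hom_restrictI)
      (use that in \<open>simp_all add: comm_group.axioms(2) [OF X] c obs F.arr G.arr
        F.D.Comp_in_Hom F.D.Comp_add_left F.D.Comp_add_right\<close>)
  note lift = tensor_lift [of ?K ?\<beta>, OF comm_group_HomGrp_Ab [OF X Y]]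
  have *: "?act = tensor_lift (HomGrp Q a' a) (HomGrp R b b') ?K ?\<beta>"
    by (simp add: hom_bimodule_def)
  have cl: "?\<beta> q r \<in> carrier ?K" if "q \<in> carrier (HomGrp Q a' a)" "r \<in> carrier (HomGrp R b b')" for
    q r
    using \<beta> that by (simp add: c)
  have l: "?\<beta> (q \<otimes>\<^bsub>HomGrp Q a' a\<^esub> q') r = ?\<beta> q r \<otimes>\<^bsub>?K\<^esub> ?\<beta> q' r"
    if "q \<in> carrier (HomGrp Q a' a)" "q' \<in> carrier (HomGrp Q a' a)" "r \<in> carrier (HomGrp R b b')"
      for q q' r
    unfolding Ab_sel c(3)
    by (rule restrict_ext) (use that in \<open>simp add: c F.add F.arr G.arr obs F.D.Comp_in_Hom
      F.D.Comp_add_right\<close>)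
  have r: "?\<beta> q (r \<otimes>\<^bsub>HomGrp R b b'\<^esub> r') = ?\<beta> q r \<otimes>\<^bsub>?K\<^esub> ?\<beta> q r'"
    if "q \<in> carrier (HomGrp Q a' a)" "r \<in> carrier (HomGrp R b b')" "r' \<in> carrier (HomGrp R b b')"
      for q r r'
    unfolding Ab_sel c(3)
    by (rule restrict_ext) (use that in \<open>simp add: c G.add F.arr G.arr obs F.D.Comp_in_Hom
      F.D.Comp_add_left\<close>)
  show "?act \<in> hom ?T ?K"
    unfolding * by (rule ext_hom_hom, rule lift(1) [OF cl l r])
  show "?act (pure_tensor (HomGrp Q a' a) (HomGrp R b b') q r) f
      = Comp S (on_ob F a') (on_ob G b) (on_ob G b') (on_hom G b b' r)
              (Comp S (on_ob F a') (on_ob F a) (on_ob G b) f (on_hom F a' a q))"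
    if "q \<in> Hom Q a' a" "r \<in> Hom R b b'" "f \<in> Hom S (on_ob F a) (on_ob G b)" for q r f
    unfolding * using that by (subst lift(2) [OF cl l r]) (simp_all add: c)
qed

end

text \<open>For a fixed f both sides of the naturality square are homomorphisms in the arrow u of
  \<open>bimod_category R Q\<close>, which runs over a tensor product; so it is enough to test u = q
  \<otimes> r. Two ambient categories \<open>S\<close> and \<open>S'\<close> occur because the
  source of \<alpha> lives over S and its target over R.\<close>

lemma mod_hom_bimodule_iff:
  assumes "bimod_functors Q R S F G" and "bimod_functors Q R S' F' G'"
  shows "\<alpha> \<in> mod_hom (bimod_category R Q) (hom_bimodule R Q S F G) (hom_bimodule R Q S' F' G') \<longleftrightarrow>
    \<alpha> \<in> extensional (Ob Q \<times> Ob R) \<and>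
    (\<forall>a\<in>Ob Q. \<forall>b\<in>Ob R. \<alpha> (a, b) \<in> ext_hom (HomGrp S (on_ob F a) (on_ob G b)) (HomGrp S' (on_ob F' a)
      (on_ob G' b))) \<and>
    (\<forall>a\<in>Ob Q. \<forall>a'\<in>Ob Q. \<forall>b\<in>Ob R. \<forall>b'\<in>Ob R. \<forall>q\<in>Hom Q a' a. \<forall>r\<in>Hom R b b'. \<forall>f\<in>Hom S (on_ob F a)
      (on_ob G b).
      \<alpha> (a', b') (Comp S (on_ob F a') (on_ob G b) (on_ob G b') (on_hom G b b' r)
              (Comp S (on_ob F a') (on_ob F a) (on_ob G b) f (on_hom F a' a q)))
      = Comp S' (on_ob F' a') (on_ob G' b) (on_ob G' b') (on_hom G' b b' r)
              (Comp S' (on_ob F' a') (on_ob F' a) (on_ob G' b) (\<alpha> (a, b) f) (on_hom F' a' a q)))"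
    (is "?L \<longleftrightarrow> ?ext \<and> ?hom \<and> ?nat")
proof -
  interpret A: bimod_functors Q R S F G by fact
  interpret B: bimod_functors Q R S' F' G' by fact
  let ?A = "hom_bimodule R Q S F G" and ?B = "hom_bimodule R Q S' F' G'"
  have pure: "pure_tensor (HomGrp Q a' a) (HomGrp R b b') q r
    \<in> carrier (tensor (HomGrp Q a' a) (HomGrp R b b'))"
    if "a \<in> Ob Q" "a' \<in> Ob Q" "b \<in> Ob R" "b' \<in> Ob R" "q \<in> Hom Q a' a" "r \<in> Hom R b b'"
      for a a' b b' q r
    by (rule tensor_product.pure_tensor_closed)
      (use that in \<open>simp_all add: tensor_product_def A.F.C.HomGrp_comm_group A.G.C.HomGrp_comm_group
        A.F.C.HomGrp_carrier A.G.C.HomGrp_carrier\<close>)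
  show ?thesis
  proof
    assume L: ?L
    have ?ext
      using L by (simp add: mod_hom_def bimod_category_sel PiE_def)
    moreover have ?hom
      using mod_homD(1) [OF L] by (force simp: bimod_category_sel)
    moreover have ?nat
    proof (intro ballI)
      fix a a' b b' q r f
      assume ab: "a \<in> Ob Q" "a' \<in> Ob Q" "b \<in> Ob R" "b' \<in> Ob R" and q: "q \<in> Hom Q a' a"
        and r: "r \<in> Hom R b b'"
        and f: "f \<in> Hom S (on_ob F a) (on_ob G b)"
      have "\<alpha> (a, b) \<in> hom (HomGrp S (on_ob F a) (on_ob G b)) (HomGrp S' (on_ob F' a) (on_ob G' b))"
        using \<open>?hom\<close> ab by (simp add: ext_hom_hom)
      from hom_in_carrier [OF this, of f] have \<alpha>: "\<alpha> (a, b) f \<in> Hom S' (on_ob F' a) (on_ob G' b)"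
        using ab f by (simp add: A.F.D.HomGrp_carrier B.F.D.HomGrp_carrier A.F.ob A.G.ob B.F.ob
          B.G.ob)
      have "\<alpha> (a', b') (on_hom ?A (a, b) (a', b') (pure_tensor (HomGrp Q a' a) (HomGrp R b b') q r)
        f)
          = on_hom ?B (a, b) (a', b') (pure_tensor (HomGrp Q a' a) (HomGrp R b b') q r)
            (\<alpha> (a, b) f)"
        by (rule mod_homD(4) [OF L])
          (use ab q r f in \<open>simp_all add: bimod_category_sel pure A.F.D.HomGrp_carrier A.F.ob
            A.G.ob\<close>)
      then show "\<alpha> (a', b') (Comp S (on_ob F a') (on_ob G b) (on_ob G b') (on_hom G b b' r)
              (Comp S (on_ob F a') (on_ob F a) (on_ob G b) f (on_hom F a' a q)))
          = Comp S' (on_ob F' a') (on_ob G' b) (on_ob G' b') (on_hom G' b b' r)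
              (Comp S' (on_ob F' a') (on_ob F' a) (on_ob G' b) (\<alpha> (a, b) f) (on_hom F' a' a q))"
        using ab q r f \<alpha> by (simp add: A.act(2) B.act(2))
    qed
    ultimately show "?ext \<and> ?hom \<and> ?nat" by blast
  next
    assume "?ext \<and> ?hom \<and> ?nat"
    then have ext: ?ext and hom: "\<And>a b. \<lbrakk>a \<in> Ob Q; b \<in> Ob R\<rbrakk>
      \<Longrightarrow> \<alpha> (a, b) \<in> ext_hom (HomGrp S (on_ob F a) (on_ob G b)) (HomGrp S' (on_ob F' a) (on_ob G' b))"
      and nat: ?nat
      by blast+
    show ?L
    proof (rule mod_homI)
      show "\<alpha> \<in> extensional (Ob (bimod_category R Q))"
        using ext by (simp add: bimod_category_sel)
      fix p assume p: "p \<in> Ob (bimod_category R Q)"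
      obtain a b where p_eq: "p = (a, b)" by force
      then have ab: "a \<in> Ob Q" "b \<in> Ob R" using p by (simp_all add: bimod_category_sel)
      then show "\<alpha> p \<in> ext_hom (on_ob ?A p) (on_ob ?B p)" using hom by (simp add: p_eq)
      fix p' u f assume p': "p' \<in> Ob (bimod_category R Q)"
        and u: "u \<in> Hom (bimod_category R Q) p p'"
        and f: "f \<in> carrier (on_ob ?A p)"
      obtain a' b' where p'_eq: "p' = (a', b')" by force
      then have ab': "a' \<in> Ob Q" "b' \<in> Ob R" using p' by (simp_all add: bimod_category_sel)
      interpret t: tensor_product "HomGrp Q a' a" "HomGrp R b b'"
        by (intro tensor_product.intro A.F.C.HomGrp_comm_group A.G.C.HomGrp_comm_group ab ab')
      let ?X = "HomGrp S (on_ob F a) (on_ob G b)" and ?Y = "HomGrp S (on_ob F a') (on_ob G b')"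
        and ?X' = "HomGrp S' (on_ob F' a) (on_ob G' b)"
          and ?Y' = "HomGrp S' (on_ob F' a') (on_ob G' b')"
      have c: "carrier ?X = Hom S (on_ob F a) (on_ob G b)" "carrier ?X'
        = Hom S' (on_ob F' a) (on_ob G' b)"
        "carrier (HomGrp Q a' a) = Hom Q a' a" "carrier (HomGrp R b b') = Hom R b b'"
        by (simp_all add: A.F.C.HomGrp_carrier A.G.C.HomGrp_carrier A.F.D.HomGrp_carrier
          B.F.D.HomGrp_carrier
            A.F.ob A.G.ob B.F.ob B.G.ob ab ab')
      have Y': "group ?Y'"
        by (rule comm_group.axioms(2)) (simp add: B.F.D.HomGrp_comm_group B.F.ob B.G.ob ab')
      have f: "f \<in> carrier ?X" using f by (simp add: p_eq)
      have \<alpha>: "\<alpha> (a, b) f \<in> carrier ?X'"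
        using hom_in_carrier [OF ext_hom_hom [OF hom [OF ab]] f] .
      have "\<alpha> (a', b') (on_hom ?A (a, b) (a', b') u f) = on_hom ?B (a, b) (a', b') u (\<alpha> (a, b) f)"
      proof (rule t.hom_eqI [OF Y'])
        show "(\<lambda>u. \<alpha> (a', b') (on_hom ?A (a, b) (a', b') u f)) \<in> hom t.T ?Y'"
          using hom_compose [OF HomGrp_Ab_eval_hom [OF A.act(1) f] ext_hom_hom [OF hom [OF ab']]] ab
            ab'
          by (simp add: comp_def)
        show "(\<lambda>u. on_hom ?B (a, b) (a', b') u (\<alpha> (a, b) f)) \<in> hom t.T ?Y'"
          by (rule HomGrp_Ab_eval_hom [OF B.act(1) \<alpha>]) (use ab ab' in auto)
        show "u \<in> carrier t.T"
          using u by (simp add: p_eq p'_eq bimod_category_sel)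
        fix q r assume "q \<in> carrier (HomGrp Q a' a)" "r \<in> carrier (HomGrp R b b')"
        then show "\<alpha> (a', b') (on_hom ?A (a, b) (a', b') (pure_tensor (HomGrp Q a' a)
          (HomGrp R b b') q r) f)
            = on_hom ?B (a, b) (a', b') (pure_tensor (HomGrp Q a' a) (HomGrp R b b') q r)
              (\<alpha> (a, b) f)"
          using f \<alpha> ab ab' nat by (simp add: c A.act(2) B.act(2))
      qed
      then show "\<alpha> p' (on_hom ?A p p' u f) = on_hom ?B p p' u (\<alpha> p f)"
        by (simp add: p_eq p'_eq)
    qed
  qed
qed

section \<open>The separability criterion\<close>

lemma restriction_sel [simp]:
  "on_ob (on_ob (restriction Q \<psi>) M) a = on_ob M (on_ob \<psi> a)"
  "on_hom (on_ob (restriction Q \<psi>) M) a b q = on_hom M (on_ob \<psi> a) (on_ob \<psi> b) (on_hom \<psi> b a q)"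
  "on_hom (restriction Q \<psi>) M N \<eta> = (\<lambda>a\<in>Ob Q. \<eta> (on_ob \<psi> a))"
  by (simp_all add: restriction_def)

locale scalar_tower = psi: add_functor Q R \<psi> + phi: add_functor R S \<phi>
  for Q :: "('q, 'b, 'x) preadditive_scheme" and R :: "('r, 'a, 'y) preadditive_scheme"
    and S :: "('s, 'c, 'z) preadditive_scheme"
    and \<psi> :: "('q, 'b, 'r, 'a) cfun" and \<phi> :: "('r, 'a, 's, 'c) cfun"
begin

abbreviation "\<phi>\<psi> a \<equiv> on_ob \<phi> (on_ob \<psi> a)"
abbreviation "\<phi>\<psi>\<^sub>m a b q \<equiv> on_hom \<phi> (on_ob \<psi> a) (on_ob \<psi> b) (on_hom \<psi> a b q)"

text \<open>x \<mapsto> x \<otimes> 1, the unit of the adjunction between extension and restriction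
  along \<phi>.\<close>

abbreviation unit :: "('r, 'a, 'm) modul \<Rightarrow> 'r \<Rightarrow> 'm \<Rightarrow> ('r, 'm, 'c) mtens" where
  "unit M b x \<equiv> phi.ten M (on_ob \<phi> b) b x (Ident S (on_ob \<phi> b))"

lemma obs:
  "a \<in> Ob Q \<Longrightarrow> on_ob \<psi> a \<in> Ob R" "b \<in> Ob R \<Longrightarrow> on_ob \<phi> b \<in> Ob S"
  by (simp_all add: psi.ob phi.ob)

lemma unit_closed:
  "\<lbrakk>ab_module (opp R) M; b \<in> Ob R; x \<in> carrier (on_ob M b)\<rbrakk>
    \<Longrightarrow> unit M b x \<in> carrier (phi.Ten M (on_ob \<phi> b))"
  by (simp add: phi.ten_closed phi.D.Ident_in_Hom obs)

lemma unit_mult: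
  "\<lbrakk>ab_module (opp R) M; b \<in> Ob R; x \<in> carrier (on_ob M b); y \<in> carrier (on_ob M b)\<rbrakk>
    \<Longrightarrow> unit M b (x \<otimes>\<^bsub>on_ob M b\<^esub> y) = unit M b x \<otimes>\<^bsub>phi.Ten M (on_ob \<phi> b)\<^esub> unit M b y"
  by (simp add: phi.ten_mult_left phi.D.Ident_in_Hom obs)

text \<open>x \<otimes> f is the translate of x \<otimes> 1 by f. A morphism of S-modules therefore
  lets f pass, and only its values on elements x \<otimes> 1 matter.\<close>

lemma ten_eq_act_unit:
  "\<lbrakk>ab_module (opp R) M; s \<in> Ob S; b \<in> Ob R; x \<in> carrier (on_ob M b); f \<in> Hom S s (on_ob \<phi> b)\<rbrakk>
    \<Longrightarrow> phi.ten M s b x f = on_hom (phi.E M) (on_ob \<phi> b) s f (unit M b x)"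
  by (simp add: phi.E_act(2) phi.D.Ident_in_Hom phi.D.Comp_Ident_left obs)

text \<open>Balancedness moves r across the tensor sign: x r \<otimes> 1 = x \<otimes> \<phi>(r),
  which is (x \<otimes> 1) translated by \<phi>(r).\<close>

lemma unit_act:
  assumes "ab_module (opp R) M" "a \<in> Ob R" "b \<in> Ob R" "r \<in> Hom R a b" "x \<in> carrier (on_ob M b)"
  shows "unit M a (on_hom M b a r x) = on_hom (phi.E M) (on_ob \<phi> b) (on_ob \<phi> a) (on_hom \<phi> a b r)
    (unit M b x)"
  using assms
  by (simp add: phi.ten_balanced phi.E_act(2) phi.D.Ident_in_Hom phi.D.Comp_Ident_left
    phi.D.Comp_Ident_right obs phi.arr)

text \<open>The hypotheses are the conditions of the criterion with bimodule linearity spelled out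
  on pure tensors q \<otimes> r, the form that \<open>mod_hom_bimodule_iff\<close> provides.\<close>

lemma heavily_separableI:
  assumes \<alpha>_hom: "\<And>a b. \<lbrakk>a \<in> Ob Q; b \<in> Ob R\<rbrakk>
    \<Longrightarrow> \<alpha> (a, b) \<in> hom (HomGrp S (\<phi>\<psi> a) (on_ob \<phi> b)) (HomGrp R (on_ob \<psi> a) b)"
    and \<alpha>_nat: "\<And>a a' b b' q r f. \<lbrakk>a \<in> Ob Q; a' \<in> Ob Q; b \<in> Ob R; b' \<in> Ob R; q \<in> Hom Q a' a;
      r \<in> Hom R b b'; f \<in> Hom S (\<phi>\<psi> a) (on_ob \<phi> b)\<rbrakk>
      \<Longrightarrow> \<alpha> (a', b') (Comp S (\<phi>\<psi> a') (on_ob \<phi> b) (on_ob \<phi> b') (on_hom \<phi> b b' r) (Comp S (\<phi>\<psi> a') (\<phi>\<psi> a)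
        (on_ob \<phi> b) f (\<phi>\<psi>\<^sub>m a' a q)))
      = Comp R (on_ob \<psi> a') b b' r (Comp R (on_ob \<psi> a') (on_ob \<psi> a) b (\<alpha> (a, b) f)
        (on_hom \<psi> a' a q))"
    and \<alpha>_id: "\<And>a b r. \<lbrakk>a \<in> Ob Q; b \<in> Ob R; r \<in> Hom R (on_ob \<psi> a) b\<rbrakk>
      \<Longrightarrow> \<alpha> (a, b) (on_hom \<phi> (on_ob \<psi> a) b r) = r"
    and \<alpha>_comp: "\<And>a b c f g. \<lbrakk>a \<in> Ob Q; b \<in> Ob R; c \<in> Ob R; f \<in> Hom S (\<phi>\<psi> a) (on_ob \<phi> b);
      g \<in> Hom S (on_ob \<phi> b) (on_ob \<phi> c)\<rbrakk>
      \<Longrightarrow> \<alpha> (a, c) (Comp S (\<phi>\<psi> a) (on_ob \<phi> b) (on_ob \<phi> c) g f)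
          = \<alpha> (a, c) (Comp S (\<phi>\<psi> a) (on_ob \<phi> b) (on_ob \<phi> c) g (on_hom \<phi> (on_ob \<psi> a) b
            (\<alpha> (a, b) f)))"
  shows "heavily_separable (right_modules R :: (('r, 'a, 'm) modul, 'r \<Rightarrow> 'm \<Rightarrow> 'm) category)
      (right_modules S) (right_modules Q) (extension R S \<phi>) (restriction Q \<psi>)"
proof -
  note S = phi.D.Ident_in_Hom phi.D.Comp_in_Hom phi.D.Comp_Ident_left phi.D.Comp_Ident_right
    phi.D.Comp_assoc
  note R = psi.D.Ident_in_Hom psi.D.Comp_in_Hom psi.D.Comp_Ident_left psi.D.Comp_Ident_right
    psi.D.Comp_assoc
  have \<alpha>: "\<alpha> (a, b) f \<in> Hom R (on_ob \<psi> a) b" if "a \<in> Ob Q" "b \<in> Ob R" "f \<in> Hom S (\<phi>\<psi> a) (on_ob \<phi> b)"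
    for a b f
    using hom_in_carrier [OF \<alpha>_hom, of a b f] that
      by (simp add: phi.D.HomGrp_carrier psi.D.HomGrp_carrier obs)
  have \<alpha>_add: "\<alpha> (a, b) (f \<otimes>\<^bsub>HomGrp S (\<phi>\<psi> a) (on_ob \<phi> b)\<^esub> g) = \<alpha> (a, b) f \<otimes>\<^bsub>HomGrp R (on_ob \<psi> a) b\<^esub>
    \<alpha> (a, b) g"
    if "a \<in> Ob Q" "b \<in> Ob R" "f \<in> Hom S (\<phi>\<psi> a) (on_ob \<phi> b)" "g \<in> Hom S (\<phi>\<psi> a) (on_ob \<phi> b)"
      for a b f g
    using hom_mult [OF \<alpha>_hom, of a b f g] that by (simp add: phi.D.HomGrp_carrier obs)
  \<comment> \<open>The two-sided linearity is split by putting an identity on one side: linearity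
    over R makes \<epsilon> well defined, linearity over Q makes it natural in the object of
    Q.\<close>
  have \<alpha>_left: "\<alpha> (a, b') (Comp S (\<phi>\<psi> a) (on_ob \<phi> b) (on_ob \<phi> b') (on_hom \<phi> b b' r) f)
    = Comp R (on_ob \<psi> a) b b' r (\<alpha> (a, b) f)"
    if "a \<in> Ob Q" "b \<in> Ob R" "b' \<in> Ob R" "r \<in> Hom R b b'" "f \<in> Hom S (\<phi>\<psi> a) (on_ob \<phi> b)"
      for a b b' r f
    using \<alpha>_nat [of a a b b' "Ident Q a" r f] that
      by (simp add: S R psi.C.Ident_in_Hom psi.id phi.id obs \<alpha>)
  have \<alpha>_right: "\<alpha> (a', b) (Comp S (\<phi>\<psi> a') (\<phi>\<psi> a) (on_ob \<phi> b) f (\<phi>\<psi>\<^sub>m a' a q))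
    = Comp R (on_ob \<psi> a') (on_ob \<psi> a) b (\<alpha> (a, b) f) (on_hom \<psi> a' a q)"
    if "a \<in> Ob Q" "a' \<in> Ob Q" "b \<in> Ob R" "q \<in> Hom Q a' a" "f \<in> Hom S (\<phi>\<psi> a) (on_ob \<phi> b)"
      for a a' b q f
    using \<alpha>_nat [of a a' b b q "Ident R b" f] that by (simp add: S R phi.id phi.arr psi.arr obs \<alpha>)

  define eps :: "('r, 'a, 'm) modul \<Rightarrow> 'q \<Rightarrow> ('r, 'm, 'c) mtens \<Rightarrow> 'm" where
    "eps N a = (SOME h. h \<in> ext_hom (phi.Ten N (\<phi>\<psi> a)) (on_ob N (on_ob \<psi> a)) \<and>
      (\<forall>b\<in>Ob R. \<forall>n\<in>carrier (on_ob N b). \<forall>f\<in>Hom S (\<phi>\<psi> a) (on_ob \<phi> b).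
        h (phi.ten N (\<phi>\<psi> a) b n f) = on_hom N b (on_ob \<psi> a) (\<alpha> (a, b) f) n))" for N a
  have eps: "eps N a \<in> ext_hom (phi.Ten N (\<phi>\<psi> a)) (on_ob N (on_ob \<psi> a)) \<and>
      (\<forall>b\<in>Ob R. \<forall>n\<in>carrier (on_ob N b). \<forall>f\<in>Hom S (\<phi>\<psi> a) (on_ob \<phi> b).
        eps N a (phi.ten N (\<phi>\<psi> a) b n f) = on_hom N b (on_ob \<psi> a) (\<alpha> (a, b) f) n)"
    if N: "ab_module (opp R) N" and a: "a \<in> Ob Q" for N a
  proof -
    interpret N: ab_module "opp R" N by fact
    have "\<exists>h\<in>ext_hom (phi.Ten N (\<phi>\<psi> a)) (on_ob N (on_ob \<psi> a)). \<forall>b\<in>Ob R. \<forall>n\<in>carrier (on_ob N b).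
      \<forall>f\<in>Hom S (\<phi>\<psi> a) (on_ob \<phi> b).
        h (phi.ten N (\<phi>\<psi> a) b n f) = on_hom N b (on_ob \<psi> a) (\<alpha> (a, b) f) n"
    proof (rule phi.ten_universal [OF N])
      show "comm_group (on_ob N (on_ob \<psi> a))" by (rule N.grp) (simp add: obs a)
      fix b c r n f
      assume "b \<in> Ob R" "c \<in> Ob R" "r \<in> Hom R b c" "n \<in> carrier (on_ob N c)"
        "f \<in> Hom S (\<phi>\<psi> a) (on_ob \<phi> b)"
      \<comment> \<open>Balancedness: n acted on by r and then by \<alpha>(f) is n acted on by r
        \<circ> \<alpha>(f) = \<alpha>(\<phi>(r) \<circ> f).\<close>
      then show "on_hom N b (on_ob \<psi> a) (\<alpha> (a, b) f) (on_hom N c b r n)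
          = on_hom N c (on_ob \<psi> a) (\<alpha> (a, c) (Comp S (\<phi>\<psi> a) (on_ob \<phi> b) (on_ob \<phi> c) (on_hom \<phi> b c r)
            f)) n"
        using N.act_comp [of c b "on_ob \<psi> a" r "\<alpha> (a, b) f" n] a by (simp add: \<alpha>_left \<alpha> obs)
    qed (use a in \<open>simp_all add: obs N.act_closed N.act_mult N.act_add [simplified] \<alpha> \<alpha>_add\<close>)
    then show ?thesis
      unfolding eps_def Bex_def by (rule someI_ex)
  qed
  have eps_hom: "eps N a \<in> hom (phi.Ten N (\<phi>\<psi> a)) (on_ob N (on_ob \<psi> a))"
    if "ab_module (opp R) N" "a \<in> Ob Q" for N a
    using eps [OF that] by (simp add: ext_hom_hom)
  note eps_closed = hom_in_carrier [OF eps_hom]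
  have eps_ten: "eps N a (phi.ten N (\<phi>\<psi> a) b n f) = on_hom N b (on_ob \<psi> a) (\<alpha> (a, b) f) n"
    if "ab_module (opp R) N" "a \<in> Ob Q" "b \<in> Ob R" "n \<in> carrier (on_ob N b)"
      "f \<in> Hom S (\<phi>\<psi> a) (on_ob \<phi> b)" for N a b n f
    using eps [OF that(1,2)] that by blast

  \<comment> \<open>Naturality in the module: on n \<otimes> f it says that \<open>v\<close>
    commutes with the action of \<alpha>(f).\<close>
  have eps_map: "eps N' a (phi.E\<^sub>m N N' v (\<phi>\<psi> a) w) = v (on_ob \<psi> a) (eps N a w)"
    if N: "ab_module (opp R) N" and N': "ab_module (opp R) N'" and v: "v \<in> mod_hom (opp R) N N'"
      and a: "a \<in> Ob Q" and w: "w \<in> carrier (phi.Ten N (\<phi>\<psi> a))" for N N' v a w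
  proof (rule phi.ten_hom_eqI [OF N, where s = "\<phi>\<psi> a" and K = "on_ob N' (on_ob \<psi> a)" and t = w])
    interpret N': ab_module "opp R" N' by fact
    show "group (on_ob N' (on_ob \<psi> a))" by (rule comm_group.axioms(2) [OF N'.grp]) (simp add: obs a)
    have "phi.E\<^sub>m N N' v (\<phi>\<psi> a) \<in> hom (phi.Ten N (\<phi>\<psi> a)) (phi.Ten N' (\<phi>\<psi> a))"
      using mod_homD(1) [OF phi.E_map(1) [OF N N' v], of "\<phi>\<psi> a"]
        by (simp add: obs a N N' ext_hom_hom)
    from hom_compose [OF this eps_hom [OF N' a]]
    show "(\<lambda>w. eps N' a (phi.E\<^sub>m N N' v (\<phi>\<psi> a) w)) \<in> hom (phi.Ten N (\<phi>\<psi> a)) (on_ob N' (on_ob \<psi> a))"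
      by (simp add: comp_def)
    have "v (on_ob \<psi> a) \<in> hom (on_ob N (on_ob \<psi> a)) (on_ob N' (on_ob \<psi> a))"
      using mod_homD(1) [OF v, of "on_ob \<psi> a"] by (simp add: obs a ext_hom_hom)
    from hom_compose [OF eps_hom [OF N a] this]
    show "(\<lambda>w. v (on_ob \<psi> a) (eps N a w)) \<in> hom (phi.Ten N (\<phi>\<psi> a)) (on_ob N' (on_ob \<psi> a))"
      by (simp add: comp_def)
  qed (use a w mod_homD(2,4) [OF v] in \<open>simp_all add: obs phi.E_map(2) [OF N N' v] eps_ten
    [OF N] eps_ten [OF N'] \<alpha>\<close>)

  \<comment> \<open>Naturality in the object of Q: on n \<otimes> f it is right linearity,
    \<alpha>(f \<circ> \<phi>(\<psi>(q))) = \<alpha>(f) \<circ> \<psi>(q).\<close>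
  have eps_act: "eps N a' (on_hom (phi.E N) (\<phi>\<psi> a) (\<phi>\<psi> a') (\<phi>\<psi>\<^sub>m a' a q) w)
    = on_hom N (on_ob \<psi> a) (on_ob \<psi> a') (on_hom \<psi> a' a q) (eps N a w)"
    if N: "ab_module (opp R) N" and a: "a \<in> Ob Q" and a': "a' \<in> Ob Q" and q: "q \<in> Hom Q a' a"
      and w: "w \<in> carrier (phi.Ten N (\<phi>\<psi> a))" for N a a' q w
  proof (rule phi.ten_hom_eqI [OF N, where s = "\<phi>\<psi> a" and K = "on_ob N (on_ob \<psi> a')" and t = w])
    interpret N: ab_module "opp R" N by fact
    show "group (on_ob N (on_ob \<psi> a'))" by (rule comm_group.axioms(2) [OF N.grp]) (simp add: obs a')
    have "on_hom (phi.E N) (\<phi>\<psi> a) (\<phi>\<psi> a') (\<phi>\<psi>\<^sub>m a' a q) \<in> hom (phi.Ten N (\<phi>\<psi> a))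
      (phi.Ten N (\<phi>\<psi> a'))"
      by (rule phi.E_act_hom [OF N]) (simp_all add: obs a a' q phi.arr psi.arr)
    from hom_compose [OF this eps_hom [OF N a']]
    show "(\<lambda>w. eps N a' (on_hom (phi.E N) (\<phi>\<psi> a) (\<phi>\<psi> a') (\<phi>\<psi>\<^sub>m a' a q) w)) \<in> hom (phi.Ten N (\<phi>\<psi> a))
      (on_ob N (on_ob \<psi> a'))"
      by (simp add: comp_def)
    have "on_hom N (on_ob \<psi> a) (on_ob \<psi> a') (on_hom \<psi> a' a q) \<in> hom (on_ob N (on_ob \<psi> a))
      (on_ob N (on_ob \<psi> a'))"
      by (rule ext_hom_hom [OF N.act_ext_hom]) (simp_all add: obs a a' q psi.arr)
    from hom_compose [OF eps_hom [OF N a] this]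
    show "(\<lambda>w. on_hom N (on_ob \<psi> a) (on_ob \<psi> a') (on_hom \<psi> a' a q) (eps N a w))
      \<in> hom (phi.Ten N (\<phi>\<psi> a)) (on_ob N (on_ob \<psi> a'))"
      by (simp add: comp_def)
    fix b n f assume *: "b \<in> Ob R" "n \<in> carrier (on_ob N b)" "f \<in> Hom S (\<phi>\<psi> a) (on_ob \<phi> b)"
    then show "eps N a' (on_hom (phi.E N) (\<phi>\<psi> a) (\<phi>\<psi> a') (\<phi>\<psi>\<^sub>m a' a q) (phi.ten N (\<phi>\<psi> a) b n f))
      = on_hom N (on_ob \<psi> a) (on_ob \<psi> a') (on_hom \<psi> a' a q) (eps N a (phi.ten N (\<phi>\<psi> a) b n f))"
      using N.act_comp [of b "on_ob \<psi> a" "on_ob \<psi> a'" "\<alpha> (a, b) f" "on_hom \<psi> a' a q" n] a a' q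
      by (simp add: phi.E_act(2) [OF N] eps_ten [OF N] S obs phi.arr psi.arr \<alpha> \<alpha>_right)
  qed (use a w in \<open>simp_all add: obs\<close>)

  \<comment> \<open>For v = n \<otimes> g the left side is n acted on by \<alpha>(g \<circ> f), and
    the claim becomes condition (2).\<close>
  have eps_twist: "eps L a (on_hom (phi.E L) (on_ob \<phi> b) (\<phi>\<psi> a) f v)
      = eps L a (on_hom (phi.E L) (on_ob \<phi> b) (\<phi>\<psi> a) (on_hom \<phi> (on_ob \<psi> a) b (\<alpha> (a, b) f)) v)"
    if L: "ab_module (opp R) L" and a: "a \<in> Ob Q" and b: "b \<in> Ob R"
      and f: "f \<in> Hom S (\<phi>\<psi> a) (on_ob \<phi> b)"
      and v: "v \<in> carrier (phi.Ten L (on_ob \<phi> b))" for L a b f v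
  proof (rule phi.ten_hom_eqI [OF L, where s = "on_ob \<phi> b" and K = "on_ob L (on_ob \<psi> a)" and t = v])
    interpret L: ab_module "opp R" L by fact
    show "group (on_ob L (on_ob \<psi> a))" by (rule comm_group.axioms(2) [OF L.grp]) (simp add: obs a)
    show "(\<lambda>w. eps L a (on_hom (phi.E L) (on_ob \<phi> b) (\<phi>\<psi> a) f w)) \<in> hom (phi.Ten L (on_ob \<phi> b))
      (on_ob L (on_ob \<psi> a))"
      using hom_compose [OF phi.E_act_hom [OF L, of "on_ob \<phi> b" "\<phi>\<psi> a" f] eps_hom [OF L a]] a b f
      by (simp add: comp_def obs)
    show "(\<lambda>w. eps L a (on_hom (phi.E L) (on_ob \<phi> b) (\<phi>\<psi> a) (on_hom \<phi> (on_ob \<psi> a) b (\<alpha> (a, b) f))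
      w)) \<in> hom (phi.Ten L (on_ob \<phi> b)) (on_ob L (on_ob \<psi> a))"
      using hom_compose [OF phi.E_act_hom [OF L, of "on_ob \<phi> b" "\<phi>\<psi> a" "on_hom \<phi> (on_ob \<psi> a) b
        (\<alpha> (a, b) f)"] eps_hom [OF L a]] a b f
      by (simp add: comp_def obs \<alpha> phi.arr)
    fix c n g assume *: "c \<in> Ob R" "n \<in> carrier (on_ob L c)" "g \<in> Hom S (on_ob \<phi> b) (on_ob \<phi> c)"
    then show "eps L a (on_hom (phi.E L) (on_ob \<phi> b) (\<phi>\<psi> a) f (phi.ten L (on_ob \<phi> b) c n g))
      = eps L a (on_hom (phi.E L) (on_ob \<phi> b) (\<phi>\<psi> a) (on_hom \<phi> (on_ob \<psi> a) b (\<alpha> (a, b) f))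
        (phi.ten L (on_ob \<phi> b) c n g))"
      using \<alpha>_comp [OF a b *(1) f *(3)] a b f
      by (simp add: phi.E_act(2) [OF L] eps_ten [OF L] S obs phi.arr \<alpha>)
  qed (use b v in \<open>simp_all add: obs\<close>)

  have eps_unit: "eps L a (g (\<phi>\<psi> a) w) = eps L a (g (\<phi>\<psi> a) (unit N (on_ob \<psi> a) (eps N a w)))"
    if N: "ab_module (opp R) N" and L: "ab_module (opp R) L"
      and g: "g \<in> mod_hom (opp S) (phi.E N) (phi.E L)"
      and a: "a \<in> Ob Q" and w: "w \<in> carrier (phi.Ten N (\<phi>\<psi> a))" for N L g a w
  proof (rule phi.ten_hom_eqI [OF N, where s = "\<phi>\<psi> a" and K = "on_ob L (on_ob \<psi> a)" and t = w])
    interpret L: ab_module "opp R" L by fact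
    show "group (on_ob L (on_ob \<psi> a))" by (rule comm_group.axioms(2) [OF L.grp]) (simp add: obs a)
    have "g (\<phi>\<psi> a) \<in> hom (phi.Ten N (\<phi>\<psi> a)) (phi.Ten L (\<phi>\<psi> a))"
      using mod_homD(1) [OF g, of "\<phi>\<psi> a"] by (simp add: obs a N L ext_hom_hom)
    from hom_compose [OF this eps_hom [OF L a]]
    have h: "(\<lambda>w. eps L a (g (\<phi>\<psi> a) w)) \<in> hom (phi.Ten N (\<phi>\<psi> a)) (on_ob L (on_ob \<psi> a))"
      by (simp add: comp_def)
    then show "(\<lambda>w. eps L a (g (\<phi>\<psi> a) w)) \<in> hom (phi.Ten N (\<phi>\<psi> a)) (on_ob L (on_ob \<psi> a))" .
    have "unit N (on_ob \<psi> a) \<in> hom (on_ob N (on_ob \<psi> a)) (phi.Ten N (\<phi>\<psi> a))"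
      by (rule homI) (simp_all add: unit_closed N obs a unit_mult)
    from hom_compose [OF hom_compose [OF eps_hom [OF N a] this] h]
    show "(\<lambda>w. eps L a (g (\<phi>\<psi> a) (unit N (on_ob \<psi> a) (eps N a w)))) \<in> hom (phi.Ten N (\<phi>\<psi> a))
      (on_ob L (on_ob \<psi> a))"
      by (simp add: comp_def)
    fix b n f assume *: "b \<in> Ob R" "n \<in> carrier (on_ob N b)" "f \<in> Hom S (\<phi>\<psi> a) (on_ob \<phi> b)"
    note gn = mod_homD(2,4) [OF g, simplified]
    have u: "unit N b n \<in> carrier (phi.Ten N (on_ob \<phi> b))" "g (on_ob \<phi> b) (unit N b n)
      \<in> carrier (phi.Ten L (on_ob \<phi> b))"
      using * gn(1) [of "on_ob \<phi> b" "unit N b n"] by (simp_all add: unit_closed N L obs)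
    \<comment> \<open>The chain writes n \<otimes> f as (n \<otimes> 1) translated by f, pulls f out
      through \<open>g\<close>, replaces it by \<phi>(\<alpha>(f)) under \<open>eps\<close>, pushes
      that back through \<open>g\<close>, and finally moves \<alpha>(f) across the tensor sign onto
      n.\<close>
    have "eps L a (g (\<phi>\<psi> a) (phi.ten N (\<phi>\<psi> a) b n f))
        = eps L a (on_hom (phi.E L) (on_ob \<phi> b) (\<phi>\<psi> a) f (g (on_ob \<phi> b) (unit N b n)))"
      using * a u gn(2) [of "on_ob \<phi> b" "\<phi>\<psi> a" f "unit N b n"]
        by (simp add: ten_eq_act_unit [OF N] obs N)
    also have "\<dots> = eps L a (on_hom (phi.E L) (on_ob \<phi> b) (\<phi>\<psi> a) (on_hom \<phi> (on_ob \<psi> a) b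
      (\<alpha> (a, b) f)) (g (on_ob \<phi> b) (unit N b n)))"
      by (rule eps_twist [OF L a *(1,3) u(2)])
    also have "\<dots> = eps L a (g (\<phi>\<psi> a) (unit N (on_ob \<psi> a) (on_hom N b (on_ob \<psi> a) (\<alpha> (a, b) f) n)))"
      using * a u gn(2) [of "on_ob \<phi> b" "\<phi>\<psi> a" "on_hom \<phi> (on_ob \<psi> a) b (\<alpha> (a, b) f)" "unit N b n"]
      by (simp add: unit_act [OF N] obs N \<alpha> phi.arr)
    finally show "eps L a (g (\<phi>\<psi> a) (phi.ten N (\<phi>\<psi> a) b n f))
        = eps L a (g (\<phi>\<psi> a) (unit N (on_ob \<psi> a) (eps N a (phi.ten N (\<phi>\<psi> a) b n f))))"
      using * a by (simp add: eps_ten [OF N])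
  qed (use a w in \<open>simp_all add: obs\<close>)

  define P :: "('r, 'a, 'm) modul \<Rightarrow> ('r, 'a, 'm) modul \<Rightarrow> ('s \<Rightarrow> ('r, 'm, 'c) mtens \<Rightarrow> ('r, 'm, 'c)
    mtens) \<Rightarrow> 'q \<Rightarrow> 'm \<Rightarrow> 'm" where
    "P M N h = (\<lambda>a\<in>Ob Q. \<lambda>x\<in>carrier (on_ob M (on_ob \<psi> a)). eps N a
      (h (\<phi>\<psi> a) (unit M (on_ob \<psi> a) x)))" for M N h
  have P_hom: "P M N h \<in> mod_hom (opp Q) (on_ob (restriction Q \<psi>) M) (on_ob (restriction Q \<psi>) N)"
    if M: "ab_module (opp R) M" and N: "ab_module (opp R) N"
      and h: "h \<in> mod_hom (opp S) (phi.E M) (phi.E N)" for M N h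
  proof (rule mod_homI)
    interpret M: ab_module "opp R" M by fact
    note hn = mod_homD(2-4) [OF h, simplified]
    show "P M N h \<in> extensional (Ob (opp Q))" by (simp add: P_def)
    fix a assume "a \<in> Ob (opp Q)"
    then have a: "a \<in> Ob Q" by simp
    have "(\<lambda>x\<in>carrier (on_ob M (on_ob \<psi> a)). eps N a (h (\<phi>\<psi> a) (unit M (on_ob \<psi> a) x)))
      \<in> ext_hom (on_ob M (on_ob \<psi> a)) (on_ob N (on_ob \<psi> a))"
      by (rule ext_hom_restrictI)
        (use a hn in \<open>simp_all add: comm_group.axioms(2) [OF M.grp] unit_closed unit_mult obs M N
          eps_closed hom_mult [OF eps_hom]\<close>)
    then show "P M N h a \<in> ext_hom (on_ob (on_ob (restriction Q \<psi>) M) a)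
      (on_ob (on_ob (restriction Q \<psi>) N) a)"
      using a by (simp add: P_def)
    fix a' q x assume a': "a' \<in> Ob (opp Q)" and q: "q \<in> Hom (opp Q) a a'"
      and x: "x \<in> carrier (on_ob (on_ob (restriction Q \<psi>) M) a)"
    have q': "on_hom \<psi> a' a q \<in> Hom R (on_ob \<psi> a') (on_ob \<psi> a)" "\<phi>\<psi>\<^sub>m a' a q \<in> Hom S (\<phi>\<psi> a') (\<phi>\<psi> a)"
      using a a' q by (simp_all add: psi.arr phi.arr obs)
    have u: "unit M (on_ob \<psi> a) x \<in> carrier (phi.Ten M (\<phi>\<psi> a))"
      using x a by (simp add: unit_closed M obs)
    \<comment> \<open>Passing from x to x \<otimes> 1 turns the action of \<psi>(q) into that of
      \<phi>(\<psi>(q)), with which \<open>h\<close> commutes; \<open>eps_act\<close> turns it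
      back.\<close>
    show "P M N h a' (on_hom (on_ob (restriction Q \<psi>) M) a a' q x)
      = on_hom (on_ob (restriction Q \<psi>) N) a a' q (P M N h a x)"
      using a a' x q q' u hn(1) [of "\<phi>\<psi> a" "unit M (on_ob \<psi> a) x"]
        hn(3) [of "\<phi>\<psi> a" "\<phi>\<psi> a'" "\<phi>\<psi>\<^sub>m a' a q" "unit M (on_ob \<psi> a) x"]
      by (simp add: P_def M.act_closed obs unit_act [OF M] M N eps_act)
  qed

  show ?thesis
    unfolding heavily_separable_def right_modules_sel psi.C.Ob_right_modules psi.D.Ob_right_modules
      phi.D.Ob_right_modules
  proof (intro conjI exI [of _ P] ballI; (unfold psi.D.Ob_right_modules)?)
    show "is_functor (right_modules R :: (('r, 'a, 'm) modul, 'r \<Rightarrow> 'm \<Rightarrow> 'm) category)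
      (right_modules S) (extension R S \<phi>)"
      by (rule phi.is_functor_extension)
    show "is_functor (right_modules R :: (('r, 'a, 'm) modul, 'r \<Rightarrow> 'm \<Rightarrow> 'm) category)
      (right_modules Q) (restriction Q \<psi>)"
      by (rule psi.is_functor_restriction)
    fix M N :: "('r, 'a, 'm) modul" assume M: "ab_module (opp R) M" and N: "ab_module (opp R) N"
    show "P M N \<in> mod_hom (opp S) (phi.E M) (phi.E N) \<rightarrow> mod_hom (opp Q) (on_ob (restriction Q \<psi>) M)
      (on_ob (restriction Q \<psi>) N)"
      using P_hom [OF M N] by blast
    interpret M: ab_module "opp R" M by fact
    interpret N: ab_module "opp R" N by fact
    show "P M N (phi.E\<^sub>m M N \<eta>) = on_hom (restriction Q \<psi>) M N \<eta>"
      if \<eta>: "\<eta> \<in> mod_hom (opp R) M N" for \<eta>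
    proof (rule mod_hom_eqI [OF P_hom [OF M N phi.E_map(1) [OF M N \<eta>]]])
      show "on_hom (restriction Q \<psi>) M N \<eta> \<in> mod_hom (opp Q) (on_ob (restriction Q \<psi>) M)
        (on_ob (restriction Q \<psi>) N)"
        by (rule psi.restriction_map [OF M \<eta>])
      fix a x assume a: "a \<in> Ob (opp Q)" and x: "x \<in> carrier (on_ob (on_ob (restriction Q \<psi>) M) a)"
      \<comment> \<open>The identity is \<phi> of an identity, so (1) applies and \<epsilon>(y
        \<otimes> 1) = y for y = \<eta>(x).\<close>
      have "\<alpha> (a, on_ob \<psi> a) (Ident S (\<phi>\<psi> a)) = Ident R (on_ob \<psi> a)"
        using \<alpha>_id [of a "on_ob \<psi> a" "Ident R (on_ob \<psi> a)"] a
          by (simp add: obs phi.id psi.D.Ident_in_Hom)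
      then show "P M N (phi.E\<^sub>m M N \<eta>) a x = on_hom (restriction Q \<psi>) M N \<eta> a x"
        using a x mod_homD(2) [OF \<eta>, of "on_ob \<psi> a" x] N.act_id [of "on_ob \<psi> a" "\<eta> (on_ob \<psi> a) x"]
        by (simp add: P_def phi.E_map(2) [OF M N \<eta>] obs phi.D.Ident_in_Hom eps_ten [OF N])
    qed
    show "P M L (mod_comp (opp S) (phi.E M) g f) = mod_comp (opp Q) (on_ob (restriction Q \<psi>) M)
      (P N L g) (P M N f)"
      if L: "ab_module (opp R) L" and f: "f \<in> mod_hom (opp S) (phi.E M) (phi.E N)"
        and g: "g \<in> mod_hom (opp S) (phi.E N) (phi.E L)" for L f g
    proof (rule mod_hom_eqI [OF P_hom [OF M L mod_comp_hom [OF f g phi.E_module [OF M]]]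
          mod_comp_hom [OF P_hom [OF M N f] P_hom [OF N L g] psi.restriction_module [OF M]]])
      fix a x assume a: "a \<in> Ob (opp Q)" and x: "x \<in> carrier (on_ob (on_ob (restriction Q \<psi>) M) a)"
      have u: "unit M (on_ob \<psi> a) x \<in> carrier (phi.Ten M (\<phi>\<psi> a))"
        using x a by (simp add: unit_closed M obs)
      \<comment> \<open>This is \<open>eps_unit\<close> at the element f(x \<otimes> 1).\<close>
      then show "P M L (mod_comp (opp S) (phi.E M) g f) a x
          = mod_comp (opp Q) (on_ob (restriction Q \<psi>) M) (P N L g) (P M N f) a x"
        using a x mod_homD(2) [OF f, of "\<phi>\<psi> a" "unit M (on_ob \<psi> a) x"]
          eps_unit [OF N L g, of a "f (\<phi>\<psi> a) (unit M (on_ob \<psi> a) x)"]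
        by (simp add: P_def mod_comp_def compose_def obs M N eps_closed)
    qed
    show "P M' N' (mod_comp (opp S) (phi.E M') (phi.E\<^sub>m N N' v) (mod_comp (opp S) (phi.E M') h
      (phi.E\<^sub>m M' M u)))
        = mod_comp (opp Q) (on_ob (restriction Q \<psi>) M') (on_hom (restriction Q \<psi>) N N' v)
            (mod_comp (opp Q) (on_ob (restriction Q \<psi>) M') (P M N h) (on_hom (restriction Q \<psi>) M' M
              u))"
      if M': "ab_module (opp R) M'" and N': "ab_module (opp R) N'" and u: "u \<in> mod_hom (opp R) M' M"
        and v: "v \<in> mod_hom (opp R) N N'"
        and h: "h \<in> mod_hom (opp S) (phi.E M) (phi.E N)" for M' N' u v h
    proof -
      \<comment> \<open>The inner morphism is absorbed because E(u) sends x \<otimes> 1 to u(x)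
        \<otimes> 1, the outer one by \<open>eps_map\<close>.\<close>
      note Eu = phi.E_map(1) [OF M' M u] and Ev = phi.E_map(1) [OF N N' v]
      show ?thesis
      proof (rule mod_hom_eqI [OF P_hom [OF M' N' mod_comp_hom [OF mod_comp_hom [OF Eu h] Ev]]
            mod_comp_hom [OF mod_comp_hom [OF psi.restriction_map [OF M' u] P_hom [OF M N h]]
              psi.restriction_map [OF N v]]])
        fix a x assume a: "a \<in> Ob (opp Q)"
          and x: "x \<in> carrier (on_ob (on_ob (restriction Q \<psi>) M') a)"
        have ux: "u (on_ob \<psi> a) x \<in> carrier (on_ob M (on_ob \<psi> a))"
          using mod_homD(2) [OF u, of "on_ob \<psi> a" x] x a by (simp add: obs)
        have un: "unit M' (on_ob \<psi> a) x \<in> carrier (phi.Ten M' (\<phi>\<psi> a))" "unit M (on_ob \<psi> a)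
          (u (on_ob \<psi> a) x) \<in> carrier (phi.Ten M (\<phi>\<psi> a))"
          using x ux a by (simp_all add: unit_closed M M' obs)
        then have hu: "h (\<phi>\<psi> a) (unit M (on_ob \<psi> a) (u (on_ob \<psi> a) x)) \<in> carrier (phi.Ten N (\<phi>\<psi> a))"
          using mod_homD(2) [OF h, of "\<phi>\<psi> a"] a by (simp add: M N obs)
        show "P M' N' (mod_comp (opp S) (phi.E M') (phi.E\<^sub>m N N' v) (mod_comp (opp S) (phi.E M') h
          (phi.E\<^sub>m M' M u))) a x
          = mod_comp (opp Q) (on_ob (restriction Q \<psi>) M') (on_hom (restriction Q \<psi>) N N' v)
            (mod_comp (opp Q) (on_ob (restriction Q \<psi>) M') (P M N h) (on_hom (restriction Q \<psi>) M' M
              u)) a x"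
          using a x ux un hu phi.E_map(2) [OF M' M u, of "\<phi>\<psi> a" "on_ob \<psi> a" x "Ident S (\<phi>\<psi> a)"]
            eps_map [OF N N' v, of a]
          by (simp add: P_def mod_comp_def compose_def obs M M' N N' phi.D.Ident_in_Hom)
      qed (use phi.E_module psi.restriction_module M' in auto)
    qed
  qed
qed

end

section \<open>Transport and biproducts of modules\<close>

text \<open>Changes the type of values: group structure and action are carried along maps that are
  injective on the carriers and need not respect any structure. The injection may vary with the
  object, as the embeddings of the hom-sets R(a, b) do.\<close>

definition transport :: "('o \<Rightarrow> 'm \<Rightarrow> 'n) \<Rightarrow> ('o, 'a, 'm) modul \<Rightarrow> ('o, 'a, 'n) modul" where
  "transport i M = \<lparr>on_ob = (\<lambda>a. image_group (i a) (on_ob M a)),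
     on_hom = (\<lambda>a b f. \<lambda>y\<in>i a ` carrier (on_ob M a). i b
       (on_hom M a b f (inv_into (carrier (on_ob M a)) (i a) y)))\<rparr>"

lemma carrier_transport [simp]: "carrier (on_ob (transport i M) a) = i a ` carrier (on_ob M a)"
  by (simp add: transport_def image_group_def)

lemma one_transport [simp]: "\<one>\<^bsub>on_ob (transport i M) a\<^esub> = i a \<one>\<^bsub>on_ob M a\<^esub>"
  by (simp add: transport_def image_group_def)

lemma mult_transport:
  "\<lbrakk>inj_on (i a) (carrier (on_ob M a)); x \<in> carrier (on_ob M a); y \<in> carrier (on_ob M a)\<rbrakk>
   \<Longrightarrow> i a x \<otimes>\<^bsub>on_ob (transport i M) a\<^esub> i a y = i a (x \<otimes>\<^bsub>on_ob M a\<^esub> y)"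
  by (simp add: transport_def image_group_def)

lemma act_transport:
  "\<lbrakk>inj_on (i a) (carrier (on_ob M a)); x \<in> carrier (on_ob M a)\<rbrakk>
   \<Longrightarrow> on_hom (transport i M) a b f (i a x) = i b (on_hom M a b f x)"
  by (simp add: transport_def)

lemma transport_module:
  assumes M: "ab_module C M" and inj: "\<And>a. a \<in> Ob C \<Longrightarrow> inj_on (i a) (carrier (on_ob M a))"
  shows "ab_module C (transport i M)"
proof -
  interpret M: ab_module C M by fact
  have grp: "comm_group (on_ob (transport i M) a)" if a: "a \<in> Ob C" for a
    using comm_group.iso_imp_img_comm_group [OF M.grp inj_imp_image_group_iso [OF inj]] a
    by (simp add: transport_def image_group_def)
  show ?thesis
  proof (rule ab_moduleI)
    show "preadditive_category C" by unfold_locales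
    show "comm_group (on_ob (transport i M) a)" if a: "a \<in> Ob C" for a
      using that by (rule grp)
    fix a b f assume ab: "a \<in> Ob C" "b \<in> Ob C" and f: "f \<in> Hom C a b"
    note inja = mult_transport [where i = i and M = M, OF inj] act_transport [where i = i
      and M = M, OF inj]
    have mc: "x \<otimes>\<^bsub>on_ob M c\<^esub> y \<in> carrier (on_ob M c)"
      if "c \<in> Ob C" "x \<in> carrier (on_ob M c)" "y \<in> carrier (on_ob M c)" for c x y
      by (meson M.grp comm_group.axioms(2) group.is_monoid monoid.m_closed that)
    have "on_hom (transport i M) a b f \<in> hom (on_ob (transport i M) a) (on_ob (transport i M) b)"
      by (rule homI) (use ab f in \<open>auto simp: inja M.act_closed M.act_mult mc\<close>)
    moreover have "on_hom (transport i M) a b f \<in> extensional (carrier (on_ob (transport i M) a))"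
      by (simp add: transport_def image_group_def)
    ultimately show "on_hom (transport i M) a b f \<in> ext_hom (on_ob (transport i M) a)
      (on_ob (transport i M) b)"
      by (simp add: ext_hom_def)
  qed (auto simp: act_transport [where i = i and M = M, OF inj] mult_transport [where i = i
    and M = M, OF inj] M.act_id M.act_comp M.act_add M.act_closed)
qed

text \<open>The sum of two copies of M, still valued in pairs; \<open>biproduct_exists\<close>
  brings it back to the original type.\<close>

definition dsum :: "('o, 'a, 'm) modul \<Rightarrow> ('o, 'a, 'm \<times> 'm) modul" where
  "dsum M = \<lparr>on_ob = (\<lambda>a. on_ob M a \<times>\<times> on_ob M a),
     on_hom = (\<lambda>a b f. \<lambda>p\<in>carrier (on_ob M a \<times>\<times> on_ob M a). (on_hom M a b f (fst p), on_hom M a b f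
       (snd p)))\<rparr>"

lemma dsum_module:
  assumes M: "ab_module C M"
  shows "ab_module C (dsum M)"
proof -
  interpret M: ab_module C M by fact
  have grp: "comm_group (on_ob M a \<times>\<times> on_ob M a)" if a: "a \<in> Ob C" for a
  proof -
    interpret A: comm_group "on_ob M a" by (rule M.grp) fact
    show ?thesis
      by (rule group.group_comm_groupI [OF DirProd_group]) (auto simp: A.m_comm A.is_group)
  qed
  show ?thesis
  proof (rule ab_moduleI)
    show "preadditive_category C" by unfold_locales
    show "comm_group (on_ob (dsum M) a)" if a: "a \<in> Ob C" for a
      using grp [OF that] by (simp add: dsum_def)
    fix a b f assume ab: "a \<in> Ob C" "b \<in> Ob C" and f: "f \<in> Hom C a b"
    have "(\<lambda>p\<in>carrier (on_ob M a \<times>\<times> on_ob M a). (on_hom M a b f (fst p), on_hom M a b f (snd p)))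
        \<in> ext_hom (on_ob M a \<times>\<times> on_ob M a) (on_ob M b \<times>\<times> on_ob M b)"
      by (rule ext_hom_restrictI)
        (use comm_group.axioms(2) [OF grp] ab f in \<open>auto simp: M.act_closed M.act_mult\<close>)
    then show "on_hom (dsum M) a b f \<in> ext_hom (on_ob (dsum M) a) (on_ob (dsum M) b)"
      by (simp add: dsum_def)
  qed (auto simp: dsum_def M.act_closed M.act_id M.act_comp M.act_add)
qed

text \<open>An infinite type has an injection from its square, and transporting
  \<open>dsum M\<close> along it yields a biproduct with values in the same type, hence one to which
  a family such as \<open>P\<close> applies. The map \<open>n\<close> is the codiagonal, the sum of
  the two projections.\<close>

lemma biproduct_exists:
  fixes M :: "('o, 'a, 'm) modul"
  assumes inf: "infinite (UNIV :: 'm set)" and M: "ab_module C M"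
  obtains B :: "('o, 'a, 'm) modul" and i1 i2 p1 p2 n where "ab_module C B"
    "i1 \<in> mod_hom C M B" "i2 \<in> mod_hom C M B" "p1 \<in> mod_hom C B M" "p2 \<in> mod_hom C B M"
      "n \<in> mod_hom C B M"
    "\<forall>a\<in>Ob C. \<forall>x\<in>carrier (on_ob M a). p1 a (i1 a x) = x \<and> p1 a (i2 a x) = \<one>\<^bsub>on_ob M a\<^esub> \<and>
      p2 a (i1 a x) = \<one>\<^bsub>on_ob M a\<^esub> \<and> p2 a (i2 a x) = x \<and> n a (i1 a x) = x \<and> n a (i2 a x) = x"
    "\<forall>a\<in>Ob C. \<forall>y\<in>carrier (on_ob B a). n a y = p1 a y \<otimes>\<^bsub>on_ob M a\<^esub> p2 a y"
proof -
  interpret M: ab_module C M by fact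
  have "|UNIV \<times> UNIV :: ('m \<times> 'm) set| \<le>o |UNIV :: 'm set|"
    using card_of_Times_same_infinite [OF inf] ordIso_iff_ordLeq by blast
  then obtain pr :: "'m \<times> 'm \<Rightarrow> 'm" where pr: "inj pr"
    unfolding card_of_ordLeq [symmetric] by auto
  define B where "B = transport (\<lambda>_. pr) (dsum M)"
  have inj: "inj_on pr X" for X using pr inj_on_subset by blast
  have B: "ab_module C B"
    unfolding B_def by (rule transport_module [OF dsum_module [OF M] inj])
  interpret B: ab_module C B by (rule B)
  have cB: "carrier (on_ob B a) = pr ` (carrier (on_ob M a) \<times> carrier (on_ob M a))" for a
    by (simp add: B_def dsum_def)
  have mB: "pr (x, y) \<otimes>\<^bsub>on_ob B a\<^esub> pr (x', y') = pr (x \<otimes>\<^bsub>on_ob M a\<^esub> x', y \<otimes>\<^bsub>on_ob M a\<^esub> y')"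
    if "x \<in> carrier (on_ob M a)" "y \<in> carrier (on_ob M a)" "x' \<in> carrier (on_ob M a)" "y'
      \<in> carrier (on_ob M a)" for x y x' y' a
    using mult_transport [of "\<lambda>_. pr" a "dsum M" "(x, y)" "(x', y')"] that inj
      by (simp add: B_def dsum_def)
  have aB: "on_hom B a b f (pr (x, y)) = pr (on_hom M a b f x, on_hom M a b f y)"
    if "x \<in> carrier (on_ob M a)" "y \<in> carrier (on_ob M a)" for a b f x y
    using act_transport [of "\<lambda>_. pr" a "dsum M" "(x, y)" b f] that inj by (simp add: B_def dsum_def)
  have act_one: "on_hom M a b f \<one>\<^bsub>on_ob M a\<^esub> = \<one>\<^bsub>on_ob M b\<^esub>"
    if "a \<in> Ob C" "b \<in> Ob C" "f \<in> Hom C a b" for a b f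
    using hom_one [OF ext_hom_hom [OF M.act_ext_hom]] that comm_group.axioms(2) [OF M.grp] by blast
  have g: "group (on_ob M a)" "group (on_ob B a)" if "a \<in> Ob C" for a
    using that comm_group.axioms(2) M.grp B.grp by blast+
  have one: "\<one>\<^bsub>on_ob M a\<^esub> \<in> carrier (on_ob M a)" and mult: "\<lbrakk>x \<in> carrier (on_ob M a);
    y \<in> carrier (on_ob M a)\<rbrakk> \<Longrightarrow> x \<otimes>\<^bsub>on_ob M a\<^esub> y \<in> carrier (on_ob M a)"
    and l_one: "x \<in> carrier (on_ob M a) \<Longrightarrow> \<one>\<^bsub>on_ob M a\<^esub> \<otimes>\<^bsub>on_ob M a\<^esub> x = x"
    and r_one: "x \<in> carrier (on_ob M a) \<Longrightarrow> x \<otimes>\<^bsub>on_ob M a\<^esub> \<one>\<^bsub>on_ob M a\<^esub> = x"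
    if "a \<in> Ob C" for a x y
    using g(1) [OF that] by (simp_all add: group.is_monoid monoid.m_closed)
  have comm: "(x \<otimes>\<^bsub>on_ob M a\<^esub> y) \<otimes>\<^bsub>on_ob M a\<^esub> (x' \<otimes>\<^bsub>on_ob M a\<^esub> y') = (x \<otimes>\<^bsub>on_ob M a\<^esub> x')
    \<otimes>\<^bsub>on_ob M a\<^esub> (y \<otimes>\<^bsub>on_ob M a\<^esub> y')"
    if "a \<in> Ob C" "x \<in> carrier (on_ob M a)" "y \<in> carrier (on_ob M a)" "x' \<in> carrier (on_ob M a)" "y'
      \<in> carrier (on_ob M a)" for a x y x' y'
  proof -
    interpret comm_group "on_ob M a" by (rule M.grp) fact
    show ?thesis using that by (simp add: m_ac)
  qed
  define i1 where "i1 = (\<lambda>a\<in>Ob C. \<lambda>x\<in>carrier (on_ob M a). pr (x, \<one>\<^bsub>on_ob M a\<^esub>))"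
  define i2 where "i2 = (\<lambda>a\<in>Ob C. \<lambda>x\<in>carrier (on_ob M a). pr (\<one>\<^bsub>on_ob M a\<^esub>, x))"
  define p1 where "p1 = (\<lambda>a\<in>Ob C. \<lambda>y\<in>carrier (on_ob B a). fst (inv_into UNIV pr y))"
  define p2 where "p2 = (\<lambda>a\<in>Ob C. \<lambda>y\<in>carrier (on_ob B a). snd (inv_into UNIV pr y))"
  define n where "n = (\<lambda>a\<in>Ob C. \<lambda>y\<in>carrier (on_ob B a). fst (inv_into UNIV pr y)
    \<otimes>\<^bsub>on_ob M a\<^esub> snd (inv_into UNIV pr y))"
  have ip: "inv_into UNIV pr (pr z) = z" for z using pr by simp
  have pr_eq: "pr z = pr z' \<longleftrightarrow> z = z'" for z z' using pr by (rule inj_eq)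
  note rules = mB aB act_one one mult l_one r_one comm ip M.act_closed M.act_mult
  \<comment> \<open>One argument for the two projections and the codiagonal: each decodes the pair
    and applies an operation that is additive and compatible with the action.\<close>
  have proj: "(\<lambda>a\<in>Ob C. \<lambda>y\<in>carrier (on_ob B a). p a (inv_into UNIV pr y)) \<in> mod_hom C B M"
    if cl: "\<And>a x y. \<lbrakk>a \<in> Ob C; x \<in> carrier (on_ob M a); y \<in> carrier (on_ob M a)\<rbrakk>
      \<Longrightarrow> p a (x, y) \<in> carrier (on_ob M a)"
      and hm: "\<And>a x y x' y'. \<lbrakk>a \<in> Ob C; x \<in> carrier (on_ob M a); y \<in> carrier (on_ob M a);
        x' \<in> carrier (on_ob M a); y' \<in> carrier (on_ob M a)\<rbrakk>
        \<Longrightarrow> p a (x \<otimes>\<^bsub>on_ob M a\<^esub> x', y \<otimes>\<^bsub>on_ob M a\<^esub> y') = p a (x, y) \<otimes>\<^bsub>on_ob M a\<^esub> p a (x', y')"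
      and nat: "\<And>a b f x y. \<lbrakk>a \<in> Ob C; b \<in> Ob C; f \<in> Hom C a b; x \<in> carrier (on_ob M a);
        y \<in> carrier (on_ob M a)\<rbrakk>
        \<Longrightarrow> p b (on_hom M a b f x, on_hom M a b f y) = on_hom M a b f (p a (x, y))" for p
  proof (rule mod_homI)
    fix a assume a: "a \<in> Ob C"
    have "(\<lambda>y\<in>carrier (on_ob B a). p a (inv_into UNIV pr y)) \<in> ext_hom (on_ob B a) (on_ob M a)"
      by (rule ext_hom_restrictI) (use a in \<open>auto simp: cB rules cl hm g\<close>)
    then show "(\<lambda>a\<in>Ob C. \<lambda>y\<in>carrier (on_ob B a). p a (inv_into UNIV pr y)) a
      \<in> ext_hom (on_ob B a) (on_ob M a)"
      using a by simp
  qed (auto simp: cB rules nat pr_eq)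
  show thesis
  proof (rule that [OF B, of i1 i2 p1 p2 n])
    show "i1 \<in> mod_hom C M B" "i2 \<in> mod_hom C M B"
      by (rule mod_homI; auto simp: i1_def i2_def cB rules intro!: ext_hom_restrictI g)+
    show "p1 \<in> mod_hom C B M" "p2 \<in> mod_hom C B M" "n \<in> mod_hom C B M"
      unfolding p1_def p2_def n_def by (rule proj; simp add: rules)+
  qed (auto simp: i1_def i2_def p1_def p2_def n_def cB rules)
qed

section \<open>Additivity as a consequence of naturality\<close>

lemma mod_hom_add:
  assumes \<eta>: "\<eta> \<in> mod_hom C M N" and \<theta>: "\<theta> \<in> mod_hom C M N" and M: "ab_module C M"
    and N: "ab_module C N"
  shows "(\<lambda>a\<in>Ob C. \<lambda>x\<in>carrier (on_ob M a). \<eta> a x \<otimes>\<^bsub>on_ob N a\<^esub> \<theta> a x) \<in> mod_hom C M N"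
proof -
  interpret M: ab_module C M by fact
  interpret N: ab_module C N by fact
  show ?thesis
  proof (rule mod_homI)
    fix a assume a: "a \<in> Ob C"
    interpret K: comm_group "on_ob N a" by (rule N.grp [OF a])
    have "(\<lambda>x\<in>carrier (on_ob M a). \<eta> a x \<otimes>\<^bsub>on_ob N a\<^esub> \<theta> a x) \<in> ext_hom (on_ob M a) (on_ob N a)"
      by (intro restrict_ext_hom K.hom_group_mult ext_hom_hom mod_homD(1) [OF \<eta> a] mod_homD(1)
        [OF \<theta> a]
          comm_group.axioms(2) [OF M.grp] a)
    then show "(\<lambda>a\<in>Ob C. \<lambda>x\<in>carrier (on_ob M a). \<eta> a x \<otimes>\<^bsub>on_ob N a\<^esub> \<theta> a x) a
      \<in> ext_hom (on_ob M a) (on_ob N a)"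
      using a by simp
  qed (simp_all add: M.act_closed N.act_mult mod_homD(2,4) [OF \<eta>] mod_homD(2,4) [OF \<theta>])
qed

text \<open>Checked on pure tensors, the second clause by means of \<open>ten_one_left\<close>. In
  this form the biproduct identities survive the extension of scalars.\<close>

lemma (in add_functor) E_map_comp_id:
  assumes M: "ab_module (opp C) M" and N: "ab_module (opp C) N"
    and \<eta>: "\<eta> \<in> mod_hom (opp C) M N" and \<theta>: "\<theta> \<in> mod_hom (opp C) N M"
    and s: "s \<in> Ob D" and w: "w \<in> carrier (Ten M s)"
  shows "(\<And>a x. \<lbrakk>a \<in> Ob C; x \<in> carrier (on_ob M a)\<rbrakk> \<Longrightarrow> \<theta> a (\<eta> a x) = x) \<Longrightarrow> E\<^sub>m N M \<theta> s (E\<^sub>m M N \<eta> s w)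
    = w"
    and "(\<And>a x. \<lbrakk>a \<in> Ob C; x \<in> carrier (on_ob M a)\<rbrakk> \<Longrightarrow> \<theta> a (\<eta> a x) = \<one>\<^bsub>on_ob M a\<^esub>)
      \<Longrightarrow> E\<^sub>m N M \<theta> s (E\<^sub>m M N \<eta> s w) = \<one>\<^bsub>Ten M s\<^esub>"
proof -
  have s': "s \<in> Ob (opp D)" using s by simp
  have "E\<^sub>m M N \<eta> s \<in> hom (Ten M s) (Ten N s)" "E\<^sub>m N M \<theta> s \<in> hom (Ten N s) (Ten M s)"
    using mod_homD(1) [OF E_map(1) [OF M N \<eta>] s'] mod_homD(1) [OF E_map(1) [OF N M \<theta>] s']
    by (simp_all add: M N ext_hom_hom)
  from hom_compose [OF this]
  have h: "(\<lambda>w. E\<^sub>m N M \<theta> s (E\<^sub>m M N \<eta> s w)) \<in> hom (Ten M s) (Ten M s)"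
    by (simp add: comp_def)
  interpret T: comm_group "Ten M s" by (rule Ten_comm_group [OF M s])
  note maps = E_map(2) [OF M N \<eta>] E_map(2) [OF N M \<theta>] mod_homD(2) [OF \<eta>]
  show "E\<^sub>m N M \<theta> s (E\<^sub>m M N \<eta> s w) = w" if "\<And>a x. \<lbrakk>a \<in> Ob C; x \<in> carrier (on_ob M a)\<rbrakk>
    \<Longrightarrow> \<theta> a (\<eta> a x) = x"
    by (rule ten_hom_eqI [OF M s _ h, where h = "\<lambda>w. w"])
      (use that s w in \<open>simp_all add: T.is_group hom_ident maps\<close>)
  show "E\<^sub>m N M \<theta> s (E\<^sub>m M N \<eta> s w) = \<one>\<^bsub>Ten M s\<^esub>"
    if "\<And>a x. \<lbrakk>a \<in> Ob C; x \<in> carrier (on_ob M a)\<rbrakk> \<Longrightarrow> \<theta> a (\<eta> a x) = \<one>\<^bsub>on_ob M a\<^esub>"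
    by (rule ten_hom_eqI [OF M s _ h, where h = "\<lambda>w. \<one>\<^bsub>Ten M s\<^esub>"])
      (use that s w in \<open>simp_all add: T.is_group hom_def maps ten_one_left [OF M]\<close>)
qed

text \<open>The morphism \<open>h = E(i\<^sub>1) f + E(i\<^sub>2) g\<close> into \<open>E(N \<oplus> N)\<close> is carried to \<open>f\<close>, \<open>g\<close> and \<open>f + g\<close> by
  \<open>E(p\<^sub>1)\<close>, \<open>E(p\<^sub>2)\<close> and \<open>E(p\<^sub>1 + p\<^sub>2)\<close>, and \<open>P\<close> commutes with these three.\<close>

lemma (in scalar_tower) natural_imp_additive:
  fixes M N :: "('r, 'a, 'm) modul"
  assumes inf: "infinite (UNIV :: 'm set)"
    and P_hom: "\<And>(M :: ('r, 'a, 'm) modul) N h. \<lbrakk>ab_module (opp R) M; ab_module (opp R) N;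
      h \<in> mod_hom (opp S) (phi.E M) (phi.E N)\<rbrakk>
      \<Longrightarrow> P M N h \<in> mod_hom (opp Q) (on_ob (restriction Q \<psi>) M) (on_ob (restriction Q \<psi>) N)"
    and P_post: "\<And>M N N' v h. \<lbrakk>ab_module (opp R) M; ab_module (opp R) N; ab_module (opp R) N';
      v \<in> mod_hom (opp R) N N';
        h \<in> mod_hom (opp S) (phi.E M) (phi.E N)\<rbrakk>
      \<Longrightarrow> P M N' (mod_comp (opp S) (phi.E M) (phi.E\<^sub>m N N' v) h)
        = mod_comp (opp Q) (on_ob (restriction Q \<psi>) M) (on_hom (restriction Q \<psi>) N N' v) (P M N h)"
    and M: "ab_module (opp R) M" and N: "ab_module (opp R) N"
    and f: "f \<in> mod_hom (opp S) (phi.E M) (phi.E N)"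
      and g: "g \<in> mod_hom (opp S) (phi.E M) (phi.E N)"
    and k: "k \<in> mod_hom (opp S) (phi.E M) (phi.E N)"
    and kfg: "\<And>s w. \<lbrakk>s \<in> Ob S; w \<in> carrier (phi.Ten M s)\<rbrakk> \<Longrightarrow> k s w = f s w \<otimes>\<^bsub>phi.Ten N s\<^esub> g s w"
    and a: "a \<in> Ob Q" and x: "x \<in> carrier (on_ob M (on_ob \<psi> a))"
  shows "P M N k a x = P M N f a x \<otimes>\<^bsub>on_ob N (on_ob \<psi> a)\<^esub> P M N g a x"
proof -
  obtain B :: "('r, 'a, 'm) modul" and i1 i2 p1 p2 n where B: "ab_module (opp R) B"
    and i1: "i1 \<in> mod_hom (opp R) N B" and i2: "i2 \<in> mod_hom (opp R) N B"
    and p1: "p1 \<in> mod_hom (opp R) B N" and p2: "p2 \<in> mod_hom (opp R) B N"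
      and n: "n \<in> mod_hom (opp R) B N"
    and eqs: "\<forall>a\<in>Ob (opp R). \<forall>x\<in>carrier (on_ob N a). p1 a (i1 a x) = x \<and> p1 a (i2 a x)
      = \<one>\<^bsub>on_ob N a\<^esub> \<and>
      p2 a (i1 a x) = \<one>\<^bsub>on_ob N a\<^esub> \<and> p2 a (i2 a x) = x \<and> n a (i1 a x) = x \<and> n a (i2 a x) = x"
    and n_eq: "\<forall>a\<in>Ob (opp R). \<forall>y\<in>carrier (on_ob B a). n a y = p1 a y \<otimes>\<^bsub>on_ob N a\<^esub> p2 a y"
    by (rule biproduct_exists [OF inf N]) (rule that)
  define h where "h = (\<lambda>s\<in>Ob (opp S). \<lambda>w\<in>carrier (on_ob (phi.E M) s).
    mod_comp (opp S) (phi.E M) (phi.E\<^sub>m N B i1) f s w \<otimes>\<^bsub>on_ob (phi.E B) s\<^esub> mod_comp (opp S)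
      (phi.E M) (phi.E\<^sub>m N B i2) g s w)"
  note EM = phi.E_module [OF M] and EB = phi.E_module [OF B]
  have h: "h \<in> mod_hom (opp S) (phi.E M) (phi.E B)"
    unfolding h_def
    by (intro mod_hom_add mod_comp_hom [OF f] mod_comp_hom [OF g] phi.E_map(1) N B i1 i2 EM EB)
  have h_eq: "h s w = phi.E\<^sub>m N B i1 s (f s w) \<otimes>\<^bsub>phi.Ten B s\<^esub> phi.E\<^sub>m N B i2 s (g s w)"
    and fw: "f s w \<in> carrier (phi.Ten N s)" and gw: "g s w \<in> carrier (phi.Ten N s)"
    if "s \<in> Ob S" "w \<in> carrier (phi.Ten M s)" for s w
    using that mod_homD(2) [OF f, of s w] mod_homD(2) [OF g, of s w]
    by (simp_all add: h_def mod_comp_def compose_def M N B)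
  have comp: "phi.E\<^sub>m B N v s (h s w) = phi.E\<^sub>m B N v s (phi.E\<^sub>m N B i1 s (f s w))
    \<otimes>\<^bsub>phi.Ten N s\<^esub> phi.E\<^sub>m B N v s (phi.E\<^sub>m N B i2 s (g s w))"
    if v: "v \<in> mod_hom (opp R) B N" and s: "s \<in> Ob S" and w: "w \<in> carrier (phi.Ten M s)" for v s w
    using mod_homD(3) [OF phi.E_map(1) [OF B N v], of s] mod_homD(2) [OF phi.E_map(1)
      [OF N B i1], of s "f s w"]
      mod_homD(2) [OF phi.E_map(1) [OF N B i2], of s "g s w"] s w
    by (simp add: h_eq fw gw N B)
  \<comment> \<open>To be applied with \<open>v\<close> the two projections and the codiagonal, and
    \<open>j\<close> the morphisms \<open>f\<close>, \<open>g\<close> and \<open>k\<close>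
    respectively.\<close>
  have mc: "mod_comp (opp S) (phi.E M) (phi.E\<^sub>m B N v) h = j"
    if v: "v \<in> mod_hom (opp R) B N" and j: "j \<in> mod_hom (opp S) (phi.E M) (phi.E N)"
      and "\<And>s w. \<lbrakk>s \<in> Ob S; w \<in> carrier (phi.Ten M s)\<rbrakk> \<Longrightarrow> phi.E\<^sub>m B N v s (h s w) = j s w" for v j
    by (rule mod_hom_eqI [OF mod_comp_hom [OF h phi.E_map(1) [OF B N v] EM] j])
      (use that(3) in \<open>simp add: mod_comp_def compose_def M\<close>)
  note cancel = phi.E_map_comp_id [OF N B i1 p1] phi.E_map_comp_id [OF N B i2 p1] phi.E_map_comp_id
    [OF N B i1 p2]
    phi.E_map_comp_id [OF N B i2 p2] phi.E_map_comp_id [OF N B i1 n] phi.E_map_comp_id [OF N B i2 n]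
  have T: "\<one>\<^bsub>phi.Ten N s\<^esub> \<otimes>\<^bsub>phi.Ten N s\<^esub> w = w" "w \<otimes>\<^bsub>phi.Ten N s\<^esub> \<one>\<^bsub>phi.Ten N s\<^esub> = w"
    if "s \<in> Ob S" "w \<in> carrier (phi.Ten N s)" for s w
    using phi.Ten_group [OF N that(1)] that(2) by (simp_all add: group.is_monoid)
  have Pv: "P M N (mod_comp (opp S) (phi.E M) (phi.E\<^sub>m B N v) h) a x = v (on_ob \<psi> a) (P M B h a x)"
    if v: "v \<in> mod_hom (opp R) B N" for v
    unfolding P_post [OF M B N v h] using a x by (simp add: mod_comp_def compose_def)
  have "P M N f a x = p1 (on_ob \<psi> a) (P M B h a x)"
    by (subst Pv [OF p1, symmetric], subst mc [OF p1 f]) (simp_all add: comp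
      [OF p1] cancel fw gw eqs T)
  moreover have "P M N g a x = p2 (on_ob \<psi> a) (P M B h a x)"
    by (subst Pv [OF p2, symmetric], subst mc [OF p2 g]) (simp_all add: comp
      [OF p2] cancel fw gw eqs T)
  moreover have "P M N k a x = n (on_ob \<psi> a) (P M B h a x)"
    by (subst Pv [OF n, symmetric], subst mc [OF n k]) (simp_all add: comp
      [OF n] cancel fw gw eqs kfg)
  moreover have "P M B h a x \<in> carrier (on_ob B (on_ob \<psi> a))"
    using mod_homD(2) [OF P_hom [OF M B h], of a x] a x by simp
  ultimately show ?thesis
    using n_eq a by (simp add: obs)
qed

section \<open>Representable modules\<close>

context scalar_tower
begin

text \<open>With this functor, \<open>hom_module\<close> over \<open>opp R\<close> at b is the
  representable right module R(-, b), so no separate construction is called for.\<close>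

lemma add_functor_id_opp: "add_functor (opp R) (opp R) id_cfun"
proof -
  have "additive_functor (opp R) (opp R) id_cfun"
    by (auto simp: additive_functor_def is_functor_def hom_def psi.D.HomGrp_carrier
      psi.D.add_closed)
  then show ?thesis
    by (intro add_functor.intro add_functor_axioms.intro psi.D.preadditive_opp)
qed

text \<open>The maps \<open>\<iota> a b\<close> embed the hom-sets of R in the universe, which
  brings the representable modules into the domain of the functors. The conclusion is already in the
  elementwise form to which \<open>mod_hom_bimodule_iff\<close> reduces the existence of a bimodule
  morphism.\<close>

lemma heavily_separableD:
  fixes \<iota> :: "'r \<Rightarrow> 'r \<Rightarrow> 'a \<Rightarrow> 'm"
  assumes inf: "infinite (UNIV :: 'm set)"
    and inj: "\<And>a b. \<lbrakk>a \<in> Ob R; b \<in> Ob R\<rbrakk> \<Longrightarrow> inj_on (\<iota> a b) (Hom R a b)"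
    and sep: "heavily_separable (right_modules R :: (('r, 'a, 'm) modul, 'r \<Rightarrow> 'm \<Rightarrow> 'm) category)
      (right_modules S) (right_modules Q) (extension R S \<phi>) (restriction Q \<psi>)"
  shows "\<exists>\<alpha>. \<alpha> \<in> extensional (Ob Q \<times> Ob R) \<and>
    (\<forall>a\<in>Ob Q. \<forall>b\<in>Ob R. \<alpha> (a, b) \<in> ext_hom (HomGrp S (\<phi>\<psi> a) (on_ob \<phi> b)) (HomGrp R (on_ob \<psi> a) b)) \<and>
    (\<forall>a\<in>Ob Q. \<forall>a'\<in>Ob Q. \<forall>b\<in>Ob R. \<forall>b'\<in>Ob R. \<forall>q\<in>Hom Q a' a. \<forall>r\<in>Hom R b b'. \<forall>f\<in>Hom S (\<phi>\<psi> a)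
      (on_ob \<phi> b).
      \<alpha> (a', b') (Comp S (\<phi>\<psi> a') (on_ob \<phi> b) (on_ob \<phi> b') (on_hom \<phi> b b' r) (Comp S (\<phi>\<psi> a') (\<phi>\<psi> a)
        (on_ob \<phi> b) f (\<phi>\<psi>\<^sub>m a' a q)))
      = Comp R (on_ob \<psi> a') b b' r (Comp R (on_ob \<psi> a') (on_ob \<psi> a) b (\<alpha> (a, b) f)
        (on_hom \<psi> a' a q))) \<and>
    (\<forall>a\<in>Ob Q. \<forall>b\<in>Ob R. \<forall>r\<in>Hom R (on_ob \<psi> a) b. \<alpha> (a, b) (on_hom \<phi> (on_ob \<psi> a) b r) = r) \<and>
    (\<forall>a\<in>Ob Q. \<forall>b\<in>Ob R. \<forall>c\<in>Ob R. \<forall>f\<in>Hom S (\<phi>\<psi> a) (on_ob \<phi> b). \<forall>g\<in>Hom S (on_ob \<phi> b) (on_ob \<phi> c).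
      \<alpha> (a, c) (Comp S (\<phi>\<psi> a) (on_ob \<phi> b) (on_ob \<phi> c) g f)
          = \<alpha> (a, c) (Comp S (\<phi>\<psi> a) (on_ob \<phi> b) (on_ob \<phi> c) g (on_hom \<phi> (on_ob \<psi> a) b
            (\<alpha> (a, b) f))))"
proof -
  note S = phi.D.Ident_in_Hom phi.D.Comp_in_Hom phi.D.Comp_Ident_left phi.D.Comp_Ident_right
    phi.D.Comp_assoc phi.D.add_closed
  note R = psi.D.Ident_in_Hom psi.D.Comp_in_Hom psi.D.Comp_Ident_left psi.D.Comp_Ident_right
    psi.D.Comp_assoc psi.D.add_closed
  interpret op: add_functor "opp R" "opp R" id_cfun by (rule add_functor_id_opp)

  define Rep :: "'r \<Rightarrow> ('r, 'a, 'm) modul" where "Rep b = transport (\<lambda>a. \<iota> a b) (hom_module (opp R)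
    id_cfun b)" for b
  define \<kappa> where "\<kappa> a b = inv_into (Hom R a b) (\<iota> a b)" for a b
  have \<kappa>\<iota> [simp]: "\<kappa> a b (\<iota> a b r) = r" if "a \<in> Ob R" "b \<in> Ob R" "r \<in> Hom R a b" for a b r
    using that inj by (simp add: \<kappa>_def)
  have carR: "carrier (on_ob (Rep b) a) = \<iota> a b ` Hom R a b" if "a \<in> Ob R" "b \<in> Ob R" for a b
    using that by (simp add: Rep_def psi.D.HomGrp_carrier)
  have \<iota>: "\<iota> a b r \<in> carrier (on_ob (Rep b) a)" if "a \<in> Ob R" "b \<in> Ob R" "r \<in> Hom R a b" for a b r
    using that by (simp add: carR)
  have RepE: "\<exists>r\<in>Hom R a b. x = \<iota> a b r" if "a \<in> Ob R" "b \<in> Ob R" "x \<in> carrier (on_ob (Rep b) a)"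
    for a b x
    using that by (auto simp: carR)
  have \<kappa>: "\<kappa> a b x \<in> Hom R a b" and \<iota>\<kappa>: "\<iota> a b (\<kappa> a b x) = x"
    if "a \<in> Ob R" "b \<in> Ob R" "x \<in> carrier (on_ob (Rep b) a)" for a b x
    using that by (auto simp: carR)
  have Rep_mult: "\<iota> a b r \<otimes>\<^bsub>on_ob (Rep b) a\<^esub> \<iota> a b r' = \<iota> a b (r \<otimes>\<^bsub>HomGrp R a b\<^esub> r')"
    if "a \<in> Ob R" "b \<in> Ob R" "r \<in> Hom R a b" "r' \<in> Hom R a b" for a b r r'
    using mult_transport [of "\<lambda>a. \<iota> a b" a "hom_module (opp R) id_cfun b" r r'] that inj
    by (simp add: Rep_def psi.D.HomGrp_carrier)
  have Rep_act: "on_hom (Rep b) a a' q (\<iota> a b r) = \<iota> a' b (Comp R a' a b r q)"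
    if "a \<in> Ob R" "a' \<in> Ob R" "b \<in> Ob R" "r \<in> Hom R a b" "q \<in> Hom R a' a" for a a' b r q
    using act_transport [of "\<lambda>a. \<iota> a b" a "hom_module (opp R) id_cfun b" r a' q] that inj
    by (simp add: Rep_def psi.D.HomGrp_carrier)
  have Rep: "ab_module (opp R) (Rep b)" if "b \<in> Ob R" for b
    unfolding Rep_def
    by (rule transport_module [OF op.hmod_module]) (use that inj in \<open>simp_all add:
      psi.D.HomGrp_carrier\<close>)

  \<comment> \<open>The universal element of R(-, c): every other element is a translate of it. By
    balancedness each pure tensor over R(-, c) then becomes 1 \<otimes> t' with t' : s \<rightarrow>
    \<phi> c, as \<open>ten_Rep\<close> records.\<close>
  define e where "e c = \<iota> c c (Ident R c)" for c
  have e: "e c \<in> carrier (on_ob (Rep c) c)" if "c \<in> Ob R" for c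
    using that by (simp add: e_def \<iota> R)
  have ten_Rep: "phi.ten (Rep c) s a (\<iota> a c r) t = phi.ten (Rep c) s c (e c) (Comp S s (on_ob \<phi> a)
    (on_ob \<phi> c) (on_hom \<phi> a c r) t)"
    if "c \<in> Ob R" "a \<in> Ob R" "s \<in> Ob S" "r \<in> Hom R a c" "t \<in> Hom S s (on_ob \<phi> a)" for a c s r t
    using phi.ten_balanced [OF Rep, of c s a c r "e c" t] that e by (simp add: e_def Rep_act R)

  \<comment> \<open>The Yoneda image of r, postcomposition with r.\<close>
  define repm where "repm b c r = (\<lambda>a\<in>Ob R. \<lambda>x\<in>carrier (on_ob (Rep b) a). \<iota> a c
    (Comp R a b c r (\<kappa> a b x)))" for b c r
  have repm_eq: "repm b c r a (\<iota> a b q) = \<iota> a c (Comp R a b c r q)"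
    if "a \<in> Ob R" "b \<in> Ob R" "c \<in> Ob R" "q \<in> Hom R a b" for a b c q r
    using that by (simp add: repm_def \<iota>)
  have repm: "repm b c r \<in> mod_hom (opp R) (Rep b) (Rep c)" if b: "b \<in> Ob R" and c: "c \<in> Ob R"
    and r: "r \<in> Hom R b c" for b c r
  proof (rule mod_homI)
    interpret B: ab_module "opp R" "Rep b" by (rule Rep) fact
    fix a assume "a \<in> Ob (opp R)"
    then have a: "a \<in> Ob R" by simp
    have "(\<lambda>x\<in>carrier (on_ob (Rep b) a). \<iota> a c (Comp R a b c r (\<kappa> a b x)))
      \<in> ext_hom (on_ob (Rep b) a) (on_ob (Rep c) a)"
    proof (rule ext_hom_restrictI)
      show "group (on_ob (Rep b) a)" by (rule comm_group.axioms(2) [OF B.grp]) (simp add: a)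
      fix x assume x: "x \<in> carrier (on_ob (Rep b) a)"
      then show "\<iota> a c (Comp R a b c r (\<kappa> a b x)) \<in> carrier (on_ob (Rep c) a)"
        using a b c r by (simp add: \<iota> \<kappa> R)
      fix y assume y: "y \<in> carrier (on_ob (Rep b) a)"
      show "\<iota> a c (Comp R a b c r (\<kappa> a b (x \<otimes>\<^bsub>on_ob (Rep b) a\<^esub> y)))
          = \<iota> a c (Comp R a b c r (\<kappa> a b x)) \<otimes>\<^bsub>on_ob (Rep c) a\<^esub> \<iota> a c (Comp R a b c r (\<kappa> a b y))"
        using RepE [OF a b x] RepE [OF a b y] a b c r
        by (auto simp: Rep_mult R psi.D.Comp_add_right)
    qed
    then show "repm b c r a \<in> ext_hom (on_ob (Rep b) a) (on_ob (Rep c) a)"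
      using a by (simp add: repm_def)
    fix a' q x assume *: "a' \<in> Ob (opp R)" "q \<in> Hom (opp R) a a'" "x \<in> carrier (on_ob (Rep b) a)"
    then show "repm b c r a' (on_hom (Rep b) a a' q x) = on_hom (Rep c) a a' q (repm b c r a x)"
      using RepE [OF a b *(3)] a b c r by (auto simp: Rep_act repm_eq R)
  qed (simp add: repm_def)

  \<comment> \<open>Existence of the morphism induced by f. The formula depends on x \<otimes> t
    only through \<phi>(x) \<circ> t, the arrow s \<rightarrow> \<phi> b that this tensor
    represents; that is why it is balanced and natural in s.\<close>
  have "\<exists>\<eta>\<in>mod_hom (opp S) (phi.E (Rep b)) (phi.E (Rep c)). \<forall>s\<in>Ob S. \<forall>a\<in>Ob R. \<forall>x\<in>carrier
    (on_ob (Rep b) a). \<forall>t\<in>Hom S s (on_ob \<phi> a).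
      \<eta> s (phi.ten (Rep b) s a x t) = phi.ten (Rep c) s c (e c)
        (Comp S s (on_ob \<phi> b) (on_ob \<phi> c) f (Comp S s (on_ob \<phi> a) (on_ob \<phi> b)
          (on_hom \<phi> a b (\<kappa> a b x)) t))"
    if b: "b \<in> Ob R" and c: "c \<in> Ob R" and f: "f \<in> Hom S (on_ob \<phi> b) (on_ob \<phi> c)" for b c f
  proof (rule phi.E_hom_exists [OF Rep [OF b] phi.E_module [OF Rep [OF c]]])
    fix s a x y t assume *: "s \<in> Ob S" "a \<in> Ob R" "x \<in> carrier (on_ob (Rep b) a)"
      "y \<in> carrier (on_ob (Rep b) a)"
      and t: "t \<in> Hom S s (on_ob \<phi> a)"
    have "\<kappa> a b (x \<otimes>\<^bsub>on_ob (Rep b) a\<^esub> y) = \<kappa> a b x \<otimes>\<^bsub>HomGrp R a b\<^esub> \<kappa> a b y"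
      using RepE [OF *(2) b *(3)] RepE [OF *(2) b *(4)] * b by (auto simp: Rep_mult R)
    then show "phi.ten (Rep c) s c (e c)
        (Comp S s (on_ob \<phi> b) (on_ob \<phi> c) f (Comp S s (on_ob \<phi> a) (on_ob \<phi> b)
          (on_hom \<phi> a b (\<kappa> a b (x \<otimes>\<^bsub>on_ob (Rep b) a\<^esub> y))) t))
      = phi.ten (Rep c) s c (e c)
        (Comp S s (on_ob \<phi> b) (on_ob \<phi> c) f (Comp S s (on_ob \<phi> a) (on_ob \<phi> b)
          (on_hom \<phi> a b (\<kappa> a b x)) t))
       \<otimes>\<^bsub>on_ob (phi.E (Rep c)) s\<^esub> phi.ten (Rep c) s c (e c)
        (Comp S s (on_ob \<phi> b) (on_ob \<phi> c) f (Comp S s (on_ob \<phi> a) (on_ob \<phi> b)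
          (on_hom \<phi> a b (\<kappa> a b y)) t))"
      using * b c t f
      by (simp add: Rep e \<kappa> obs phi.arr phi.add S phi.D.Comp_add_left phi.D.Comp_add_right
        phi.ten_mult_right)
  next
    fix s a a' r x t assume *: "s \<in> Ob S" "a \<in> Ob R" "a' \<in> Ob R" "r \<in> Hom R a a'"
      "x \<in> carrier (on_ob (Rep b) a')"
      and t: "t \<in> Hom S s (on_ob \<phi> a)"
    have "\<kappa> a b (on_hom (Rep b) a' a r x) = Comp R a a' b (\<kappa> a' b x) r"
      using RepE [OF *(3) b *(5)] * b by (auto simp: Rep_act R)
    then show "phi.ten (Rep c) s c (e c)
        (Comp S s (on_ob \<phi> b) (on_ob \<phi> c) f (Comp S s (on_ob \<phi> a) (on_ob \<phi> b)
          (on_hom \<phi> a b (\<kappa> a b (on_hom (Rep b) a' a r x))) t))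
      = phi.ten (Rep c) s c (e c)
        (Comp S s (on_ob \<phi> b) (on_ob \<phi> c) f (Comp S s (on_ob \<phi> a') (on_ob \<phi> b)
          (on_hom \<phi> a' b (\<kappa> a' b x))
          (Comp S s (on_ob \<phi> a) (on_ob \<phi> a') (on_hom \<phi> a a' r) t)))"
      using * b c t f by (simp add: \<kappa> obs phi.arr phi.comp S)
  qed (use b c f in \<open>simp_all add: Rep e \<kappa> obs phi.arr S phi.ten_closed phi.D.Comp_add_right
    phi.ten_mult_right phi.E_act(2)\<close>)
  then obtain push where push: "\<And>b c f. \<lbrakk>b \<in> Ob R; c \<in> Ob R; f \<in> Hom S (on_ob \<phi> b) (on_ob \<phi> c)\<rbrakk>
      \<Longrightarrow> push b c f \<in> mod_hom (opp S) (phi.E (Rep b)) (phi.E (Rep c))"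
    and push_eq: "\<And>b c f s a x t. \<lbrakk>b \<in> Ob R; c \<in> Ob R; f \<in> Hom S (on_ob \<phi> b) (on_ob \<phi> c); s \<in> Ob S;
      a \<in> Ob R; x \<in> carrier (on_ob (Rep b) a); t \<in> Hom S s (on_ob \<phi> a)\<rbrakk>
      \<Longrightarrow> push b c f s (phi.ten (Rep b) s a x t) = phi.ten (Rep c) s c (e c)
        (Comp S s (on_ob \<phi> b) (on_ob \<phi> c) f (Comp S s (on_ob \<phi> a) (on_ob \<phi> b)
          (on_hom \<phi> a b (\<kappa> a b x)) t))"
    by metis

  \<comment> \<open>On arrows \<phi>(r) the induced morphism is the extension of a morphism of
    R-modules, so the value of \<open>P\<close> there is prescribed. This and the next two facts say
    that \<open>push\<close> is an additive functorial assignment.\<close>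
  have push_arr: "push b c (on_hom \<phi> b c r) = phi.E\<^sub>m (Rep b) (Rep c) (repm b c r)"
    if b: "b \<in> Ob R" and c: "c \<in> Ob R" and r: "r \<in> Hom R b c" for b c r
  proof (rule phi.E_hom_eqI [OF Rep [OF b] phi.E_module [OF Rep [OF c]]])
    show "push b c (on_hom \<phi> b c r) \<in> mod_hom (opp S) (phi.E (Rep b)) (phi.E (Rep c))"
      using b c r by (simp add: push phi.arr)
    show "phi.E\<^sub>m (Rep b) (Rep c) (repm b c r) \<in> mod_hom (opp S) (phi.E (Rep b)) (phi.E (Rep c))"
      using b c r by (intro phi.E_map(1) Rep repm)
    fix s a x t assume *: "s \<in> Ob S" "a \<in> Ob R" "x \<in> carrier (on_ob (Rep b) a)"
      and t: "t \<in> Hom S s (on_ob \<phi> a)"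
    then obtain p where p: "p \<in> Hom R a b" and x: "x = \<iota> a b p" using RepE b by blast
    have "phi.E\<^sub>m (Rep b) (Rep c) (repm b c r) s (phi.ten (Rep b) s a x t)
      = phi.ten (Rep c) s a (\<iota> a c (Comp R a b c r p)) t"
      using * b c r t p by (simp add: x phi.E_map(2) [OF Rep Rep repm] repm_eq)
    also have "\<dots> = phi.ten (Rep c) s c (e c) (Comp S s (on_ob \<phi> a) (on_ob \<phi> c)
      (on_hom \<phi> a c (Comp R a b c r p)) t)"
      using * b c r t p by (simp add: ten_Rep R)
    finally show "push b c (on_hom \<phi> b c r) s (phi.ten (Rep b) s a x t) = phi.E\<^sub>m (Rep b) (Rep c)
      (repm b c r) s (phi.ten (Rep b) s a x t)"
      using * b c r t
      using p by (simp add: x push_eq phi.arr phi.comp obs S)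
  qed

  have push_comp: "push b d (Comp S (on_ob \<phi> b) (on_ob \<phi> c) (on_ob \<phi> d) g f)
    = mod_comp (opp S) (phi.E (Rep b)) (push c d g) (push b c f)"
    if b: "b \<in> Ob R" and c: "c \<in> Ob R" and d: "d \<in> Ob R" and f: "f \<in> Hom S (on_ob \<phi> b) (on_ob \<phi> c)"
      and g: "g \<in> Hom S (on_ob \<phi> c) (on_ob \<phi> d)" for b c d f g
  proof (rule phi.E_hom_eqI [OF Rep [OF b] phi.E_module [OF Rep [OF d]]])
    show "push b d (Comp S (on_ob \<phi> b) (on_ob \<phi> c) (on_ob \<phi> d) g f)
      \<in> mod_hom (opp S) (phi.E (Rep b)) (phi.E (Rep d))"
      using b c d f g by (simp add: push obs S)
    show "mod_comp (opp S) (phi.E (Rep b)) (push c d g) (push b c f)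
      \<in> mod_hom (opp S) (phi.E (Rep b)) (phi.E (Rep d))"
      using b c d f g by (intro mod_comp_hom [OF push push] phi.E_module Rep)
    fix s a x t assume *: "s \<in> Ob S" "a \<in> Ob R" "x \<in> carrier (on_ob (Rep b) a)"
      and t: "t \<in> Hom S s (on_ob \<phi> a)"
    \<comment> \<open>The first morphism produces tensors with first factor \<open>e c\<close>, an
      identity, on which the second one merely composes with g.\<close>
    have "\<kappa> c c (e c) = Ident R c" using c by (simp add: e_def R)
    then show "push b d (Comp S (on_ob \<phi> b) (on_ob \<phi> c) (on_ob \<phi> d) g f) s (phi.ten (Rep b) s a x t)
        = mod_comp (opp S) (phi.E (Rep b)) (push c d g) (push b c f) s (phi.ten (Rep b) s a x t)"
      using * b c d f g t
      by (simp add: mod_comp_def compose_def Rep phi.ten_closed push_eq e obs \<kappa> phi.arr phi.id S)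
  qed

  have push_add: "push b c (f \<otimes>\<^bsub>HomGrp S (on_ob \<phi> b) (on_ob \<phi> c)\<^esub> g) s w = push b c f s w
    \<otimes>\<^bsub>phi.Ten (Rep c) s\<^esub> push b c g s w"
    if b: "b \<in> Ob R" and c: "c \<in> Ob R" and f: "f \<in> Hom S (on_ob \<phi> b) (on_ob \<phi> c)"
      and g: "g \<in> Hom S (on_ob \<phi> b) (on_ob \<phi> c)"
      and s: "s \<in> Ob S" and w: "w \<in> carrier (phi.Ten (Rep b) s)" for b c f g s w
  proof -
    interpret T: comm_group "phi.Ten (Rep c) s" by (rule phi.Ten_comm_group [OF Rep [OF c] s])
    have ph: "push b c k s \<in> hom (phi.Ten (Rep b) s) (phi.Ten (Rep c) s)"
      if "k \<in> Hom S (on_ob \<phi> b) (on_ob \<phi> c)" for k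
      using mod_homD(1) [OF push [OF b c that], of s] s by (simp add: Rep b c ext_hom_hom)
    have fg: "f \<otimes>\<^bsub>HomGrp S (on_ob \<phi> b) (on_ob \<phi> c)\<^esub> g \<in> Hom S (on_ob \<phi> b) (on_ob \<phi> c)"
      using b c f g by (simp add: S obs)
    show ?thesis
      by (rule phi.ten_hom_eqI [OF Rep [OF b] s T.is_group ph [OF fg] T.hom_group_mult
        [OF ph [OF f] ph [OF g]] _ w])
        (use b c f g s fg in \<open>simp add: push_eq Rep e \<kappa> obs phi.arr S phi.D.Comp_add_left
          phi.ten_mult_right\<close>)
  qed

  obtain P where P_fun: "\<forall>M\<in>Ob (right_modules R :: (('r, 'a, 'm) modul, 'r \<Rightarrow> 'm \<Rightarrow> 'm) category).
    \<forall>N\<in>Ob (right_modules R).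
      P M N \<in> mod_hom (opp S) (phi.E M) (phi.E N) \<rightarrow> mod_hom (opp Q) (on_ob (restriction Q \<psi>) M)
        (on_ob (restriction Q \<psi>) N)"
    and P_nat: "\<forall>M\<in>Ob (right_modules R). \<forall>M'\<in>Ob (right_modules R). \<forall>N\<in>Ob (right_modules R). \<forall>N'\<in>Ob
      (right_modules R).
      \<forall>u\<in>mod_hom (opp R) M' M. \<forall>v\<in>mod_hom (opp R) N N'. \<forall>h\<in>mod_hom (opp S) (phi.E M) (phi.E N).
        P M' N' (mod_comp (opp S) (phi.E M') (phi.E\<^sub>m N N' v) (mod_comp (opp S) (phi.E M') h
          (phi.E\<^sub>m M' M u)))
        = mod_comp (opp Q) (on_ob (restriction Q \<psi>) M') (on_hom (restriction Q \<psi>) N N' v)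
            (mod_comp (opp Q) (on_ob (restriction Q \<psi>) M') (P M N h) (on_hom (restriction Q \<psi>) M' M
              u))"
    and P_map: "\<forall>M\<in>Ob (right_modules R). \<forall>N\<in>Ob (right_modules R). \<forall>\<eta>\<in>mod_hom (opp R) M N.
      P M N (phi.E\<^sub>m M N \<eta>) = on_hom (restriction Q \<psi>) M N \<eta>"
    and P_comp: "\<forall>M\<in>Ob (right_modules R). \<forall>N\<in>Ob (right_modules R). \<forall>L\<in>Ob (right_modules R).
      \<forall>f\<in>mod_hom (opp S) (phi.E M) (phi.E N). \<forall>g\<in>mod_hom (opp S) (phi.E N) (phi.E L).
        P M L (mod_comp (opp S) (phi.E M) g f) = mod_comp (opp Q) (on_ob (restriction Q \<psi>) M)
          (P N L g) (P M N f)"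
    using sep unfolding heavily_separable_def right_modules_sel by (elim conjE exE) (rule that)
  note Ob = psi.D.Ob_right_modules [THEN iffD2]
  have P_hom: "P M N h \<in> mod_hom (opp Q) (on_ob (restriction Q \<psi>) M) (on_ob (restriction Q \<psi>) N)"
    if "ab_module (opp R) M" "ab_module (opp R) N" "h \<in> mod_hom (opp S) (phi.E M) (phi.E N)"
      for M N h
    using P_fun Ob [OF that(1)] Ob [OF that(2)] that(3) by blast
  \<comment> \<open>Multiplicativity with E(v) as the second factor, whose image under
    \<open>P\<close> is known.\<close>
  have P_post: "P M N' (mod_comp (opp S) (phi.E M) (phi.E\<^sub>m N N' v) h)
        = mod_comp (opp Q) (on_ob (restriction Q \<psi>) M) (on_hom (restriction Q \<psi>) N N' v) (P M N h)"
    if M: "ab_module (opp R) M" and N: "ab_module (opp R) N" and N': "ab_module (opp R) N'"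
      and v: "v \<in> mod_hom (opp R) N N'"
      and h: "h \<in> mod_hom (opp S) (phi.E M) (phi.E N)" for M N N' v h
    using P_comp [rule_format, OF Ob [OF M] Ob [OF N] Ob [OF N'] h phi.E_map(1) [OF N N' v]]
      P_map [rule_format, OF Ob [OF N] Ob [OF N'] v] by simp

  \<comment> \<open>\<open>\<pi>\<close> is the value in the transported module, \<alpha> its
    preimage in R(\<psi> a, b). The restrictions in \<alpha> make it extensional, as membership in
    \<open>mod_hom\<close> demands.\<close>
  define \<pi> where "\<pi> a b f = P (Rep (on_ob \<psi> a)) (Rep b) (push (on_ob \<psi> a) b f) a (e (on_ob \<psi> a))"
    for a b f
  define \<alpha> where "\<alpha> = (\<lambda>(a, b)\<in>Ob Q \<times> Ob R. \<lambda>f\<in>Hom S (\<phi>\<psi> a) (on_ob \<phi> b). \<kappa> (on_ob \<psi> a) b (\<pi> a b f))"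
  have \<pi>: "\<pi> a b f \<in> carrier (on_ob (Rep b) (on_ob \<psi> a))"
    if "a \<in> Ob Q" "b \<in> Ob R" "f \<in> Hom S (\<phi>\<psi> a) (on_ob \<phi> b)" for a b f
    using mod_homD(2) [OF P_hom [OF Rep Rep push], of "on_ob \<psi> a" b f a "e (on_ob \<psi> a)"] that
    by (simp add: \<pi>_def obs e)
  have \<alpha>_eq: "\<alpha> (a, b) f = \<kappa> (on_ob \<psi> a) b (\<pi> a b f)"
    and \<alpha>: "\<alpha> (a, b) f \<in> Hom R (on_ob \<psi> a) b" and \<iota>\<alpha>: "\<pi> a b f = \<iota> (on_ob \<psi> a) b (\<alpha> (a, b) f)"
    if "a \<in> Ob Q" "b \<in> Ob R" "f \<in> Hom S (\<phi>\<psi> a) (on_ob \<phi> b)" for a b f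
    using that \<pi> [OF that] by (simp_all add: \<alpha>_def \<kappa> \<iota>\<kappa> obs)

  have add: "\<alpha> (a, b) \<in> ext_hom (HomGrp S (\<phi>\<psi> a) (on_ob \<phi> b)) (HomGrp R (on_ob \<psi> a) b)"
    if a: "a \<in> Ob Q" and b: "b \<in> Ob R" for a b
  proof -
    have c: "carrier (HomGrp S (\<phi>\<psi> a) (on_ob \<phi> b)) = Hom S (\<phi>\<psi> a) (on_ob \<phi> b)"
      "carrier (HomGrp R (on_ob \<psi> a) b) = Hom R (on_ob \<psi> a) b"
      using a b by (simp_all add: phi.D.HomGrp_carrier psi.D.HomGrp_carrier obs)
    have "\<alpha> (a, b) \<in> hom (HomGrp S (\<phi>\<psi> a) (on_ob \<phi> b)) (HomGrp R (on_ob \<psi> a) b)"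
    proof (rule homI; unfold c)
      fix f assume f: "f \<in> Hom S (\<phi>\<psi> a) (on_ob \<phi> b)"
      then show "\<alpha> (a, b) f \<in> Hom R (on_ob \<psi> a) b" using \<alpha> a b by simp
      fix g assume g: "g \<in> Hom S (\<phi>\<psi> a) (on_ob \<phi> b)"
      have fg: "f \<otimes>\<^bsub>HomGrp S (\<phi>\<psi> a) (on_ob \<phi> b)\<^esub> g \<in> Hom S (\<phi>\<psi> a) (on_ob \<phi> b)"
        using a b f g by (simp add: S obs)
      have "\<pi> a b (f \<otimes>\<^bsub>HomGrp S (\<phi>\<psi> a) (on_ob \<phi> b)\<^esub> g) = \<pi> a b f \<otimes>\<^bsub>on_ob (Rep b) (on_ob \<psi> a)\<^esub> \<pi> a b
        g"
        unfolding \<pi>_def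
      proof (rule natural_imp_additive [where P = P, OF inf])
        show "ab_module (opp R) (Rep (on_ob \<psi> a))" "ab_module (opp R) (Rep b)"
          using a b by (simp_all add: Rep obs)
      qed (use a b f g fg in \<open>simp_all add: P_hom P_post push push_add e obs\<close>)
      then show "\<alpha> (a, b) (f \<otimes>\<^bsub>HomGrp S (\<phi>\<psi> a) (on_ob \<phi> b)\<^esub> g) = \<alpha> (a, b) f
        \<otimes>\<^bsub>HomGrp R (on_ob \<psi> a) b\<^esub> \<alpha> (a, b) g"
        using a b f g \<alpha>_eq [OF a b fg] by (simp add: \<iota>\<alpha> Rep_mult \<alpha> obs R)
    qed
    moreover have "\<alpha> (a, b) \<in> extensional (carrier (HomGrp S (\<phi>\<psi> a) (on_ob \<phi> b)))"
      using a b by (simp add: c \<alpha>_def)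
    ultimately show ?thesis by (simp add: ext_hom_def)
  qed

  have nat: "\<alpha> (a', b') (Comp S (\<phi>\<psi> a') (on_ob \<phi> b) (on_ob \<phi> b') (on_hom \<phi> b b' r)
    (Comp S (\<phi>\<psi> a') (\<phi>\<psi> a) (on_ob \<phi> b) f (\<phi>\<psi>\<^sub>m a' a q)))
      = Comp R (on_ob \<psi> a') b b' r (Comp R (on_ob \<psi> a') (on_ob \<psi> a) b (\<alpha> (a, b) f)
        (on_hom \<psi> a' a q))"
    if a: "a \<in> Ob Q" and a': "a' \<in> Ob Q" and b: "b \<in> Ob R" and b': "b' \<in> Ob R"
      and q: "q \<in> Hom Q a' a"
      and r: "r \<in> Hom R b b'" and f: "f \<in> Hom S (\<phi>\<psi> a) (on_ob \<phi> b)" for a a' b b' q r f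
  proof -
    let ?h = "Comp S (\<phi>\<psi> a') (on_ob \<phi> b) (on_ob \<phi> b') (on_hom \<phi> b b' r) (Comp S (\<phi>\<psi> a') (\<phi>\<psi> a)
      (on_ob \<phi> b) f (\<phi>\<psi>\<^sub>m a' a q))"
    let ?u = "repm (on_ob \<psi> a') (on_ob \<psi> a) (on_hom \<psi> a' a q)" and ?v = "repm b b' r"
    note ob = obs(1) [OF a] obs(1) [OF a'] b b' obs(2) [OF obs(1) [OF a]] obs(2)
      [OF obs(1) [OF a']] obs(2) [OF b] obs(2) [OF b']
    have q\<psi>: "on_hom \<psi> a' a q \<in> Hom R (on_ob \<psi> a') (on_ob \<psi> a)" by (rule psi.arr [OF a' a q])
    have Hs: "\<phi>\<psi>\<^sub>m a' a q \<in> Hom S (\<phi>\<psi> a') (\<phi>\<psi> a)" "on_hom \<phi> b b' r \<in> Hom S (on_ob \<phi> b) (on_ob \<phi> b')"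
      using ob q\<psi> r by (simp_all add: phi.arr)
    have h: "?h \<in> Hom S (\<phi>\<psi> a') (on_ob \<phi> b')" using ob Hs f by (simp add: S)
    note modules = Ob [OF Rep [OF obs(1) [OF a]]] Ob [OF Rep [OF obs(1) [OF a']]] Ob
      [OF Rep [OF b]] Ob [OF Rep [OF b']]
    \<comment> \<open>The outer factors \<phi>(r) and \<phi>(\<psi>(q)) come from R, so their
      induced morphisms are extensions and naturality of \<open>P\<close> takes them out.\<close>
    have "push (on_ob \<psi> a') b' ?h = mod_comp (opp S) (phi.E (Rep (on_ob \<psi> a'))) (phi.E\<^sub>m (Rep b)
      (Rep b') ?v)
        (mod_comp (opp S) (phi.E (Rep (on_ob \<psi> a'))) (push (on_ob \<psi> a) b f)
          (phi.E\<^sub>m (Rep (on_ob \<psi> a')) (Rep (on_ob \<psi> a)) ?u))"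
      using ob Hs f q\<psi> r by (simp add: push_comp push_arr [symmetric] phi.D.Comp_in_Hom)
    then have "\<pi> a' b' ?h = mod_comp (opp Q) (on_ob (restriction Q \<psi>) (Rep (on_ob \<psi> a')))
      (on_hom (restriction Q \<psi>) (Rep b) (Rep b') ?v)
            (mod_comp (opp Q) (on_ob (restriction Q \<psi>) (Rep (on_ob \<psi> a'))) (P (Rep (on_ob \<psi> a))
              (Rep b) (push (on_ob \<psi> a) b f))
              (on_hom (restriction Q \<psi>) (Rep (on_ob \<psi> a')) (Rep (on_ob \<psi> a)) ?u)) a'
                (e (on_ob \<psi> a'))"
      unfolding \<pi>_def
      using P_nat [rule_format, OF modules repm [OF ob(2,1) q\<psi>] repm [OF b b' r] push
        [OF ob(1) b f]] by simp
    also have "\<dots> = ?v (on_ob \<psi> a') (P (Rep (on_ob \<psi> a)) (Rep b) (push (on_ob \<psi> a) b f) a'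
      (?u (on_ob \<psi> a') (e (on_ob \<psi> a'))))"
      using a' ob by (simp add: mod_comp_def compose_def e)
    \<comment> \<open>The element \<psi>(q) is the identity of \<psi> a' postcomposed with
      \<psi>(q), and also the identity of \<psi> a translated by \<psi>(q). The second reading lets
      the value of \<open>P\<close>, a morphism of Q-modules, carry the evaluation from a' back to
      a.\<close>
    also have "?u (on_ob \<psi> a') (e (on_ob \<psi> a')) = on_hom (Rep (on_ob \<psi> a)) (on_ob \<psi> a) (on_ob \<psi> a')
      (on_hom \<psi> a' a q) (e (on_ob \<psi> a))"
      using ob q\<psi> by (simp add: e_def repm_eq Rep_act R)
    also have "P (Rep (on_ob \<psi> a)) (Rep b) (push (on_ob \<psi> a) b f) a' (on_hom (Rep (on_ob \<psi> a))
      (on_ob \<psi> a) (on_ob \<psi> a') (on_hom \<psi> a' a q) (e (on_ob \<psi> a)))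
        = on_hom (Rep b) (on_ob \<psi> a) (on_ob \<psi> a') (on_hom \<psi> a' a q) (\<pi> a b f)"
      using mod_homD(4) [OF P_hom [OF Rep [OF ob(1)] Rep [OF b] push [OF ob(1) b f]], of a a' q
        "e (on_ob \<psi> a)"] a a' q ob
      by (simp add: \<pi>_def e)
    also have "?v (on_ob \<psi> a') \<dots> = \<iota> (on_ob \<psi> a') b' (Comp R (on_ob \<psi> a') b b' r
      (Comp R (on_ob \<psi> a') (on_ob \<psi> a) b (\<alpha> (a, b) f) (on_hom \<psi> a' a q)))"
      using a b f ob q\<psi> r by (simp add: \<iota>\<alpha> Rep_act repm_eq R \<alpha>)
    finally show ?thesis
      using \<alpha>_eq [OF a' b' h] ob q\<psi> r \<alpha> [OF a b f] by (simp add: R)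
  qed

  \<comment> \<open>Here \<open>P\<close> returns the restriction of the Yoneda image of r, and
    evaluating that at the identity recovers r. This is condition (1).\<close>
  have repm_id: "\<pi> a b (on_hom \<phi> (on_ob \<psi> a) b r) = \<iota> (on_ob \<psi> a) b r"
    if a: "a \<in> Ob Q" and b: "b \<in> Ob R" and r: "r \<in> Hom R (on_ob \<psi> a) b" for a b r
    using P_map [rule_format, OF Ob [OF Rep [OF obs(1) [OF a]]] Ob [OF Rep [OF b]] repm
      [OF obs(1) [OF a] b r]] a b r
    by (simp add: \<pi>_def push_arr obs) (simp add: e_def repm_eq R obs)
  have id: "\<alpha> (a, b) (on_hom \<phi> (on_ob \<psi> a) b r) = r"
    if a: "a \<in> Ob Q" and b: "b \<in> Ob R" and r: "r \<in> Hom R (on_ob \<psi> a) b" for a b r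
    using \<alpha>_eq [OF a b, of "on_hom \<phi> (on_ob \<psi> a) b r"] that by (simp add: repm_id obs phi.arr)

  have \<pi>_comp: "\<pi> a c (Comp S (\<phi>\<psi> a) (on_ob \<phi> b) (on_ob \<phi> c) g f) = P (Rep b) (Rep c) (push b c g) a
    (\<pi> a b f)"
    if a: "a \<in> Ob Q" and b: "b \<in> Ob R" and c: "c \<in> Ob R" and f: "f \<in> Hom S (\<phi>\<psi> a) (on_ob \<phi> b)"
      and g: "g \<in> Hom S (on_ob \<phi> b) (on_ob \<phi> c)" for a b c f g
    using P_comp [rule_format, OF Ob [OF Rep [OF obs(1) [OF a]]] Ob [OF Rep [OF b]] Ob
      [OF Rep [OF c]] push [OF obs(1) [OF a] b f] push [OF b c g]] that
    by (simp add: \<pi>_def push_comp obs mod_comp_def compose_def e)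
  have comp: "\<alpha> (a, c) (Comp S (\<phi>\<psi> a) (on_ob \<phi> b) (on_ob \<phi> c) g f)
          = \<alpha> (a, c) (Comp S (\<phi>\<psi> a) (on_ob \<phi> b) (on_ob \<phi> c) g (on_hom \<phi> (on_ob \<psi> a) b
            (\<alpha> (a, b) f)))"
    if a: "a \<in> Ob Q" and b: "b \<in> Ob R" and c: "c \<in> Ob R" and f: "f \<in> Hom S (\<phi>\<psi> a) (on_ob \<phi> b)"
      and g: "g \<in> Hom S (on_ob \<phi> b) (on_ob \<phi> c)" for a b c f g
  proof -
    have \<phi>\<alpha>: "on_hom \<phi> (on_ob \<psi> a) b (\<alpha> (a, b) f) \<in> Hom S (\<phi>\<psi> a) (on_ob \<phi> b)"
      using that by (simp add: phi.arr obs \<alpha>)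
    \<comment> \<open>Both sides are the same map applied to \<open>\<pi> a b f\<close> and to
      \<open>\<pi>\<close> of \<phi>(\<alpha>(f)). These elements coincide: each is the embedded
      \<alpha>(f), the second by \<open>repm_id\<close>.\<close>
    have "\<pi> a c (Comp S (\<phi>\<psi> a) (on_ob \<phi> b) (on_ob \<phi> c) g f)
        = \<pi> a c (Comp S (\<phi>\<psi> a) (on_ob \<phi> b) (on_ob \<phi> c) g (on_hom \<phi> (on_ob \<psi> a) b (\<alpha> (a, b) f)))"
      unfolding \<pi>_comp [OF a b c f g] \<pi>_comp [OF a b c \<phi>\<alpha> g]
      using that by (simp add: repm_id \<iota>\<alpha> \<alpha>)
    then show ?thesis
      using that \<phi>\<alpha> by (simp add: \<alpha>_eq S obs)
  qed

  have "\<alpha> \<in> extensional (Ob Q \<times> Ob R)"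
    by (simp add: \<alpha>_def)
  with add nat id comp show ?thesis
    by (intro exI [of _ \<alpha>] conjI ballI)
qed

end

theorem theorem3p2:
  fixes Q :: "('q, 'b) preadditive" and R :: "('r, 'a) preadditive" and S :: "('s, 'c) preadditive"
    and \<psi> :: "('q, 'b, 'r, 'a) cfun" and \<phi> :: "('r, 'a, 's, 'c) cfun"
  assumes "infinite (UNIV :: 'u set)"
    and "preadditive_category Q" and "small TYPE('u) Q"
    and "preadditive_category R" and "small TYPE('u) R"
    and "preadditive_category S" and "small TYPE('u) S"
    and "additive_functor Q R \<psi>" and "additive_functor R S \<phi>"
  shows "heavily_separable
      (right_modules R :: (('r, 'a, 'u) modul, 'r \<Rightarrow> 'u \<Rightarrow> 'u) category)
      (right_modules S) (right_modules Q)
      (extension R S \<phi>) (restriction Q \<psi>)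
    \<longleftrightarrow>
    (\<exists>\<alpha> \<in> mod_hom (bimod_category R Q) (hom_bimodule R Q S (\<phi> \<circ>\<^sub>F \<psi>) \<phi>) (hom_bimodule R Q R \<psi> id_cfun).
      mod_comp (bimod_category R Q) (hom_bimodule R Q R \<psi> id_cfun) \<alpha> (functor_bimod_hom R Q \<phi> \<psi>)
        = mod_id (bimod_category R Q) (hom_bimodule R Q R \<psi> id_cfun) \<and>
      (\<forall>a \<in> Ob Q. \<forall>b \<in> Ob R. \<forall>c \<in> Ob R.
        \<forall>f \<in> Hom S (on_ob \<phi> (on_ob \<psi> a)) (on_ob \<phi> b). \<forall>g \<in> Hom S (on_ob \<phi> b) (on_ob \<phi> c).
          \<alpha> (a, c) (Comp S (on_ob \<phi> (on_ob \<psi> a)) (on_ob \<phi> b) (on_ob \<phi> c) g f)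
          = \<alpha> (a, c) (Comp S (on_ob \<phi> (on_ob \<psi> a)) (on_ob \<phi> b) (on_ob \<phi> c) g
              (on_hom \<phi> (on_ob \<psi> a) b (\<alpha> (a, b) f)))))"
    (is "?sep \<longleftrightarrow> (\<exists>\<alpha>\<in>?Hom. ?retr \<alpha> \<and> ?twist \<alpha>)")
proof -
  interpret psi: add_functor Q R \<psi>
    using assms by (intro add_functor.intro add_functor_axioms.intro)
  interpret phi: add_functor R S \<phi>
    using assms by (intro add_functor.intro add_functor_axioms.intro)
  interpret scalar_tower Q R S \<psi> \<phi> ..
  have "additive_functor Q S (\<phi> \<circ>\<^sub>F \<psi>)"
    by (auto simp: additive_functor_def is_functor_def hom_def psi.C.HomGrp_carrier phi.D.HomGrp_carrier obs
        psi.arr phi.arr psi.id phi.id psi.comp phi.comp psi.add phi.add)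
  then have A: "bimod_functors Q R S (\<phi> \<circ>\<^sub>F \<psi>) \<phi>"
    using assms by (intro bimod_functors.intro add_functor.intro add_functor_axioms.intro)
  have "additive_functor R R id_cfun"
    by (auto simp: additive_functor_def is_functor_def hom_def psi.D.HomGrp_carrier psi.D.add_closed)
  then have B: "bimod_functors Q R R \<psi> id_cfun"
    using assms by (intro bimod_functors.intro add_functor.intro add_functor_axioms.intro)
  note Hom_iff = mod_hom_bimodule_iff [OF A B, unfolded cfun_sel]
  \<comment> \<open>Both families are restricted to the same objects and carriers, so their equality
    is equality of values there.\<close>
  have retr_iff: "?retr \<alpha> \<longleftrightarrow> (\<forall>a\<in>Ob Q. \<forall>b\<in>Ob R. \<forall>r\<in>Hom R (on_ob \<psi> a) b. \<alpha> (a, b) (on_hom \<phi> (on_ob \<psi> a) b r) = r)" for \<alpha>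
    by (auto simp: mod_comp_def mod_id_def functor_bimod_hom_def bimod_category_sel compose_def fun_eq_iff
        hom_bimodule_def psi.D.HomGrp_carrier obs restrict_def split: if_splits)
  show ?thesis
  proof
    assume sep: ?sep
    from \<open>small TYPE('u) R\<close> obtain j :: "'r \<times> 'r \<times> 'a \<Rightarrow> 'u"
      where j: "inj_on j {(a, b, f). a \<in> Ob R \<and> b \<in> Ob R \<and> f \<in> Hom R a b}"
      unfolding small_def by blast
    \<comment> \<open>The embedding of all tagged arrows, with source and target held fixed, serves
      as \<open>\<iota> a b\<close>.\<close>
    have "inj_on (\<lambda>f. j (a, b, f)) (Hom R a b)" if "a \<in> Ob R" "b \<in> Ob R" for a b
      using j that by (auto simp: inj_on_def)
    from heavily_separableD [OF assms(1) this sep] show "\<exists>\<alpha>\<in>?Hom. ?retr \<alpha> \<and> ?twist \<alpha>"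
      unfolding Bex_def Hom_iff retr_iff conj_assoc .
  next
    assume "\<exists>\<alpha>\<in>?Hom. ?retr \<alpha> \<and> ?twist \<alpha>"
    then obtain \<alpha> where "\<alpha> \<in> ?Hom" "?retr \<alpha>" "?twist \<alpha>" by blast
    then show ?sep
      unfolding Hom_iff retr_iff by (intro heavily_separableI [of \<alpha>]) (auto intro: ext_hom_hom)
  qed
qed

end
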